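(* Let $\mathcal{X},\mathcal{Y},\mathcal{Z}$ be standard Borel spaces, let $X,Y,Z$ be random variables (on a common probability space) with values in $\mathcal{X},\mathcal{Y},\mathcal{Z}$ respectively, and let $W:=(X,Z)$, an $\mathcal{X}\times\mathcal{Z}$-valued random variable. Fix Borel isomorphisms $\varphi$ of $\mathcal{X}$, $\psi$ of $\mathcal{Y}$ and $\delta$ of $\mathcal{X}\times\mathcal{Z}$, and let $(X_1,Y_1,Z_1),(X_2,Y_2,Z_2),\ldots$ be i.i.d. copies of $(X,Y,Z)$, $W_i=(X_i,Z_i)$. Define $\xi_n(X,Y):=\xi_n(\varphi(X),\psi(Y))$ computed from $(\varphi(X_i),\psi(Y_i))_{i\le n}$ and $\xi_n(W,Y):=\xi_n(\delta(W),\psi(Y))$ computed from $(\delta(W_i),\psi(Y_i))_{i\le n}$, and set $\xi_n(Z,Y\mid X):=\dfrac{\xi_n(W,Y)-\xi_n(X,Y)}{1-\xi_n(X,Y)}$ (undefined if the denominator is $0$). Suppose $Y$ is not almost surely equal to a measurable function of $X$. Then as $n\to\infty$, $\xi_n(Z,Y\mid X)$ converges almost surely to a deterministic limit $\xi(Z,Y\mid X)\in[0,1]$; moreover $\xi(Z,Y\mid X)=0$ if and only if $Y$ and $Z$ are conditionally independent given $X$, and $\xi(Z,Y\mid X)=1$ if and only if there is a measurable $g:\mathcal{X}\times\mathcal{Z}\to\mathcal{Y}$ with $Y=g(X,Z)$ almost surely.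
   Context: A standard Borel space is a measurable space isomorphic (via a measurable bijection with measurable inverse) to a Borel subset of a Polish space. A Borel isomorphism of a standard Borel space $\mathcal{X}$ is an injective measurable map $\varphi:\mathcal{X}\to\mathbb{R}$ with $\varphi(\mathcal{X})$ Borel and $\varphi^{-1}$ measurable on $\varphi(\mathcal{X})$. Definition of $\xi_n$ for real data: given real pairs $(X_1,Y_1),\ldots,(X_n,Y_n)$, $n\ge2$, rearrange them as $(X_{(1)},Y_{(1)}),\ldots,(X_{(n)},Y_{(n)})$ with $X_{(1)}\le\cdots\le X_{(n)}$, where $Y_{(i)}$ is the $Y$-value paired with $X_{(i)}$, ties among the $X_i$ being broken uniformly at random. Let $r_i=\#\{j: Y_{(j)}\le Y_{(i)}\}$ and $l_i=\#\{j:Y_{(j)}\ge Y_{(i)}\}$. Then $\xi_n=1-\dfrac{n\sum_{i=1}^{n-1}|r_{i+1}-r_i|}{2\sum_{i=1}^n l_i(n-l_i)}$. *)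

theory Defs
  imports "HOL-Probability.Probability"
begin

definition standard_borel :: "'p::polish_space itself \<Rightarrow> 'a measure \<Rightarrow> bool" where
  "standard_borel _ M \<longleftrightarrow>
     (\<exists>(f::'a \<Rightarrow> 'p) B. B \<in> sets borel \<and> bij_betw f (space M) B \<and>
        f \<in> M \<rightarrow>\<^sub>M restrict_space borel B \<and>
        the_inv_into (space M) f \<in> restrict_space borel B \<rightarrow>\<^sub>M M)"

definition borel_iso :: "'a measure \<Rightarrow> ('a \<Rightarrow> real) \<Rightarrow> bool" where
  "borel_iso M \<phi> \<longleftrightarrow>
     inj_on \<phi> (space M) \<and> \<phi> \<in> M \<rightarrow>\<^sub>M borel \<and> \<phi> ` space M \<in> sets borel \<and>
     the_inv_into (space M) \<phi> \<in> restrict_space borel (\<phi> ` space M) \<rightarrow>\<^sub>M M"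

text \<open>Chatterjee's xi_n computed from the first n data points (indices 0..<n), x i, y i.
  Ties among the x-values are broken by the auxiliary tags u i (the sort is stable, so sorting
  by u first and then by x yields the lexicographic order on (x i, u i)).
  If the tags are i.i.d. continuous and independent of the data, this breaks ties uniformly at random.\<close>
definition chatterjee_xi :: "nat \<Rightarrow> (nat \<Rightarrow> real) \<Rightarrow> (nat \<Rightarrow> real) \<Rightarrow> (nat \<Rightarrow> real) \<Rightarrow> real" where
  "chatterjee_xi n x y u =
     (let s = sort_key x (sort_key u [0..<n]);
          r = (\<lambda>k. real (card {j. j < n \<and> y (s ! j) \<le> y (s ! k)}));
          l = (\<lambda>k. real (card {j. j < n \<and> y (s ! j) \<ge> y (s ! k)}))
      in 1 - (real n * (\<Sum>k<n - 1. \<bar>r (k + 1) - r k\<bar>)) /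
             (2 * (\<Sum>k<n. l k * (real n - l k))))"

text \<open>Conditional coefficient xi_n(Z,Y|X) from xi_n(X,Y) = a and xi_n(W,Y) = b
  (division by zero yields 0 in HOL; the paper leaves it undefined).\<close>
definition xi_cond :: "real \<Rightarrow> real \<Rightarrow> real" where
  "xi_cond a b = (b - a) / (1 - a)"

definition cond_indep :: "'a measure \<Rightarrow> 'x measure \<Rightarrow> 'y measure \<Rightarrow> 'z measure \<Rightarrow>
    ('a \<Rightarrow> 'x) \<Rightarrow> ('a \<Rightarrow> 'y) \<Rightarrow> ('a \<Rightarrow> 'z) \<Rightarrow> bool" where
  "cond_indep M MX MY MZ X Y Z \<longleftrightarrow>
     (\<forall>A\<in>sets MY. \<forall>B\<in>sets MZ.
        AE \<omega> in M.
          real_cond_exp M (vimage_algebra (space M) X MX)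
             (\<lambda>\<omega>. indicator A (Y \<omega>) * indicator B (Z \<omega>)) \<omega> =
          real_cond_exp M (vimage_algebra (space M) X MX) (\<lambda>\<omega>. indicator A (Y \<omega>)) \<omega> *
          real_cond_exp M (vimage_algebra (space M) X MX) (\<lambda>\<omega>. indicator B (Z \<omega>)) \<omega>)"

end

(*
  The denominators of xi_n(X,Y) and xi_n(W,Y) are equal because they do not depend on the order of
  the sample, so xi_n(Z,Y|X) = 1 - R_n(W)/R_n(X) with R_n the sum of the rank increments along the
  sorted sample.  R_n is the sum over m of the variation of 1{y_m <= y} along the sorted sample, so
  changing one observation changes R_n/n^2 by O(1/n), and McDiarmid's inequality reduces almost sure
  convergence to convergence of the mean.  For a fixed threshold t, given keys and tags the
  responses are independent, and 1{t <= y_i} may be replaced by g(x_i) with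
  g(x) = P(Y >= t | X = x).  The variation of a bounded Borel function along n sorted keys is o(n)
  in mean, as one sees by approximating it in L1 by functions of bounded variation.  Hence
  R_n(X)/n^2 tends to the integral of 2 E Var(1{Y >= t} | X) over the law of Y.  This limit vanishes
  iff Y is a function of X, and the limit for X minus the limit for W is the integral of
  2 E (P(Y >= t | W) - P(Y >= t | X))^2, which vanishes iff Y and Z are independent given X.
*)

theory Submission
  imports Defs
begin

section \<open>Rank variation along a sorted sample\<close>

text \<open>Three obstacles shape the argument. Each observation is stored as a triple of key,
  response and tag, so that the order of the sample, ties included, is a function of i.i.d. triples;
  this lets McDiarmid's inequality see the tie-breaking and lets one condition on the order. The
  thresholds of \<open>R_n\<close> are themselves responses of the sample, so a threshold
  \<open>y_m\<close> is not independent of the variation that it measures. Leaving \<open>m\<close>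
  out of the sorted list costs at most 2 per threshold, hence 2/n after normalization, and makes the
  two independent. Finally, the limit averages over thresholds drawn from the law of Y, so its
  vanishing, or the equality of two limits, says something about almost every value of Y and nothing
  directly about a threshold outside the support. Passing to all half-lines and then to all Borel
  sets is a separate argument. The conditional tail probabilities are chosen for each t separately,
  so measurability of the limit in t has to be recovered from the finite-sample means.\<close>

fun consec_sum :: "('i \<Rightarrow> 'i \<Rightarrow> real) \<Rightarrow> 'i list \<Rightarrow> real" where
  "consec_sum F [] = 0"
| "consec_sum F [i] = 0"
| "consec_sum F (i # j # l) = F i j + consec_sum F (j # l)"

abbreviation variation :: "('i \<Rightarrow> real) \<Rightarrow> 'i list \<Rightarrow> real" where
  "variation f \<equiv> consec_sum (\<lambda>i j. \<bar>f j - f i\<bar>)"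

lemma consec_sum_conv_nth: "consec_sum F l = (\<Sum>k<length l - 1. F (l ! k) (l ! (k + 1)))"
proof (induction l rule: induct_list012)
  case (3 i j l)
  then show ?case by (simp add: sum.lessThan_Suc_shift del: sum.lessThan_Suc)
qed auto

lemma consec_sum_cong:
  assumes "\<And>i j. i \<in> set l \<Longrightarrow> j \<in> set l \<Longrightarrow> F i j = G i j"
  shows "consec_sum F l = consec_sum G l"
  using assms by (induction l rule: induct_list012) auto

lemma consec_sum_mono:
  assumes "\<And>i j. i \<in> set l \<Longrightarrow> j \<in> set l \<Longrightarrow> F i j \<le> G i j"
  shows "consec_sum F l \<le> consec_sum G l"
  using assms by (induction l rule: induct_list012) (auto intro!: add_mono)

lemma consec_sum_add: "consec_sum (\<lambda>i j. F i j + G i j) l = consec_sum F l + consec_sum G l"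
  by (induction l rule: induct_list012) auto

lemma consec_sum_cmult: "consec_sum (\<lambda>i j. c * F i j) l = c * consec_sum F l"
  by (induction l rule: induct_list012) (auto simp: algebra_simps)

lemma consec_sum_nonneg:
  assumes "\<And>i j. 0 \<le> F i j"
  shows "0 \<le> consec_sum F l"
  using assms by (induction l rule: induct_list012) auto

lemma consec_sum_le_length:
  assumes "\<And>i j. F i j \<le> 1"
  shows "consec_sum F l \<le> length l"
proof (induction l rule: induct_list012)
  case (3 i j l)
  then show ?case using assms[of i j] by auto
qed auto

text \<open>Only the increments next to \<open>m\<close> disappear, and the one joining its
  neighbours takes their place. For values in the unit interval the change is at most 2, attained by
  a single spike.\<close>

lemma variation_delete:
  assumes "\<And>i. 0 \<le> f i" "\<And>i. f i \<le> 1"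
  shows "\<bar>variation f (as @ m # bs) - variation f (as @ bs)\<bar> \<le> 2"
proof (induction as rule: induct_list012)
  case 1
  show ?case
    using assms[of m] assms[of "hd bs"] by (cases bs) auto
next
  case (2 a)
  show ?case
    using assms[of m] assms[of "hd bs"] assms[of a] by (cases bs) auto
next
  case (3 a a' as)
  then show ?case by simp
qed

lemma variation_diff_le:
  "variation f l \<le> variation g l + 2 * (\<Sum>i\<leftarrow>l. \<bar>f i - g i\<bar>)"
proof -
  \<comment> \<open>The subtracted term records that the deviation at the head has entered only one
    increment so far. Its second share pays for the increment to the next element put in
    front.\<close>
  have "variation f l \<le> variation g l + 2 * (\<Sum>i\<leftarrow>l. \<bar>f i - g i\<bar>) - (if l = [] then 0 else \<bar>f (hd l) - g (hd l)\<bar>)"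
  proof (induction l rule: induct_list012)
    case (3 i j l)
    have "\<bar>f j - f i\<bar> \<le> \<bar>g j - g i\<bar> + \<bar>f j - g j\<bar> + \<bar>f i - g i\<bar>" by linarith
    with 3 show ?case by simp
  qed auto
  then show ?thesis by (auto split: if_splits)
qed

lemma variation_mono_le:
  fixes f :: "'i \<Rightarrow> real"
  assumes "sorted (map x l)" "antimono h" "\<And>s. 0 \<le> h s" "\<And>s. h s \<le> 1"
  shows "variation (\<lambda>i. h (x i)) l \<le> 1"
proof -
  \<comment> \<open>All increments have the same sign, so the sum telescopes; the value at the first
    key is the bound that survives the induction.\<close>
  have "variation (\<lambda>i. h (x i)) l \<le> (if l = [] then 0 else h (x (hd l)))"
    using assms(1)
  proof (induction l rule: induct_list012)
    case (3 i j l)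
    then have "h (x j) \<le> h (x i)" using assms(2) by (auto simp: antimono_def)
    then show ?case using 3 by auto
  qed (use assms in auto)
  then show ?thesis using assms(4) by (auto split: if_splits intro: order_trans)
qed

section \<open>Lexicographic sorting and deletion of one index\<close>

definition lex_sort :: "(nat \<Rightarrow> real) \<Rightarrow> (nat \<Rightarrow> real) \<Rightarrow> nat list \<Rightarrow> nat list" where
  "lex_sort x u l = sort_key x (sort_key u l)"

lemma set_lex_sort [simp]: "set (lex_sort x u l) = set l"
  and length_lex_sort [simp]: "length (lex_sort x u l) = length l"
  and distinct_lex_sort [simp]: "distinct (lex_sort x u l) = distinct l"
  and sorted_lex_sort: "sorted (map x (lex_sort x u l))"
  by (simp_all add: lex_sort_def)

lemma sum_list_lex_sort: "(\<Sum>i\<leftarrow>lex_sort x u l. f i) = (\<Sum>i\<leftarrow>l. (f i :: real))"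
proof -
  have "mset (lex_sort x u l) = mset l" by (simp add: lex_sort_def)
  then show ?thesis by (metis mset_map sum_mset_sum_list)
qed

lemma insort_key_cong:
  assumes "f i = g i" "\<And>j. j \<in> set l \<Longrightarrow> f j = g j"
  shows "insort_key f i l = insort_key g i l"
  using assms by (induction l) auto

lemma sort_key_cong:
  assumes "\<And>i. i \<in> set l \<Longrightarrow> f i = g i"
  shows "sort_key f l = sort_key g l"
  using assms by (induction l) (auto intro!: insort_key_cong)

lemma lex_sort_cong:
  assumes "\<And>i. i \<in> set l \<Longrightarrow> x i = x' i" "\<And>i. i \<in> set l \<Longrightarrow> u i = u' i"
  shows "lex_sort x u l = lex_sort x' u' l"
  unfolding lex_sort_def using assms by (metis set_sort sort_key_cong)

text \<open>A stable sort commutes with filtering, so leaving out one index takes it out of the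
  sorted list without rearranging the others. This is why \<open>lex_sort\<close> takes the list of
  indices as an argument instead of the sample size.\<close>

lemma lex_sort_delete:
  assumes "distinct l" "m \<in> set l"
  obtains as bs where "lex_sort x u l = as @ m # bs" "lex_sort x u (filter (\<lambda>i. i \<noteq> m) l) = as @ bs"
proof -
  obtain as bs where *: "lex_sort x u l = as @ m # bs"
    using assms by (metis set_lex_sort split_list)
  then have "m \<notin> set as" "m \<notin> set bs"
    using assms(1) distinct_lex_sort[of x u l] by auto
  then have "filter (\<lambda>i. i \<noteq> m) as = as" "filter (\<lambda>i. i \<noteq> m) bs = bs"
    by (auto simp: filter_id_conv)
  then have "filter (\<lambda>i. i \<noteq> m) (lex_sort x u l) = as @ bs"
    unfolding * by simp
  then have "lex_sort x u (filter (\<lambda>i. i \<noteq> m) l) = as @ bs"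
    by (simp add: lex_sort_def filter_sort)
  with * that show thesis by blast
qed

lemma variation_lex_sort_delete:
  assumes "distinct l" "m \<in> set l" "\<And>i. 0 \<le> f i" "\<And>i. f i \<le> 1"
  shows "\<bar>variation f (lex_sort x u l) - variation f (lex_sort x u (filter (\<lambda>i. i \<noteq> m) l))\<bar> \<le> 2"
proof -
  obtain as bs where "lex_sort x u l = as @ m # bs" "lex_sort x u (filter (\<lambda>i. i \<noteq> m) l) = as @ bs"
    using lex_sort_delete[OF assms(1,2)] by metis
  then show ?thesis using variation_delete[of f as m bs] assms(3,4) by simp
qed

section \<open>Numerator and denominator of the coefficient\<close>

definition xi_num :: "nat \<Rightarrow> (nat \<Rightarrow> real) \<Rightarrow> (nat \<Rightarrow> real) \<Rightarrow> (nat \<Rightarrow> real) \<Rightarrow> real" where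
  "xi_num n x y u = (\<Sum>m<n. variation (\<lambda>i. of_bool (y m \<le> y i)) (lex_sort x u [0..<n]))"

definition xi_den :: "nat \<Rightarrow> (nat \<Rightarrow> real) \<Rightarrow> real" where
  "xi_den n y = (\<Sum>i<n. real (card {j. j < n \<and> y j \<ge> y i}) * (real n - real (card {j. j < n \<and> y j \<ge> y i})))"

lemma bij_betw_nth_lex_sort: "bij_betw ((!) (lex_sort x u [0..<n])) {..<n} {..<n}"
  by (rule bij_betw_nth) auto

lemma card_nth_lex_sort:
  "card {j. j < n \<and> P (lex_sort x u [0..<n] ! j)} = card {j. j < n \<and> P j}"
proof (rule bij_betw_same_card[of "(!) (lex_sort x u [0..<n])"])
  have b: "bij_betw ((!) (lex_sort x u [0..<n])) {..<n} {..<n}" by (rule bij_betw_nth_lex_sort)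
  show "bij_betw ((!) (lex_sort x u [0..<n])) {j. j < n \<and> P (lex_sort x u [0..<n] ! j)} {j. j < n \<and> P j}"
    using b unfolding bij_betw_def inj_on_def
    by (auto simp: image_iff set_eq_iff) (metis lessThan_iff)
qed

text \<open>The sets of \<open>m\<close> with \<open>y m \<le> s\<close> are nested in
  \<open>s\<close>, so all differences of indicators have the same sign and the absolute value
  passes through the sum.\<close>

lemma rank_diff:
  fixes y :: "nat \<Rightarrow> real"
  shows "\<bar>real (card {m. m < n \<and> y m \<le> y j}) - real (card {m. m < n \<and> y m \<le> y i})\<bar>
    = (\<Sum>m<n. \<bar>of_bool (y m \<le> y j) - of_bool (y m \<le> y i)\<bar>)"
proof -
  have card: "real (card {m. m < n \<and> y m \<le> s}) = (\<Sum>m<n. of_bool (y m \<le> s))" for s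
  proof -
    have "{..<n} \<inter> Collect (\<lambda>m. y m \<le> s) = {m. m < n \<and> y m \<le> s}" by auto
    then show ?thesis by (simp add: sum_of_bool_eq)
  qed
  have *: "(\<Sum>m<n. \<bar>of_bool (y m \<le> t) - of_bool (y m \<le> s)\<bar>) = (\<Sum>m<n. of_bool (y m \<le> t)) - (\<Sum>m<n. (of_bool (y m \<le> s) :: real))"
    if "s \<le> t" for s t
    unfolding sum_subtractf[symmetric] using that by (intro sum.cong) auto
  show ?thesis
  proof (cases "y i \<le> y j")
    case True
    from *[OF this] show ?thesis unfolding card
      by (smt (verit) sum_nonneg)
  next
    case False
    then have "(\<Sum>m<n. \<bar>of_bool (y m \<le> y i) - of_bool (y m \<le> y j)\<bar>) = (\<Sum>m<n. of_bool (y m \<le> y i)) - (\<Sum>m<n. (of_bool (y m \<le> y j) :: real))"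
      by (intro *) auto
    then show ?thesis unfolding card
      by (subst (2) abs_minus_commute) (smt (verit) sum_nonneg)
  qed
qed

lemma chatterjee_xi_eq: "chatterjee_xi n x y u = 1 - real n * xi_num n x y u / (2 * xi_den n y)"
proof -
  define s where "s = lex_sort x u [0..<n]"
  have r: "card {j. j < n \<and> y (s ! j) \<le> t} = card {j. j < n \<and> y j \<le> t}"
    and l: "card {j. j < n \<and> y (s ! j) \<ge> t} = card {j. j < n \<and> y j \<ge> t}" for t
    unfolding s_def by (rule card_nth_lex_sort)+
  have num: "(\<Sum>k<n - 1. \<bar>real (card {j. j < n \<and> y j \<le> y (s ! (k+1))}) - real (card {j. j < n \<and> y j \<le> y (s ! k)})\<bar>)
     = xi_num n x y u"
  proof -
    have "xi_num n x y u = (\<Sum>m<n. (\<Sum>k<n - 1. \<bar>of_bool (y m \<le> y (s ! (k+1))) - of_bool (y m \<le> y (s ! k))\<bar>))"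
      by (simp add: xi_num_def consec_sum_conv_nth s_def)
    also have "\<dots> = (\<Sum>k<n - 1. \<Sum>m<n. \<bar>of_bool (y m \<le> y (s ! (k+1))) - of_bool (y m \<le> y (s ! k))\<bar>)"
      by (rule sum.swap)
    finally show ?thesis by (simp only: rank_diff)
  qed
  have den: "(\<Sum>k<n. real (card {j. j < n \<and> y j \<ge> y (s ! k)}) * (real n - real (card {j. j < n \<and> y j \<ge> y (s ! k)})))
     = xi_den n y"
    unfolding xi_den_def s_def
    by (rule sum.reindex_bij_betw[OF bij_betw_nth_lex_sort, where g = "\<lambda>i. real (card {j. j < n \<and> y j \<ge> y i}) * (real n - real (card {j. j < n \<and> y j \<ge> y i}))"])
  show ?thesis
    unfolding chatterjee_xi_def Let_def lex_sort_def[symmetric] s_def[symmetric] r l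
    by (simp only: num den)
qed

lemma xi_num_nonneg: "0 \<le> xi_num n x y u"
  unfolding xi_num_def by (intro sum_nonneg consec_sum_nonneg) auto

text \<open>Every index counts itself, so no count is zero; if the denominator vanishes, all counts
  equal \<open>n\<close>, all responses coincide and no threshold indicator varies. A nonzero
  numerator therefore licenses the cancellation of the common denominator, where division by zero
  would silently return 0.\<close>

lemma xi_den_nonzero:
  assumes "xi_num n x y u \<noteq> 0"
  shows "xi_den n y \<noteq> 0"
proof
  assume "xi_den n y = 0"
  have le: "card {j. j < n \<and> P j} \<le> n" for P
    using card_mono[of "{..<n}" "{j. j < n \<and> P j}"] by auto
  have "\<forall>i\<in>{..<n}. real (card {j. j < n \<and> y j \<ge> y i}) * (real n - real (card {j. j < n \<and> y j \<ge> y i})) = 0"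
    using \<open>xi_den n y = 0\<close> unfolding xi_den_def
    by (subst (asm) sum_nonneg_eq_0_iff) (auto intro!: mult_nonneg_nonneg simp: le)
  moreover have "card {j. j < n \<and> y j \<ge> y i} \<noteq> 0" if "i < n" for i
    using that by (auto simp: card_eq_0_iff)
  ultimately have "card {j. j < n \<and> y j \<ge> y i} = n" if "i < n" for i
    using that by fastforce
  then have "{j. j < n \<and> y j \<ge> y i} = {..<n}" if "i < n" for i
    using that by (intro card_subset_eq) auto
  then have eq: "y i \<le> y j" if "i < n" "j < n" for i j
    using that by blast
  \<comment> \<open>The zero increment is written as a product so that
    \<open>consec_sum_cmult\<close> can pull out the factor 0.\<close>
  have "variation (\<lambda>i. of_bool (y m \<le> y i)) (lex_sort x u [0..<n]) = consec_sum (\<lambda>i j. 0 * 0) (lex_sort x u [0..<n])" if "m < n" for m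
    by (rule consec_sum_cong) (use eq that in auto)
  then have "xi_num n x y u = 0"
    unfolding consec_sum_cmult by (simp add: xi_num_def)
  with assms show False by simp
qed

lemma xi_cond_eq:
  assumes "xi_num n x y u \<noteq> 0"
  shows "xi_cond (chatterjee_xi n x y u) (chatterjee_xi n x' y u') = 1 - xi_num n x' y u' / xi_num n x y u"
proof -
  have "n \<noteq> 0" using assms by (cases n) (simp_all add: xi_num_def)
  then show ?thesis
    using assms xi_den_nonzero[OF assms] by (simp add: xi_cond_def chatterjee_xi_eq field_simps)
qed

section \<open>McDiarmid's inequality\<close>

lemma (in prob_space) integral_diff_le_of_bounded:
  assumes f: "f \<in> borel_measurable M" and g: "g \<in> borel_measurable M"
    and fB: "\<And>x. x \<in> space M \<Longrightarrow> \<bar>f x\<bar> \<le> B" and gB: "\<And>x. x \<in> space M \<Longrightarrow> \<bar>g x\<bar> \<le> B"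
    and d: "\<And>x. x \<in> space M \<Longrightarrow> \<bar>f x - g x\<bar> \<le> (c::real)"
  shows "\<bar>(\<integral>x. f x \<partial>M) - (\<integral>x. g x \<partial>M)\<bar> \<le> c"
proof -
  have [simp]: "integrable M f" "integrable M g"
    using f g fB gB by (auto intro!: integrable_const_bound[where B=B])
  have "(\<integral>x. f x - g x \<partial>M) \<le> c"
    by (rule integral_le_const) (use d in \<open>auto simp: abs_le_iff\<close>)
  moreover have "(\<integral>x. g x - f x \<partial>M) \<le> c"
    by (rule integral_le_const) (use d in \<open>auto simp: abs_le_iff\<close>)
  ultimately have "(\<integral>x. f x - g x \<partial>M) \<le> c" "(\<integral>x. g x - f x \<partial>M) \<le> c" .
  then show ?thesis by simp
qed

text \<open>One coordinate is integrated out at a time. The partial mean \<open>f'\<close> inherits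
  the bound and the bounded differences, so the induction hypothesis applies to it, and Hoeffding's
  lemma controls the fluctuation of \<open>f\<close> around \<open>f'\<close> in the remaining
  coordinate.\<close>

lemma mcdiarmid_mgf:
  fixes c :: real
  assumes P: "prob_space P" and I: "finite I"
    and f: "f \<in> borel_measurable (Pi\<^sub>M I (\<lambda>_. P))"
    and bdd: "\<And>z. z \<in> space (Pi\<^sub>M I (\<lambda>_. P)) \<Longrightarrow> \<bar>f z\<bar> \<le> B"
    and diff: "\<And>z i w. z \<in> space (Pi\<^sub>M I (\<lambda>_. P)) \<Longrightarrow> i \<in> I \<Longrightarrow> w \<in> space P \<Longrightarrow>
      \<bar>f (z(i := w)) - f z\<bar> \<le> c"
    and s: "0 < s"
  shows "(\<integral>\<^sup>+z. ennreal (exp (s * (f z - (\<integral>z. f z \<partial>Pi\<^sub>M I (\<lambda>_. P))))) \<partial>Pi\<^sub>M I (\<lambda>_. P))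
    \<le> ennreal (exp (card I * (s\<^sup>2 * c\<^sup>2 / 2)))"
  using I f bdd diff
proof (induction I arbitrary: f rule: finite_induct)
  case empty
  interpret product_prob_space "\<lambda>_. P" "{} :: 'b set"
    using P by (auto simp: product_prob_space_def product_prob_space_axioms_def product_sigma_finite_def prob_space_imp_sigma_finite)
  show ?case
    by (simp add: PiM_empty nn_integral_count_space_finite lebesgue_integral_count_space_finite)
next
  case (insert i I)
  interpret P: prob_space P by fact
  interpret Pr: product_prob_space "\<lambda>_. P" I
    using P by (auto simp: product_prob_space_def product_prob_space_axioms_def product_sigma_finite_def prob_space_imp_sigma_finite)
  let ?Q = "Pi\<^sub>M I (\<lambda>_. P)" and ?R = "Pi\<^sub>M (insert i I) (\<lambda>_. P)"
  interpret Q: prob_space ?Q by (rule prob_space_PiM) (rule P)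
  interpret R: prob_space ?R by (rule prob_space_PiM) (rule P)
  note [measurable] = insert.prems(1)
  have upd: "z(i := w) \<in> space ?R" if "z \<in> space ?Q" "w \<in> space P" for z w
    using that by (auto simp: space_PiM PiE_def extensional_def Pi_iff)
  have [measurable]: "(\<lambda>(z, w). f (z(i := w))) \<in> borel_measurable (?Q \<Otimes>\<^sub>M P)"
    using measurable_comp[OF measurable_add_dim insert.prems(1)]
    by (simp add: comp_def case_prod_beta')
  have fz [measurable]: "(\<lambda>w. f (z(i := w))) \<in> borel_measurable P" if "z \<in> space ?Q" for z
    using that insert.hyps(2) by measurable
  define f' where "f' = (\<lambda>z. \<integral>w. f (z(i := w)) \<partial>P)"
  have f'm [measurable]: "f' \<in> borel_measurable ?Q"
    unfolding f'_def by measurable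
  have int: "integrable P (\<lambda>w. f (z(i := w)))" if "z \<in> space ?Q" for z
    using insert.prems(2) upd that by (intro P.integrable_const_bound[where B=B] fz) auto
  have f'B: "\<bar>f' z\<bar> \<le> B" if "z \<in> space ?Q" for z
  proof -
    have "f' z \<le> B" "- f' z \<le> B"
      unfolding f'_def integral_minus[symmetric]
      using insert.prems(2) upd that
      by (auto intro!: P.integral_le_const AE_I2 int integrable_minus simp: abs_le_iff simp del: integral_minus)
    then show ?thesis by simp
  qed
  have f'd: "\<bar>f' (z(j := v)) - f' z\<bar> \<le> c" if "z \<in> space ?Q" "j \<in> I" "v \<in> space P" for z j v
  proof -
    have z': "z(j := v) \<in> space ?Q"
      using that by (auto simp: space_PiM PiE_def extensional_def Pi_iff)
    have "i \<noteq> j" using that insert.hyps by auto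
    then have *: "z(j := v, i := w) = z(i := w, j := v)" for w by (auto simp: fun_upd_twist)
    show ?thesis unfolding f'_def
    proof (rule P.integral_diff_le_of_bounded[where B=B])
      fix w assume w: "w \<in> space P"
      show "\<bar>f (z(j := v, i := w))\<bar> \<le> B" "\<bar>f (z(i := w))\<bar> \<le> B"
        using upd z' that(1) w insert.prems(2) by blast+
      show "\<bar>f (z(j := v, i := w)) - f (z(i := w))\<bar> \<le> c"
        unfolding * using that w by (intro insert.prems(3) upd) auto
    qed (use z' that fz in auto)
  qed
  have E: "(\<integral>z. f z \<partial>?R) = (\<integral>z. f' z \<partial>?Q)"
    unfolding f'_def using insert.hyps insert.prems(2)
    by (intro Pr.product_integral_insert R.integrable_const_bound[where B=B]) auto
  let ?E = "\<integral>z. f' z \<partial>?Q"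
  have "(\<integral>\<^sup>+z. ennreal (exp (s * (f z - (\<integral>z. f z \<partial>?R)))) \<partial>?R)
      = (\<integral>\<^sup>+z. (\<integral>\<^sup>+w. ennreal (exp (s * (f (z(i := w)) - ?E))) \<partial>P) \<partial>?Q)"
    unfolding E using insert.hyps by (intro Pr.product_nn_integral_insert) auto
  also have "\<dots> \<le> (\<integral>\<^sup>+z. ennreal (exp (s\<^sup>2 * c\<^sup>2 / 2)) * ennreal (exp (s * (f' z - ?E))) \<partial>?Q)"
  proof (rule nn_integral_mono)
    fix z assume z: "z \<in> space ?Q"
    obtain w0 where w0: "w0 \<in> space P" using P.not_empty by blast
    \<comment> \<open>Bounded differences place the slice within \<open>c\<close> of its value at an
      arbitrary point \<open>w0\<close>, hence in an interval of width \<open>2 * c\<close>.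
      Hoeffding's exponent, one eighth of the squared product of \<open>s\<close> and this width, is
      the \<open>s\<^sup>2 * c\<^sup>2 / 2\<close> of the claim.\<close>
    interpret h: interval_bounded_random_variable P "\<lambda>w. f (z(i := w))" "f (z(i := w0)) - c" "f (z(i := w0)) + c"
    proof
      have "\<bar>f (z(i := w)) - f (z(i := w0))\<bar> \<le> c" if "w \<in> space P" for w
        using insert.prems(3)[OF upd[OF z w0], of i w] that by (simp only: fun_upd_upd insertI1)
      then show "AE w in P. f (z(i := w)) \<in> {f (z(i := w0)) - c..f (z(i := w0)) + c}"
        by (intro AE_I2) (auto simp: abs_le_iff algebra_simps)
    qed (rule fz[OF z])
    have "(\<integral>\<^sup>+w. ennreal (exp (s * (f (z(i := w)) - ?E))) \<partial>P)
      = (\<integral>\<^sup>+w. ennreal (exp (s * (f (z(i := w)) - f' z))) * ennreal (exp (s * (f' z - ?E))) \<partial>P)"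
      by (intro nn_integral_cong) (simp add: ennreal_mult[symmetric] exp_add[symmetric] algebra_simps)
    also have "\<dots> = (\<integral>\<^sup>+w. ennreal (exp (s * (f (z(i := w)) - f' z))) \<partial>P) * ennreal (exp (s * (f' z - ?E)))"
      using fz[OF z] by (intro nn_integral_multc) measurable
    also have "(\<integral>\<^sup>+w. ennreal (exp (s * (f (z(i := w)) - f' z))) \<partial>P) \<le> ennreal (exp (s\<^sup>2 * c\<^sup>2 / 2))"
    proof -
      have "f (z(i := w0)) + c - (f (z(i := w0)) - c) = 2 * c" by simp
      then show ?thesis
        using h.Hoeffdings_lemma_nn_integral[OF s] unfolding f'_def
        by (simp only: power_mult_distrib) (simp add: mult.commute)
    qed
    finally show "(\<integral>\<^sup>+w. ennreal (exp (s * (f (z(i := w)) - ?E))) \<partial>P)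
        \<le> ennreal (exp (s\<^sup>2 * c\<^sup>2 / 2)) * ennreal (exp (s * (f' z - ?E)))"
      by (simp add: mult_right_mono)
  qed
  also have "\<dots> = ennreal (exp (s\<^sup>2 * c\<^sup>2 / 2)) * (\<integral>\<^sup>+z. ennreal (exp (s * (f' z - ?E))) \<partial>?Q)"
    by (intro nn_integral_cmult) measurable
  also have "\<dots> \<le> ennreal (exp (s\<^sup>2 * c\<^sup>2 / 2)) * ennreal (exp (card I * (s\<^sup>2 * c\<^sup>2 / 2)))"
    by (intro mult_left_mono insert.IH f'm f'B f'd) auto
  also have "\<dots> = ennreal (exp (card (insert i I) * (s\<^sup>2 * c\<^sup>2 / 2)))"
    using insert.hyps by (simp add: ennreal_mult[symmetric] exp_add[symmetric] algebra_simps)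
  finally show ?case .
qed

lemma mcdiarmid_upper:
  fixes c :: real
  assumes P: "prob_space P" and I: "finite I" "I \<noteq> {}"
    and f [measurable]: "f \<in> borel_measurable (Pi\<^sub>M I (\<lambda>_. P))"
    and bdd: "\<And>z. z \<in> space (Pi\<^sub>M I (\<lambda>_. P)) \<Longrightarrow> \<bar>f z\<bar> \<le> B"
    and diff: "\<And>z i w. z \<in> space (Pi\<^sub>M I (\<lambda>_. P)) \<Longrightarrow> i \<in> I \<Longrightarrow> w \<in> space P \<Longrightarrow>
      \<bar>f (z(i := w)) - f z\<bar> \<le> c"
    and c: "0 < c" and e: "0 < e"
  shows "measure (Pi\<^sub>M I (\<lambda>_. P)) {z \<in> space (Pi\<^sub>M I (\<lambda>_. P)). f z - (\<integral>z. f z \<partial>Pi\<^sub>M I (\<lambda>_. P)) \<ge> e}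
    \<le> exp (- (e\<^sup>2 / (2 * card I * c\<^sup>2)))"
proof -
  let ?Q = "Pi\<^sub>M I (\<lambda>_. P)"
  interpret Q: prob_space ?Q by (rule prob_space_PiM) (rule P)
  \<comment> \<open>This \<open>s\<close> minimizes the exponent
    \<open>- s * e + card I * (s\<^sup>2 * c\<^sup>2 / 2)\<close> of the Chernoff bound.\<close>
  define s where "s = e / (card I * c\<^sup>2)"
  have n: "real (card I) > 0" using I by (simp add: card_gt_0_iff)
  have s: "s > 0" unfolding s_def using n e c by simp
  let ?X = "\<lambda>z. f z - (\<integral>z. f z \<partial>?Q)"
  have "ennreal (measure ?Q {z \<in> space ?Q. ?X z \<ge> e}) = emeasure ?Q {z \<in> space ?Q. ?X z \<ge> e}"
    by (simp add: Q.emeasure_eq_measure)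
  also have "\<dots> \<le> ennreal (exp (- s * e)) * (\<integral>\<^sup>+z\<in>space ?Q. ennreal (exp (s * ?X z)) \<partial>?Q)"
    by (intro Chernoff_ineq_nn_integral_ge s) auto
  also have "(\<integral>\<^sup>+z\<in>space ?Q. ennreal (exp (s * ?X z)) \<partial>?Q) = (\<integral>\<^sup>+z. ennreal (exp (s * ?X z)) \<partial>?Q)"
    by (intro nn_integral_cong) auto
  also have "\<dots> \<le> ennreal (exp (card I * (s\<^sup>2 * c\<^sup>2 / 2)))"
    by (rule mcdiarmid_mgf[OF P I(1) f bdd diff s])
  finally have "ennreal (measure ?Q {z \<in> space ?Q. ?X z \<ge> e}) \<le> ennreal (exp (- s * e) * exp (card I * (s\<^sup>2 * c\<^sup>2 / 2)))"
    by (simp add: ennreal_mult mult_left_mono)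
  then have "measure ?Q {z \<in> space ?Q. ?X z \<ge> e} \<le> exp (- s * e) * exp (card I * (s\<^sup>2 * c\<^sup>2 / 2))"
    by (subst (asm) ennreal_le_iff) auto
  also have "\<dots> = exp (- (e\<^sup>2 / (2 * card I * c\<^sup>2)))"
    unfolding exp_add[symmetric] s_def using n c by (simp add: field_simps power2_eq_square)
  finally show ?thesis .
qed

lemma mcdiarmid:
  fixes c :: real
  assumes P: "prob_space P" and I: "finite I" "I \<noteq> {}"
    and f [measurable]: "f \<in> borel_measurable (Pi\<^sub>M I (\<lambda>_. P))"
    and bdd: "\<And>z. z \<in> space (Pi\<^sub>M I (\<lambda>_. P)) \<Longrightarrow> \<bar>f z\<bar> \<le> B"
    and diff: "\<And>z i w. z \<in> space (Pi\<^sub>M I (\<lambda>_. P)) \<Longrightarrow> i \<in> I \<Longrightarrow> w \<in> space P \<Longrightarrow>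
      \<bar>f (z(i := w)) - f z\<bar> \<le> c"
    and c: "0 < c" and e: "0 < e"
  shows "measure (Pi\<^sub>M I (\<lambda>_. P)) {z \<in> space (Pi\<^sub>M I (\<lambda>_. P)). \<bar>f z - (\<integral>z. f z \<partial>Pi\<^sub>M I (\<lambda>_. P))\<bar> \<ge> e}
    \<le> 2 * exp (- (e\<^sup>2 / (2 * card I * c\<^sup>2)))"
proof -
  let ?Q = "Pi\<^sub>M I (\<lambda>_. P)"
  interpret Q: prob_space ?Q by (rule prob_space_PiM) (rule P)
  let ?m = "\<integral>z. f z \<partial>?Q"
  have "measure ?Q {z \<in> space ?Q. \<bar>f z - ?m\<bar> \<ge> e}
      = measure ?Q ({z \<in> space ?Q. f z - ?m \<ge> e} \<union> {z \<in> space ?Q. - f z - (\<integral>z. - f z \<partial>?Q) \<ge> e})"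
    by (rule arg_cong[where f="measure ?Q"]) auto
  also have "\<dots> \<le> measure ?Q {z \<in> space ?Q. f z - ?m \<ge> e} + measure ?Q {z \<in> space ?Q. - f z - (\<integral>z. - f z \<partial>?Q) \<ge> e}"
    by (intro measure_Un_le) measurable
  also have "\<dots> \<le> exp (- (e\<^sup>2 / (2 * card I * c\<^sup>2))) + exp (- (e\<^sup>2 / (2 * card I * c\<^sup>2)))"
  proof (rule add_mono)
    show "measure ?Q {z \<in> space ?Q. f z - ?m \<ge> e} \<le> exp (- (e\<^sup>2 / (2 * card I * c\<^sup>2)))"
      by (rule mcdiarmid_upper[OF P I f bdd diff c e])
    show "measure ?Q {z \<in> space ?Q. - f z - (\<integral>z. - f z \<partial>?Q) \<ge> e} \<le> exp (- (e\<^sup>2 / (2 * card I * c\<^sup>2)))"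
    proof (rule mcdiarmid_upper[OF P I _ _ _ c e])
      fix z i w assume *: "z \<in> space ?Q" "i \<in> I" "w \<in> space P"
      show "\<bar>- f (z(i := w)) - - f z\<bar> \<le> c"
        using diff[OF *] by linarith
    qed (use bdd in auto)
  qed
  finally show ?thesis by simp
qed

text \<open>With differences of order 1/n in \<open>n\<close> coordinates the McDiarmid exponent is
  linear in \<open>n\<close>, so the tail probabilities are summable and Borel-Cantelli gives almost
  sure convergence. Nothing links the functions \<open>f n\<close> for different \<open>n\<close>;
  only the fixed sequence of observations is shared.\<close>

lemma (in prob_space) bounded_difference_LLN:
  assumes rv: "\<And>i. random_variable S (\<zeta> i)" and ind: "indep_vars (\<lambda>_. S) \<zeta> (UNIV :: nat set)"
    and P: "\<And>i. distr M S (\<zeta> i) = P"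
    and f: "\<And>n. f n \<in> borel_measurable (Pi\<^sub>M {..<n} (\<lambda>_. P))"
    and bdd: "\<And>n z. z \<in> space (Pi\<^sub>M {..<n} (\<lambda>_. P)) \<Longrightarrow> \<bar>f n z\<bar> \<le> B n"
    and diff: "\<And>n z i w. z \<in> space (Pi\<^sub>M {..<n} (\<lambda>_. P)) \<Longrightarrow> i < n \<Longrightarrow> w \<in> space P \<Longrightarrow>
      \<bar>f n (z(i := w)) - f n z\<bar> \<le> C / real n"
    and C: "0 < C"
  shows "AE \<omega> in M. (\<lambda>n. f n (\<lambda>i\<in>{..<n}. \<zeta> i \<omega>) - (\<integral>z. f n z \<partial>Pi\<^sub>M {..<n} (\<lambda>_. P))) \<longlonglongrightarrow> 0"
proof -
  let ?Q = "\<lambda>n. Pi\<^sub>M {..<n} (\<lambda>_. P)"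
  have PP: "prob_space P" unfolding P[symmetric, of 0] by (rule prob_space_distr) (rule rv)
  have sP: "sets P = sets S" unfolding P[symmetric, of 0] by simp
  have zm: "(\<lambda>\<omega>. \<lambda>i\<in>{..<n}. \<zeta> i \<omega>) \<in> M \<rightarrow>\<^sub>M ?Q n" for n
    using rv by (intro measurable_restrict) (auto simp: measurable_cong_sets[OF refl sP])
  have law: "distr M (?Q n) (\<lambda>\<omega>. \<lambda>i\<in>{..<n}. \<zeta> i \<omega>) = ?Q n" if "n > 0" for n
  proof -
    have ne: "{..<n} \<noteq> {}" using that by auto
    have "indep_vars (\<lambda>_. S) \<zeta> {..<n}" using ind by (rule indep_vars_subset) auto
    then have "distr M (Pi\<^sub>M {..<n} (\<lambda>_. S)) (\<lambda>\<omega>. \<lambda>i\<in>{..<n}. \<zeta> i \<omega>) = ?Q n"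
      by (subst (asm) indep_vars_iff_distr_eq_PiM[OF ne rv]) (simp add: P)
    moreover have "sets (Pi\<^sub>M {..<n} (\<lambda>_. S)) = sets (?Q n)"
      by (intro sets_PiM_cong) (auto simp: sP)
    ultimately show ?thesis by (metis distr_cong)
  qed
  define d where "d n \<omega> = f n (\<lambda>i\<in>{..<n}. \<zeta> i \<omega>) - (\<integral>z. f n z \<partial>?Q n)" for n \<omega>
  have dm [measurable]: "d n \<in> borel_measurable M" for n
    unfolding d_def by (intro borel_measurable_diff measurable_compose[OF zm f] borel_measurable_const)
  have tail: "measure M {\<omega> \<in> space M. \<bar>d n \<omega>\<bar> \<ge> e} \<le> 2 * exp (- (e\<^sup>2 / (2 * C\<^sup>2))) ^ n" if "e > 0" "n > 0" for e n
  proof -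
    have "measure M {\<omega> \<in> space M. \<bar>d n \<omega>\<bar> \<ge> e}
       = measure (distr M (?Q n) (\<lambda>\<omega>. \<lambda>i\<in>{..<n}. \<zeta> i \<omega>)) {z \<in> space (?Q n). \<bar>f n z - (\<integral>z. f n z \<partial>?Q n)\<bar> \<ge> e}"
      using f[of n] by (subst measure_distr[OF zm])
        (auto intro!: arg_cong[where f="measure M"] simp: d_def measurable_space[OF zm])
    also have "\<dots> = measure (?Q n) {z \<in> space (?Q n). \<bar>f n z - (\<integral>z. f n z \<partial>?Q n)\<bar> \<ge> e}"
      by (simp add: law[OF that(2)])
    also have "\<dots> \<le> 2 * exp (- (e\<^sup>2 / (2 * card {..<n} * (C / n)\<^sup>2)))"
    proof (rule mcdiarmid[OF PP _ _ f bdd])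
      show "\<bar>f n (z(i := w)) - f n z\<bar> \<le> C / n"
        if "z \<in> space (?Q n)" "i \<in> {..<n}" "w \<in> space P" for z i w
        using that by (intro diff) auto
    qed (use that C in auto)
    also have "exp (- (e\<^sup>2 / (2 * card {..<n} * (C / n)\<^sup>2))) = exp (- (e\<^sup>2 / (2 * C\<^sup>2))) ^ n"
    proof -
      have "- (e\<^sup>2 / (2 * card {..<n} * (C / n)\<^sup>2)) = of_nat n * - (e\<^sup>2 / (2 * C\<^sup>2))"
        using that C by (simp add: divide_simps power2_eq_square)
      then show ?thesis by (simp only: exp_of_nat_mult)
    qed
    finally show ?thesis .
  qed
  have ev: "AE \<omega> in M. eventually (\<lambda>n. \<bar>d n \<omega>\<bar> < e) sequentially" if "e > 0" for e
  proof -
    have "exp (- (e\<^sup>2 / (2 * C\<^sup>2))) < 1" using that C by simp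
    then have "summable (\<lambda>n. 2 * exp (- (e\<^sup>2 / (2 * C\<^sup>2))) ^ n)"
      by (intro summable_mult summable_geometric) auto
    then have "summable (\<lambda>n. measure M {\<omega> \<in> space M. \<bar>d n \<omega>\<bar> \<ge> e})"
      by (rule summable_comparison_test'[where N=1]) (use tail[OF that] in auto)
    then have "AE \<omega> in M. eventually (\<lambda>n. \<omega> \<in> space M - {\<omega> \<in> space M. \<bar>d n \<omega>\<bar> \<ge> e}) sequentially"
      by (intro borel_cantelli_AE1) (auto simp: emeasure_eq_measure)
    then show ?thesis
    proof eventually_elim
      case (elim \<omega>)
      then show ?case by (rule eventually_mono) auto
    qed
  qed
  have "AE \<omega> in M. \<forall>k. eventually (\<lambda>n. \<bar>d n \<omega>\<bar> < inverse (real (Suc k))) sequentially"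
    unfolding AE_all_countable by (intro allI ev) simp
  then have "AE \<omega> in M. (\<lambda>n. d n \<omega>) \<longlonglongrightarrow> 0"
  proof eventually_elim
    case (elim \<omega>)
    show ?case
    proof (rule tendstoI)
      fix e :: real assume "e > 0"
      then obtain k where "inverse (real (Suc k)) < e" using reals_Archimedean by blast
      moreover have "eventually (\<lambda>n. \<bar>d n \<omega>\<bar> < inverse (real (Suc k))) sequentially"
        using elim by blast
      ultimately show "eventually (\<lambda>n. dist (d n \<omega>) 0 < e) sequentially"
        by (metis (mono_tags, lifting) dist_real_def diff_zero eventually_mono less_trans)
    qed
  qed
  then show ?thesis by (simp add: d_def)
qed

section \<open>Samples with independent responses\<close>

abbreviation key :: "(nat \<Rightarrow> real \<times> real \<times> real) \<Rightarrow> nat \<Rightarrow> real" where "key z i \<equiv> fst (z i)"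
abbreviation resp :: "(nat \<Rightarrow> real \<times> real \<times> real) \<Rightarrow> nat \<Rightarrow> real" where "resp z i \<equiv> fst (snd (z i))"
abbreviation tag :: "(nat \<Rightarrow> real \<times> real \<times> real) \<Rightarrow> nat \<Rightarrow> real" where "tag z i \<equiv> snd (snd (z i))"
abbreviation srt :: "(nat \<Rightarrow> real \<times> real \<times> real) \<Rightarrow> nat list \<Rightarrow> nat list" where
  "srt z \<equiv> lex_sort (key z) (tag z)"

section \<open>Measurability of the sorted list\<close>

lemma measurable_insort_key:
  fixes f :: "'i::countable \<Rightarrow> 'a \<Rightarrow> real"
  assumes [measurable]: "\<And>i. f i \<in> borel_measurable Q"
  shows "(\<lambda>z. insort_key (\<lambda>i. f i z) a l) \<in> Q \<rightarrow>\<^sub>M count_space UNIV"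
proof (induction l)
  case (Cons b l)
  note [measurable] = Cons
  have [measurable]: "(\<lambda>z. b # insort_key (\<lambda>i. f i z) a l) \<in> Q \<rightarrow>\<^sub>M count_space UNIV"
    by (rule measurable_compose[OF Cons]) simp
  show ?case by simp
qed simp

text \<open>Lists of indices form a countable type, so it is enough to treat insertion into each
  fixed list and to compose over the countably many values of the recursive call.\<close>

lemma measurable_sort_key:
  fixes f :: "'i::countable \<Rightarrow> 'a \<Rightarrow> real"
  assumes [measurable]: "\<And>i. f i \<in> borel_measurable Q"
  shows "(\<lambda>z. sort_key (\<lambda>i. f i z) l) \<in> Q \<rightarrow>\<^sub>M count_space UNIV"
proof (induction l)
  case (Cons a l)
  show ?case
    unfolding sort_key_simps
    by (rule measurable_compose_countable[OF measurable_insort_key[OF assms] Cons])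
qed simp

lemma measurable_lex_sort:
  assumes "\<And>i. (\<lambda>z. x z i) \<in> borel_measurable Q" "\<And>i. (\<lambda>z. u z i) \<in> borel_measurable Q"
  shows "(\<lambda>z. lex_sort (x z) (u z) l) \<in> Q \<rightarrow>\<^sub>M count_space UNIV"
  unfolding lex_sort_def
  by (rule measurable_compose_countable[OF measurable_sort_key measurable_sort_key]) (use assms in auto)

lemma measurable_consec_sum_fixed:
  assumes [measurable]: "\<And>i j. (\<lambda>z. F z i j) \<in> borel_measurable Q"
  shows "(\<lambda>z. consec_sum (F z) l) \<in> borel_measurable Q"
  by (induction l rule: induct_list012) auto

lemma measurable_consec_sum:
  fixes L :: "'a \<Rightarrow> nat list"
  assumes "\<And>i j. (\<lambda>z. F z i j) \<in> borel_measurable Q" "L \<in> Q \<rightarrow>\<^sub>M count_space UNIV"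
  shows "(\<lambda>z. consec_sum (F z) (L z)) \<in> borel_measurable Q"
  by (rule measurable_compose_countable[OF measurable_consec_sum_fixed assms(2)]) (rule assms(1))

text \<open>For bits the absolute difference is a polynomial that is affine in each bit. In this
  form, unlike under an absolute value, a bit can be replaced by its conditional mean inside an
  expectation.\<close>

lemma variation_bool:
  assumes "\<And>i. b i \<in> {0, 1}"
  shows "variation b l = consec_sum (\<lambda>i j. b i + b j - 2 * (b i * b j)) l"
proof (rule consec_sum_cong)
  fix i j show "\<bar>b j - b i\<bar> = b i + b j - 2 * (b i * b j)"
    using assms[of i] assms[of j] by auto
qed

text \<open>If the two neighbouring values were equal, the increment would be exactly
  \<open>2 * (g i - (g i)\<^sup>2)\<close>; the error is \<open>(g j - g i) * (1 - 2 * g i)\<close>,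
  at most one increment of \<open>g\<close>. The additional 1 covers the last element, which has no
  successor.\<close>

lemma consec_sum_variance:
  assumes "\<And>i. 0 \<le> g i" "\<And>i. g i \<le> 1"
  shows "\<bar>consec_sum (\<lambda>i j. g i + g j - 2 * (g i * g j)) l - (\<Sum>i\<leftarrow>l. 2 * (g i - (g i)\<^sup>2))\<bar> \<le> variation g l + 1"
proof (induction l rule: induct_list012)
  case (2 i)
  have "0 \<le> g i * (1 - g i)" using assms by (intro mult_nonneg_nonneg) (auto simp: algebra_simps)
  moreover have "0 \<le> (g i - 1/2)\<^sup>2" by simp
  ultimately show ?case by (simp add: power2_eq_square algebra_simps)
next
  case (3 i j l)
  have "(g i + g j - 2 * (g i * g j)) - 2 * (g i - (g i)\<^sup>2) = (g j - g i) * (1 - 2 * g i)"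
    by (simp add: power2_eq_square algebra_simps)
  moreover have "\<bar>(g j - g i) * (1 - 2 * g i)\<bar> \<le> \<bar>g j - g i\<bar> * 1"
    unfolding abs_mult using assms[of i] by (intro mult_left_mono) auto
  ultimately have "\<bar>(g i + g j - 2 * (g i * g j)) - 2 * (g i - (g i)\<^sup>2)\<bar> \<le> \<bar>g j - g i\<bar>" by simp
  with 3(2) show ?case by simp
qed simp

text \<open>\<open>P\<close> is the law of (key, response, tag), and \<open>g t\<close> is a version
  of the conditional probability of a response at least \<open>t\<close> given the key. The test
  functions \<open>h\<close> see key and tag together: this encodes that the tag adds no information
  on the response once the key is known.\<close>

locale regression_law = prob_space P for P :: "(real \<times> real \<times> real) measure" +
  fixes g :: "real \<Rightarrow> real \<Rightarrow> real"
  assumes sets_P [measurable_cong]: "sets P = sets borel"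
    and g_measurable [measurable]: "\<And>t. g t \<in> borel_measurable borel"
    and g_nonneg: "\<And>t x. 0 \<le> g t x" and g_le_1: "\<And>t x. g t x \<le> 1"
    and regression: "\<And>t h. h \<in> borel_measurable borel \<Longrightarrow> (\<And>x u. \<bar>h (x, u)\<bar> \<le> 1) \<Longrightarrow>
      (\<integral>p. h (fst p, snd (snd p)) * of_bool (t \<le> fst (snd p)) \<partial>P) = (\<integral>p. h (fst p, snd (snd p)) * g t (fst p) \<partial>P)"
begin

abbreviation PQ :: "nat set \<Rightarrow> (nat \<Rightarrow> real \<times> real \<times> real) measure" where
  "PQ I \<equiv> Pi\<^sub>M I (\<lambda>_. P)"

lemma product_sigma_finite_P: "product_sigma_finite (\<lambda>_. P)"
  by (simp add: product_sigma_finite_def sigma_finite_measure_axioms)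

lemmas product_integral_insert = product_sigma_finite.product_integral_insert[OF product_sigma_finite_P]

lemma prob_space_PQ: "prob_space (PQ I)"
  by (rule prob_space_PiM) (rule prob_space_axioms)

lemma measurable_component [measurable]: "(\<lambda>z. z i) \<in> PQ I \<rightarrow>\<^sub>M borel"
proof (cases "i \<in> I")
  case True
  then have "(\<lambda>z. z i) \<in> PQ I \<rightarrow>\<^sub>M P" by (rule measurable_component_singleton)
  then show ?thesis by (simp add: measurable_cong_sets[OF refl sets_P])
next
  case False
  then have "(\<lambda>z. z i) \<in> PQ I \<rightarrow>\<^sub>M borel \<longleftrightarrow> (\<lambda>z. undefined :: real \<times> real \<times> real) \<in> PQ I \<rightarrow>\<^sub>M borel"
    by (intro measurable_cong) (auto simp: space_PiM PiE_def extensional_def)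
  then show ?thesis by simp
qed

lemma measurable_coords [measurable]:
  "(\<lambda>z. key z i) \<in> borel_measurable (PQ I)" "(\<lambda>z. resp z i) \<in> borel_measurable (PQ I)"
  "(\<lambda>z. tag z i) \<in> borel_measurable (PQ I)"
  by (rule measurable_compose[OF measurable_component], simp add: borel_prod[symmetric])+

lemma measurable_srt [measurable]: "(\<lambda>z. srt z l) \<in> PQ I \<rightarrow>\<^sub>M count_space UNIV"
  by (rule measurable_lex_sort) measurable

lemma measurable_P_coords [measurable]:
  "fst \<in> borel_measurable P" "(\<lambda>p. fst (snd p)) \<in> borel_measurable P" "(\<lambda>p. snd (snd p)) \<in> borel_measurable P"
  unfolding measurable_cong_sets[OF sets_P refl] by (simp_all add: borel_prod[symmetric])

lemma integrable_PQ:
  assumes "f \<in> borel_measurable (PQ I)" "\<And>z. \<bar>f z\<bar> \<le> (B::real)"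
  shows "integrable (PQ I) f"
proof -
  interpret Q: prob_space "PQ I" by (rule prob_space_PQ)
  show ?thesis using assms by (intro Q.integrable_const_bound[where B=B]) auto
qed

lemma integral_component:
  assumes "i \<in> I" "f \<in> borel_measurable borel"
  shows "(\<integral>z. f (z i) \<partial>PQ I) = (\<integral>p. (f p :: real) \<partial>P)"
proof -
  have "(\<integral>z. f (z i) \<partial>PQ I) = (\<integral>p. f p \<partial>distr (PQ I) P (\<lambda>z. z i))"
    using assms by (intro integral_distr[symmetric]) (auto simp: measurable_cong_sets[OF sets_P refl])
  also have "distr (PQ I) P (\<lambda>z. z i) = P"
    using assms(1) by (intro distr_PiM_component) (rule prob_space_axioms)
  finally show ?thesis .
qed

text \<open>Fubini isolates coordinate \<open>i\<close>. There the weight \<open>K\<close> depends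
  on key and tag alone, which is what the regression identity can handle; the other responses may
  enter \<open>K\<close> freely.\<close>

lemma replace_response:
  assumes I: "finite I" "i \<in> I"
    and K [measurable]: "K \<in> borel_measurable (PQ I)" and bdd: "\<And>z. \<bar>K z\<bar> \<le> 1"
    and inv: "\<And>z x y u. K (z(i := (x, y, u))) = K (z(i := (x, 0, u)))"
  shows "(\<integral>z. K z * of_bool (t \<le> resp z i) \<partial>PQ I) = (\<integral>z. K z * g t (key z i) \<partial>PQ I)"
proof -
  define J where "J = I - {i}"
  have IJ: "I = insert i J" "i \<notin> J" "finite J" using I by (auto simp: J_def)
  have b1: "\<bar>K z * of_bool (t \<le> resp z i)\<bar> \<le> 1" for z using bdd[of z] by simp
  have b2: "\<bar>K z * g t (key z i)\<bar> \<le> 1" for z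
    using mult_mono[OF bdd[of z] g_le_1[of t "key z i"]] g_nonneg[of t "key z i"] by (simp add: abs_mult)
  have i1: "integrable (PQ I) (\<lambda>z. K z * of_bool (t \<le> resp z i))"
    by (rule integrable_PQ[OF _ b1]) measurable
  have i2: "integrable (PQ I) (\<lambda>z. K z * g t (key z i))"
    by (rule integrable_PQ[OF _ b2]) measurable
  have "(\<integral>z. K z * of_bool (t \<le> resp z i) \<partial>PQ I) = (\<integral>z. \<integral>w. K (z(i := w)) * of_bool (t \<le> fst (snd w)) \<partial>P \<partial>PQ J)"
    using product_integral_insert[OF IJ(3,2), of "\<lambda>z. K z * of_bool (t \<le> resp z i)"] i1
    by (simp add: IJ(1)[symmetric])
  also have "\<dots> = (\<integral>z. \<integral>w. K (z(i := w)) * g t (fst w) \<partial>P \<partial>PQ J)"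
  proof (rule Bochner_Integration.integral_cong[OF refl])
    fix z assume z: "z \<in> space (PQ J)"
    \<comment> \<open>The response slot is filled with the dummy value 0; by \<open>inv\<close> this
      loses nothing and turns the slice of \<open>K\<close> into a function of key and tag.\<close>
    define h where "h = (\<lambda>(x, u). K (z(i := (x, 0, u))))"
    have hK: "K (z(i := w)) = h (fst w, snd (snd w))" for w
      using inv[of z "fst w" "fst (snd w)" "snd (snd w)"] by (simp add: h_def)
    have "(\<lambda>w. z(i := w)) \<in> P \<rightarrow>\<^sub>M PQ I"
      unfolding IJ(1) using measurable_component_update[OF z IJ(2)] .
    then have "(\<lambda>w. K (z(i := w))) \<in> borel_measurable borel"
      using measurable_compose[OF _ K] by (simp add: measurable_cong_sets[OF sets_P refl])
    moreover have "(\<lambda>(x, u). (x, 0, u)) \<in> borel \<rightarrow>\<^sub>M (borel :: (real \<times> real \<times> real) measure)"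
      by (simp add: borel_prod[symmetric])
    ultimately have "h \<in> borel_measurable borel"
      unfolding h_def using measurable_compose by (force simp: case_prod_beta')
    then show "(\<integral>w. K (z(i := w)) * of_bool (t \<le> fst (snd w)) \<partial>P) = (\<integral>w. K (z(i := w)) * g t (fst w) \<partial>P)"
      unfolding hK by (rule regression) (simp add: h_def bdd)
  qed
  also have "\<dots> = (\<integral>z. K z * g t (key z i) \<partial>PQ I)"
    using product_integral_insert[OF IJ(3,2), of "\<lambda>z. K z * g t (key z i)"] i2
    by (simp add: IJ(1)[symmetric])
  finally show ?thesis .
qed

lemma srt_upd: "srt (z(i := (x, y, u))) l = srt (z(i := (x, 0, u))) l"
  by (rule lex_sort_cong) auto

text \<open>On the event that sorting yields a given list, which depends on keys and tags only, distinct
  responses can be replaced by the regression function one after the other.\<close>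

lemma integral_consec_sum_replace:
  assumes l: "distinct l"
  defines "b \<equiv> \<lambda>t z i. of_bool (t \<le> resp z i) :: real"
  shows "(\<integral>z. variation (b t z) (srt z l) \<partial>PQ (set l))
    = (\<integral>z. consec_sum (\<lambda>i j. g t (key z i) + g t (key z j) - 2 * (g t (key z i) * g t (key z j))) (srt z l) \<partial>PQ (set l))"
proof -
  let ?F = "\<lambda>a i j. a i + a j - 2 * (a i * a j) :: real"
  let ?g = "\<lambda>z i. g t (key z i)"
  \<comment> \<open>All possible outcomes of the sort. There are finitely many, so the expectation
    splits into terms in which the indices of neighbours are fixed.\<close>
  define LL where "LL = {l'. set l' = set l \<and> distinct l' \<and> length l' = length l}"
  have fin: "finite LL"
    by (rule finite_subset[OF _ finite_lists_length_eq[of "set l" "length l"]]) (auto simp: LL_def)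
  have bm [measurable]: "(\<lambda>z. b t z i) \<in> borel_measurable (PQ I)" for i I unfolding b_def by measurable
  have gm [measurable]: "(\<lambda>z. ?g z i) \<in> borel_measurable (PQ I)" for i I by measurable
  have split: "(\<integral>z. consec_sum (?F (a z)) (srt z l) \<partial>PQ (set l))
     = (\<Sum>l'\<in>LL. \<Sum>k<length l' - 1. \<integral>z. of_bool (srt z l = l') * ?F (a z) (l' ! k) (l' ! (k + 1)) \<partial>PQ (set l))"
    if am [measurable]: "\<And>i. (\<lambda>z. a z i) \<in> borel_measurable (PQ (set l))"
      and ab: "\<And>z i. 0 \<le> a z i \<and> a z i \<le> 1" for a :: "_ \<Rightarrow> nat \<Rightarrow> real"
  proof -
    have bd: "\<bar>?F (a z) i j\<bar> \<le> 4" for z i j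
    proof -
      have "0 \<le> a z i * a z j" "a z i * a z j \<le> 1"
        using ab[of z i] ab[of z j] by (auto intro!: mult_le_one)
      with ab[of z i, THEN conjunct1] ab[of z i, THEN conjunct2] ab[of z j, THEN conjunct1] ab[of z j, THEN conjunct2]
      show ?thesis by linarith
    qed
    have eq: "consec_sum (?F (a z)) (srt z l) = (\<Sum>l'\<in>LL. \<Sum>k<length l' - 1. of_bool (srt z l = l') * ?F (a z) (l' ! k) (l' ! (k + 1)))" for z
    proof -
      have "srt z l \<in> LL" using l by (simp add: LL_def)
      then have "consec_sum (?F (a z)) (srt z l) = (\<Sum>l'\<in>LL. of_bool (srt z l = l') * consec_sum (?F (a z)) l')"
        using fin by (simp add: if_distrib[of "\<lambda>c. c * _"] of_bool_def sum.delta' cong: if_cong)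
      then show ?thesis by (simp only: consec_sum_conv_nth sum_distrib_left)
    qed
    have int: "integrable (PQ (set l)) (\<lambda>z. of_bool (srt z l = l') * ?F (a z) i j)" for l' i j
      using bd by (intro integrable_PQ[where B=4]) auto
    show ?thesis
      unfolding eq
      by (subst Bochner_Integration.integral_sum, rule Bochner_Integration.integrable_sum, rule int,
          rule sum.cong[OF refl], rule Bochner_Integration.integral_sum, rule int)
  qed
  have key_eq: "(\<integral>z. of_bool (srt z l = l') * ?F (b t z) i j \<partial>PQ (set l)) = (\<integral>z. of_bool (srt z l = l') * ?F (?g z) i j \<partial>PQ (set l))"
    if ij: "i \<in> set l" "j \<in> set l" "i \<noteq> j" for l' i j
  proof -
    define K where "K z = (of_bool (srt z l = l') :: real)" for z
    let ?I = "\<lambda>f. \<integral>z. f z \<partial>PQ (set l)"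
    have Km [measurable]: "K \<in> borel_measurable (PQ (set l))" unfolding K_def by measurable
    have K01: "0 \<le> K z" "K z \<le> 1" for z by (auto simp: K_def)
    have Kinv: "K (z(i := (x, y, u))) = K (z(i := (x, 0, u)))" for z i x y u
      unfolding K_def by (simp only: srt_upd[of z i x y])
    have b01: "0 \<le> b t z i" "b t z i \<le> 1" for z i by (auto simp: b_def)
    have bound: "\<bar>K z\<bar> \<le> 1" "\<bar>K z * b t z j\<bar> \<le> 1" "\<bar>K z * ?g z i\<bar> \<le> 1" for z i j
      using K01[of z] b01[of z j] g_nonneg[of t "key z i"] g_le_1[of t "key z i"]
      by (simp_all only: abs_mult abs_of_nonneg mult_le_one)
    have R: "?I (\<lambda>z. K z * b t z i) = ?I (\<lambda>z. K z * ?g z i)"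
      if "K \<in> borel_measurable (PQ (set l))" "\<And>z. \<bar>K z\<bar> \<le> 1" "i \<in> set l"
        "\<And>z x y u. K (z(i := (x, y, u))) = K (z(i := (x, 0, u)))" for K i
      unfolding b_def using that by (intro replace_response) auto
    have 1: "?I (\<lambda>z. K z * b t z i) = ?I (\<lambda>z. K z * ?g z i)" "?I (\<lambda>z. K z * b t z j) = ?I (\<lambda>z. K z * ?g z j)"
      by (rule R[OF Km bound(1) ij(1) Kinv], rule R[OF Km bound(1) ij(2) Kinv])
    \<comment> \<open>The product is treated one factor at a time: first
      \<open>K z * b t z j\<close> is the weight for response \<open>i\<close>, then
      \<open>K z * ?g z i\<close> is the weight for response \<open>j\<close>. Both weights are
      admissible because \<open>i\<close> and \<open>j\<close> differ.\<close>
    have "?I (\<lambda>z. (K z * b t z j) * b t z i) = ?I (\<lambda>z. (K z * b t z j) * ?g z i)"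
    proof (rule R[OF _ bound(2) ij(1)])
      show "K (z(i := (x, y, u))) * b t (z(i := (x, y, u))) j = K (z(i := (x, 0, u))) * b t (z(i := (x, 0, u))) j" for z x y u
        using ij(3) unfolding Kinv[of z i x y] by (simp add: b_def)
    qed measurable
    also have "\<dots> = ?I (\<lambda>z. (K z * ?g z i) * b t z j)" by (simp add: mult_ac)
    also have "\<dots> = ?I (\<lambda>z. (K z * ?g z i) * ?g z j)"
    proof (rule R[OF _ bound(3) ij(2)])
      show "K (z(j := (x, y, u))) * ?g (z(j := (x, y, u))) i = K (z(j := (x, 0, u))) * ?g (z(j := (x, 0, u))) i" for z x y u
        using ij(3) unfolding Kinv[of z j x y] by simp
    qed measurable
    finally have 2: "?I (\<lambda>z. K z * (b t z i * b t z j)) = ?I (\<lambda>z. K z * (?g z i * ?g z j))"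
      by (simp add: mult_ac)
    have exp: "?I (\<lambda>z. K z * ?F (a z) i j) = ?I (\<lambda>z. K z * a z i) + ?I (\<lambda>z. K z * a z j) - 2 * ?I (\<lambda>z. K z * (a z i * a z j))"
      if am [measurable]: "\<And>i. (\<lambda>z. a z i) \<in> borel_measurable (PQ (set l))"
        and ab: "\<And>z i. 0 \<le> a z i \<and> a z i \<le> 1" for a :: "_ \<Rightarrow> nat \<Rightarrow> real"
    proof -
      have [simp]: "integrable (PQ (set l)) (\<lambda>z. K z * a z i)" for i
        using ab K01 by (intro integrable_PQ[where B=1]) (auto simp: abs_mult intro!: mult_le_one)
      have [simp]: "integrable (PQ (set l)) (\<lambda>z. K z * (a z i * a z j))" for i j
        using ab K01 by (intro integrable_PQ[where B=1]) (auto simp: abs_mult intro!: mult_le_one)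
      have "?I (\<lambda>z. K z * ?F (a z) i j) = ?I (\<lambda>z. K z * a z i + K z * a z j - 2 * (K z * (a z i * a z j)))"
        by (intro Bochner_Integration.integral_cong refl) (simp add: algebra_simps)
      then show ?thesis by simp
    qed
    have "?I (\<lambda>z. K z * ?F (b t z) i j) = ?I (\<lambda>z. K z * b t z i) + ?I (\<lambda>z. K z * b t z j) - 2 * ?I (\<lambda>z. K z * (b t z i * b t z j))"
      by (rule exp) (auto simp: b_def)
    also have "\<dots> = ?I (\<lambda>z. K z * ?g z i) + ?I (\<lambda>z. K z * ?g z j) - 2 * ?I (\<lambda>z. K z * (?g z i * ?g z j))"
      by (simp only: 1 2)
    also have "\<dots> = ?I (\<lambda>z. K z * ?F (?g z) i j)"
      by (rule exp[symmetric]) (auto simp: g_nonneg g_le_1)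
    finally show ?thesis by (simp only: K_def)
  qed
  have "(\<integral>z. variation (b t z) (srt z l) \<partial>PQ (set l)) = (\<integral>z. consec_sum (?F (b t z)) (srt z l) \<partial>PQ (set l))"
    by (subst variation_bool) (auto simp: b_def)
  also have "\<dots> = (\<Sum>l'\<in>LL. \<Sum>k<length l' - 1. \<integral>z. of_bool (srt z l = l') * ?F (b t z) (l' ! k) (l' ! (k + 1)) \<partial>PQ (set l))"
    by (rule split) (auto simp: b_def)
  also have "\<dots> = (\<Sum>l'\<in>LL. \<Sum>k<length l' - 1. \<integral>z. of_bool (srt z l = l') * ?F (?g z) (l' ! k) (l' ! (k + 1)) \<partial>PQ (set l))"
  proof (rule sum.cong[OF refl], rule sum.cong[OF refl], rule key_eq)
    fix l' k assume "l' \<in> LL" "k \<in> {..<length l' - 1}"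
    then have l': "set l' = set l" "distinct l'" "k < length l'" "k + 1 < length l'" by (auto simp: LL_def)
    show "l' ! k \<in> set l" "l' ! (k + 1) \<in> set l"
      using nth_mem[OF l'(3)] nth_mem[OF l'(4)] l'(1) by auto
    show "l' ! k \<noteq> l' ! (k + 1)"
      using l' by (simp add: nth_eq_iff_index_eq)
  qed
  also have "\<dots> = (\<integral>z. consec_sum (?F (?g z)) (srt z l) \<partial>PQ (set l))"
    by (rule split[symmetric]) (auto simp: g_nonneg g_le_1)
  finally show ?thesis .
qed

end

section \<open>Functions whose variation along sorted keys is sublinear in mean\<close>

lemma consec_sum_abs_le:
  assumes "\<And>i j. \<bar>F i j\<bar> \<le> B"
  shows "\<bar>consec_sum F l\<bar> \<le> B * real (length l)"
proof (induction l rule: induct_list012)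
  case (2 i)
  then show ?case using assms[of i i] by simp
next
  case (3 i j l)
  have "B * length (i # j # l) = B + B * length (j # l)" by (simp add: algebra_simps)
  then show ?case using 3(2) assms[of i j] by auto
qed simp

lemma variation_nonneg: "0 \<le> variation f l"
  by (rule consec_sum_nonneg) simp

lemma card_le_eq_floor:
  assumes "0 \<le> s" "s \<le> real m"
  shows "(\<Sum>k = 1..m. of_bool (real k \<le> s) :: real) = of_int \<lfloor>s\<rfloor>"
proof -
  have "{1..m} \<inter> Collect (\<lambda>k. real k \<le> s) = {1..nat \<lfloor>s\<rfloor>}"
    using assms by (auto simp: le_nat_iff le_floor_iff)
  then show ?thesis using assms by (simp add: sum_of_bool_eq)
qed

context regression_law
begin

lemma variation_key_measurable [measurable]:
  assumes [measurable]: "f \<in> borel_measurable borel"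
  shows "(\<lambda>z. variation (\<lambda>i. f (key z i)) (srt z l)) \<in> borel_measurable (PQ I)"
  by (rule measurable_consec_sum) measurable

lemma variation_key_integrable:
  assumes [measurable]: "f \<in> borel_measurable borel" and B: "\<And>x. \<bar>f x\<bar> \<le> B"
  shows "integrable (PQ I) (\<lambda>z. variation (\<lambda>i. f (key z i)) (srt z l))"
proof (rule integrable_PQ)
  have "\<bar>\<bar>f x - f y\<bar>\<bar> \<le> 2 * B" for x y using B[of x] B[of y] by linarith
  then show "\<bar>variation (\<lambda>i. f (key z i)) (srt z l)\<bar> \<le> 2 * B * real (length l)" for z
    using consec_sum_abs_le[of "\<lambda>i j. \<bar>f (key z j) - f (key z i)\<bar>" "2 * B" "srt z l"] by simp
qed measurable

text \<open>The class of functions below contains the half-line indicators, whose variation along any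
  sorted sample is at most one, and it is closed under approximation in mean; so it contains all
  bounded Borel functions with values in the unit interval.\<close>

definition small_variation :: "(real \<Rightarrow> real) \<Rightarrow> bool" where
  "small_variation f \<longleftrightarrow> f \<in> borel_measurable borel \<and> (\<exists>B. \<forall>x. \<bar>f x\<bar> \<le> B) \<and>
    (\<forall>e>0. \<exists>C. \<forall>l. distinct l \<longrightarrow>
      (\<integral>z. variation (\<lambda>i. f (key z i)) (srt z l) \<partial>PQ (set l)) \<le> e * real (length l) + C)"

lemma small_variation_integrable:
  "small_variation f \<Longrightarrow> integrable (PQ I) (\<lambda>z. variation (\<lambda>i. f (key z i)) (srt z l))"
  unfolding small_variation_def using variation_key_integrable by blast

lemma small_variationE:
  fixes e :: real
  assumes "small_variation f" "e > 0"
  obtains C where "\<And>l. distinct l \<Longrightarrow>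
    (\<integral>z. variation (\<lambda>i. f (key z i)) (srt z l) \<partial>PQ (set l)) \<le> e * real (length l) + C"
  using assms unfolding small_variation_def by blast

lemma small_variation_add:
  assumes f: "small_variation f" and h: "small_variation h"
  shows "small_variation (\<lambda>x. f x + h x)"
  unfolding small_variation_def
proof (intro conjI allI impI)
  obtain B1 B2 where B: "\<And>x. \<bar>f x\<bar> \<le> B1" "\<And>x. \<bar>h x\<bar> \<le> B2"
    using f h unfolding small_variation_def by blast
  have "\<bar>f x + h x\<bar> \<le> B1 + B2" for x using B(1)[of x] B(2)[of x] by linarith
  then show "\<exists>B. \<forall>x. \<bar>f x + h x\<bar> \<le> B" by blast
  have [measurable]: "f \<in> borel_measurable borel" "h \<in> borel_measurable borel"
    using f h by (auto simp: small_variation_def)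
  show m: "(\<lambda>x. f x + h x) \<in> borel_measurable borel" by measurable
  fix e :: real assume "e > 0"
  then have e2: "e / 2 > 0" by simp
  obtain C where C: "\<And>l. distinct l \<Longrightarrow> (\<integral>z. variation (\<lambda>i. f (key z i)) (srt z l) \<partial>PQ (set l)) \<le> e / 2 * real (length l) + C"
    using small_variationE[OF f e2] by blast
  obtain D where D: "\<And>l. distinct l \<Longrightarrow> (\<integral>z. variation (\<lambda>i. h (key z i)) (srt z l) \<partial>PQ (set l)) \<le> e / 2 * real (length l) + D"
    using small_variationE[OF h e2] by blast
  have "(\<integral>z. variation (\<lambda>i. f (key z i) + h (key z i)) (srt z l) \<partial>PQ (set l)) \<le> e * real (length l) + (C + D)"
    if l: "distinct l" for l
  proof -
    have "(\<integral>z. variation (\<lambda>i. f (key z i) + h (key z i)) (srt z l) \<partial>PQ (set l))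
      \<le> (\<integral>z. variation (\<lambda>i. f (key z i)) (srt z l) + variation (\<lambda>i. h (key z i)) (srt z l) \<partial>PQ (set l))"
    proof (rule integral_mono)
      show "integrable (PQ (set l)) (\<lambda>z. variation (\<lambda>i. f (key z i) + h (key z i)) (srt z l))"
        using m \<open>\<And>x. \<bar>f x + h x\<bar> \<le> B1 + B2\<close> by (rule variation_key_integrable)
      show "variation (\<lambda>i. f (key z i) + h (key z i)) (srt z l)
        \<le> variation (\<lambda>i. f (key z i)) (srt z l) + variation (\<lambda>i. h (key z i)) (srt z l)" for z
        unfolding consec_sum_add[symmetric] by (rule consec_sum_mono) linarith
    qed (intro Bochner_Integration.integrable_add small_variation_integrable f h)
    also have "\<dots> = (\<integral>z. variation (\<lambda>i. f (key z i)) (srt z l) \<partial>PQ (set l)) + (\<integral>z. variation (\<lambda>i. h (key z i)) (srt z l) \<partial>PQ (set l))"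
      by (intro Bochner_Integration.integral_add small_variation_integrable f h)
    finally show ?thesis using C[OF l] D[OF l] by linarith
  qed
  then show "\<exists>C. \<forall>l. distinct l \<longrightarrow> (\<integral>z. variation (\<lambda>i. f (key z i) + h (key z i)) (srt z l) \<partial>PQ (set l)) \<le> e * real (length l) + C"
    by blast
qed

lemma small_variation_const: "small_variation (\<lambda>_. c)"
proof -
  have "consec_sum (\<lambda>i j. 0) l = 0" for l :: "nat list"
    by (induction l rule: induct_list012) auto
  then show ?thesis unfolding small_variation_def by (auto intro: exI[of _ "\<bar>c\<bar>"] exI[of _ 0])
qed

lemma small_variation_cmult:
  assumes f: "small_variation f"
  shows "small_variation (\<lambda>x. c * f x)"
proof (cases "c = 0")
  case True
  then show ?thesis using small_variation_const[of 0] by simp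
next
  case False
  have eq: "variation (\<lambda>i. c * f (x i)) l = \<bar>c\<bar> * variation (\<lambda>i. f (x i)) l" for x and l :: "nat list"
    unfolding consec_sum_cmult[symmetric] by (rule consec_sum_cong) (simp add: abs_mult flip: right_diff_distrib)
  show ?thesis
    unfolding small_variation_def eq
  proof (intro conjI allI impI)
    obtain B where B: "\<And>x. \<bar>f x\<bar> \<le> B"
      using f unfolding small_variation_def by blast
    have "\<bar>c * f x\<bar> \<le> \<bar>c\<bar> * B" for x using B[of x] by (simp add: abs_mult mult_left_mono)
    then show "\<exists>B. \<forall>x. \<bar>c * f x\<bar> \<le> B" by blast
    show "(\<lambda>x. c * f x) \<in> borel_measurable borel" using f by (auto simp: small_variation_def)
    fix e :: real assume "e > 0"
    with False have "e / \<bar>c\<bar> > 0" by simp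
    then obtain C where C: "\<And>l. distinct l \<Longrightarrow> (\<integral>z. variation (\<lambda>i. f (key z i)) (srt z l) \<partial>PQ (set l)) \<le> e / \<bar>c\<bar> * real (length l) + C"
      using small_variationE[OF f] by blast
    have "(\<integral>z. \<bar>c\<bar> * variation (\<lambda>i. f (key z i)) (srt z l) \<partial>PQ (set l)) \<le> e * real (length l) + \<bar>c\<bar> * C" if "distinct l" for l
      using mult_left_mono[OF C[OF that], of "\<bar>c\<bar>"] False by (simp add: distrib_left)
    then show "\<exists>C. \<forall>l. distinct l \<longrightarrow> (\<integral>z. \<bar>c\<bar> * variation (\<lambda>i. f (key z i)) (srt z l) \<partial>PQ (set l)) \<le> e * real (length l) + C"
      by blast
  qed
qed

lemma small_variation_sum:
  assumes "\<And>i. i \<in> A \<Longrightarrow> small_variation (f i)"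
  shows "small_variation (\<lambda>x. \<Sum>i\<in>A. f i x)"
  using assms
proof (induction A rule: infinite_finite_induct)
  case (insert a A)
  then show ?case by (simp add: small_variation_add)
qed (simp_all add: small_variation_const)

lemma integral_sum_list_key:
  assumes l: "distinct l" and f [measurable]: "f \<in> borel_measurable borel" and B: "\<And>x. \<bar>f x\<bar> \<le> B"
  shows "(\<integral>z. (\<Sum>i\<leftarrow>l. f (key z i)) \<partial>PQ (set l)) = real (length l) * (\<integral>p. f (fst p) \<partial>P)"
    and "integrable (PQ I) (\<lambda>z. \<Sum>i\<leftarrow>l. f (key z i))"
proof -
  have int: "integrable (PQ I) (\<lambda>z. f (key z i))" for i I
    using B by (intro integrable_PQ[where B=B]) auto
  have fm: "(\<lambda>p. f (fst p)) \<in> borel_measurable (borel :: (real \<times> real \<times> real) measure)"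
    by (simp add: borel_prod[symmetric])
  have "(\<integral>z. (\<Sum>i\<in>set l. f (key z i)) \<partial>PQ (set l)) = (\<Sum>i\<in>set l. \<integral>z. f (key z i) \<partial>PQ (set l))"
    by (rule Bochner_Integration.integral_sum) (rule int)
  also have "\<dots> = (\<Sum>i\<in>set l. \<integral>p. f (fst p) \<partial>P)"
    by (intro sum.cong refl integral_component[where f="\<lambda>p. f (fst p)"] fm)
  finally show "(\<integral>z. (\<Sum>i\<leftarrow>l. f (key z i)) \<partial>PQ (set l)) = real (length l) * (\<integral>p. f (fst p) \<partial>P)"
    using l by (simp add: sum_list_distinct_conv_sum_set distinct_card)
  show "integrable (PQ I) (\<lambda>z. \<Sum>i\<leftarrow>l. f (key z i))"
    using l int by (simp add: sum_list_distinct_conv_sum_set)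
qed

text \<open>Passing from \<open>h\<close> to \<open>f\<close> costs twice the deviation at each key,
  in mean twice the L1 distance per observation. Distance \<open>e / 4\<close> uses one half of the
  allowed slope and the variation of \<open>h\<close> the other half; the additive constant is that
  of \<open>h\<close>.\<close>

lemma small_variation_approx:
  assumes f [measurable]: "f \<in> borel_measurable borel" and B: "\<And>x. \<bar>f x\<bar> \<le> B"
    and approx: "\<And>e. e > 0 \<Longrightarrow> \<exists>h. small_variation h \<and> (\<integral>p. \<bar>f (fst p) - h (fst p)\<bar> \<partial>P) \<le> e"
  shows "small_variation f"
  unfolding small_variation_def
proof (intro conjI allI impI f)
  show "\<exists>B. \<forall>x. \<bar>f x\<bar> \<le> B" using B by blast
  fix e :: real assume "e > 0"
  then obtain h where h: "small_variation h" and fh: "(\<integral>p. \<bar>f (fst p) - h (fst p)\<bar> \<partial>P) \<le> e / 4"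
    using approx[of "e / 4"] by auto
  obtain B' where B': "\<And>x. \<bar>h x\<bar> \<le> B'" using h unfolding small_variation_def by blast
  have [measurable]: "h \<in> borel_measurable borel" using h by (auto simp: small_variation_def)
  obtain C where C: "\<And>l. distinct l \<Longrightarrow> (\<integral>z. variation (\<lambda>i. h (key z i)) (srt z l) \<partial>PQ (set l)) \<le> e / 2 * real (length l) + C"
    using small_variationE[OF h, of "e / 2"] \<open>e > 0\<close> by auto
  let ?d = "\<lambda>x. \<bar>f x - h x\<bar>"
  have d: "\<bar>?d x\<bar> \<le> B + B'" for x using B[of x] B'[of x] by linarith
  have dm: "?d \<in> borel_measurable borel" by measurable
  have "(\<integral>z. variation (\<lambda>i. f (key z i)) (srt z l) \<partial>PQ (set l)) \<le> e * real (length l) + C" if l: "distinct l" for l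
  proof -
    note sl = integral_sum_list_key[OF l dm d]
    have "(\<integral>z. variation (\<lambda>i. f (key z i)) (srt z l) \<partial>PQ (set l))
      \<le> (\<integral>z. variation (\<lambda>i. h (key z i)) (srt z l) + 2 * (\<Sum>i\<leftarrow>l. ?d (key z i)) \<partial>PQ (set l))"
    proof (rule integral_mono)
      show "integrable (PQ (set l)) (\<lambda>z. variation (\<lambda>i. f (key z i)) (srt z l))"
        using f B by (rule variation_key_integrable)
      show "variation (\<lambda>i. f (key z i)) (srt z l) \<le> variation (\<lambda>i. h (key z i)) (srt z l) + 2 * (\<Sum>i\<leftarrow>l. ?d (key z i))" for z
        using variation_diff_le[of "\<lambda>i. f (key z i)" "srt z l" "\<lambda>i. h (key z i)"] by (simp only: sum_list_lex_sort)
    qed (intro Bochner_Integration.integrable_add small_variation_integrable h integrable_mult_right sl(2))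
    also have "\<dots> = (\<integral>z. variation (\<lambda>i. h (key z i)) (srt z l) \<partial>PQ (set l)) + 2 * (real (length l) * (\<integral>p. ?d (fst p) \<partial>P))"
      using sl by (simp add: Bochner_Integration.integral_add small_variation_integrable[OF h])
    also have "\<dots> \<le> e / 2 * real (length l) + C + 2 * (real (length l) * (e / 4))"
      using fh by (intro add_mono C l mult_left_mono) auto
    finally show ?thesis by simp
  qed
  then show "\<exists>C. \<forall>l. distinct l \<longrightarrow> (\<integral>z. variation (\<lambda>i. f (key z i)) (srt z l) \<partial>PQ (set l)) \<le> e * real (length l) + C"
    by blast
qed

lemma small_variation_atMost: "small_variation (indicator {..a})"
  unfolding small_variation_def
proof (intro conjI allI impI)
  show "\<exists>B. \<forall>x. \<bar>indicator {..a} x :: real\<bar> \<le> B" by (intro exI[of _ 1]) (auto simp: indicator_def)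
  fix e :: real assume "e > 0"
  have 1: "variation (\<lambda>i. indicator {..a} (key z i)) (srt z l) \<le> 1" for z l
    by (rule variation_mono_le[OF sorted_lex_sort]) (auto simp: antimono_def indicator_def)
  have "(\<integral>z. variation (\<lambda>i. indicator {..a} (key z i)) (srt z l) \<partial>PQ (set l)) \<le> e * real (length l) + 1" for l
  proof -
    interpret Q: prob_space "PQ (set l)" by (rule prob_space_PQ)
    have "(\<integral>z. variation (\<lambda>i. indicator {..a} (key z i)) (srt z l) \<partial>PQ (set l)) \<le> 1"
      using 1 by (intro Q.integral_le_const variation_key_integrable[where B=1] AE_I2) (auto simp: indicator_def)
    moreover have "0 \<le> e * real (length l)" using \<open>e > 0\<close> by simp
    ultimately show ?thesis by linarith
  qed
  then show "\<exists>C. \<forall>l. distinct l \<longrightarrow> (\<integral>z. variation (\<lambda>i. indicator {..a} (key z i)) (srt z l) \<partial>PQ (set l)) \<le> e * real (length l) + C"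
    by blast
qed simp

text \<open>Dynkin's argument with the half-lines \<open>{..a}\<close> as generator. For a countable
  disjoint union the additive constants of the pieces cannot simply be added up, so the union is
  approximated in L1 by finite partial unions.\<close>

lemma small_variation_indicator:
  assumes "A \<in> sets borel"
  shows "small_variation (indicator A)"
proof -
  have A: "A \<in> sigma_sets UNIV (range atMost)"
    using assms unfolding borel_eq_atMost by simp
  have stable: "Int_stable (range (atMost :: real \<Rightarrow> real set))" by (auto simp: Int_stable_def)
  have sub: "range (atMost :: real \<Rightarrow> real set) \<subseteq> Pow UNIV" by simp
  from stable sub A show ?thesis
  proof (induction rule: sigma_sets_induct_disjoint)
    case (basic A)
    then show ?case using small_variation_atMost by auto
  next
    case empty
    show ?case using small_variation_const[of 0] by (simp add: indicator_def)
  next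
    case (compl A)
    have *: "indicator (UNIV - A) = (\<lambda>x. 1 + (- 1) * indicator A x :: real)"
      by (auto simp: indicator_def)
    have "small_variation (indicator A)" using compl by blast
    from small_variation_add[OF small_variation_const[of 1] small_variation_cmult[OF this, of "- 1"]]
    show ?case by (simp only: *)
  next
    case (union A)
    have Am [measurable]: "A i \<in> sets borel" for i
      using union(2) unfolding borel_eq_atMost by (auto simp: subset_eq)
    let ?X = "\<lambda>A. fst -` A \<inter> space P"
    have Xm [measurable]: "?X (A i) \<in> sets P" for i by measurable
    show ?case
    proof (rule small_variation_approx[where B=1])
      show "indicator (\<Union> (range A)) \<in> borel_measurable borel" by measurable
      fix e :: real assume e: "e > 0"
      have "disjoint_family (\<lambda>i. ?X (A i))"
        using union(1) by (auto simp: disjoint_family_on_def)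
      then have "(\<lambda>i. prob (?X (A i))) sums prob (\<Union>i. ?X (A i))"
        by (intro finite_measure_UNION) auto
      then have "(\<lambda>k. \<Sum>i<k. prob (?X (A i))) \<longlonglongrightarrow> prob (\<Union>i. ?X (A i))"
        by (simp add: sums_def)
      then obtain k where k: "\<bar>(\<Sum>i<k. prob (?X (A i))) - prob (\<Union>i. ?X (A i))\<bar> < e"
        using e by (auto simp: LIMSEQ_def dist_real_def)
      \<comment> \<open>By disjointness this finite sum is again an indicator and lies below that of
        the whole union. The L1 distance is therefore a tail of a convergent series of
        probabilities.\<close>
      define h where "h = (\<lambda>x. \<Sum>i<k. indicator (A i) x :: real)"
      have hsmall: "small_variation h" unfolding h_def by (intro small_variation_sum union)
      have h_eq: "h = indicator (\<Union>i<k. A i)"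
      proof
        fix x
        have "disjoint_family_on A {..<k}" using union(1) by (auto simp: disjoint_family_on_def)
        then show "h x = indicator (\<Union>i<k. A i) x"
          unfolding h_def by (intro indicator_UN_disjoint[symmetric]) auto
      qed
      have "(\<integral>p. \<bar>indicator (\<Union> (range A)) (fst p) - h (fst p)\<bar> \<partial>P)
          = (\<integral>p. indicator (\<Union>i. ?X (A i)) p - (\<Sum>i<k. indicator (?X (A i)) p) \<partial>P)"
      proof (rule Bochner_Integration.integral_cong[OF refl])
        fix p assume "p \<in> space P"
        then have "(\<Sum>i<k. indicator (?X (A i)) p :: real) = h (fst p)"
          unfolding h_def by (intro sum.cong) (auto simp: indicator_def)
        moreover have "h (fst p) \<le> indicator (\<Union> (range A)) (fst p)"
          unfolding h_eq by (auto simp: indicator_def)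
        moreover have "indicator (\<Union>i. ?X (A i)) p = (indicator (\<Union> (range A)) (fst p) :: real)"
          using \<open>p \<in> space P\<close> by (auto simp: indicator_def)
        ultimately show "\<bar>indicator (\<Union> (range A)) (fst p) - h (fst p)\<bar> = indicator (\<Union>i. ?X (A i)) p - (\<Sum>i<k. indicator (?X (A i)) p)"
          by simp
      qed
      also have "\<dots> = prob (\<Union>i. ?X (A i)) - (\<Sum>i<k. prob (?X (A i)))"
        by (subst Bochner_Integration.integral_diff) (auto simp: Bochner_Integration.integral_sum less_top[symmetric])
      finally show "\<exists>h. small_variation h \<and> (\<integral>p. \<bar>indicator (\<Union> (range A)) (fst p) - h (fst p)\<bar> \<partial>P) \<le> e"
        using hsmall k by (intro exI[of _ h]) auto
    qed (auto simp: indicator_def)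
  qed
qed

lemma small_variation_bounded:
  assumes f [measurable]: "f \<in> borel_measurable borel" and f01: "\<And>x. 0 \<le> f x" "\<And>x. f x \<le> 1"
  shows "small_variation f"
proof (rule small_variation_approx[OF f, of 1])
  show "\<bar>f x\<bar> \<le> 1" for x using f01[of x] by simp
  fix e :: real assume "e > 0"
  then obtain m where m: "inverse (real (Suc m)) < e" using reals_Archimedean by blast
  \<comment> \<open>The staircase below \<open>f\<close> with steps of height
    \<open>inverse (Suc m)\<close>, written as a sum of indicators of level sets: the number of
    \<open>k\<close> with \<open>k \<le> Suc m * f x\<close> is the floor of
    \<open>Suc m * f x\<close>.\<close>
  define h where "h = (\<lambda>x. inverse (Suc m) * (\<Sum>k = 1..Suc m. indicator {x. real k \<le> Suc m * f x} x))"
  have h: "small_variation h"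
    unfolding h_def by (intro small_variation_cmult small_variation_sum small_variation_indicator) measurable
  have "\<bar>f x - h x\<bar> \<le> e" for x
  proof -
    have "real (Suc m) * f x \<le> real (Suc m) * 1" using f01[of x] by (intro mult_left_mono) auto
    then have "(\<Sum>k = 1..Suc m. of_bool (real k \<le> Suc m * f x) :: real) = \<lfloor>Suc m * f x\<rfloor>"
      using f01[of x] by (intro card_le_eq_floor) auto
    then have hx: "h x = inverse (Suc m) * \<lfloor>Suc m * f x\<rfloor>"
      by (simp add: h_def indicator_def of_bool_def)
    have "f x - h x = inverse (Suc m) * (Suc m * f x - \<lfloor>Suc m * f x\<rfloor>)"
      unfolding hx by (simp add: right_diff_distrib)
    moreover have "\<bar>Suc m * f x - \<lfloor>Suc m * f x\<rfloor>\<bar> \<le> 1" by linarith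
    ultimately have "\<bar>f x - h x\<bar> \<le> inverse (Suc m) * 1"
      by (simp only: abs_mult) (intro mult_mono; simp)
    then show ?thesis using m by simp
  qed
  moreover have "h \<in> borel_measurable borel" using h by (simp add: small_variation_def)
  ultimately have "(\<integral>p. \<bar>f (fst p) - h (fst p)\<bar> \<partial>P) \<le> e"
    by (intro integral_le_const integrable_const_bound[where B=e] AE_I2) auto
  with h show "\<exists>h. small_variation h \<and> (\<integral>p. \<bar>f (fst p) - h (fst p)\<bar> \<partial>P) \<le> e" by blast
qed

end

section \<open>Convergence of the rank variation\<close>

lemma xi_num_le: "xi_num n x y u \<le> real n * real n"
proof -
  have "xi_num n x y u \<le> (\<Sum>m<n. real (length (lex_sort x u [0..<n])))"
    unfolding xi_num_def by (intro sum_mono consec_sum_le_length) auto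
  then show ?thesis by simp
qed

lemma xi_num_cong:
  assumes "\<And>i. i < n \<Longrightarrow> x i = x' i" "\<And>i. i < n \<Longrightarrow> y i = y' i" "\<And>i. i < n \<Longrightarrow> u i = u' i"
  shows "xi_num n x y u = xi_num n x' y' u'"
proof -
  have "lex_sort x u [0..<n] = lex_sort x' u' [0..<n]" by (rule lex_sort_cong) (use assms in auto)
  then show ?thesis
    unfolding xi_num_def by (intro sum.cong refl) (auto intro!: consec_sum_cong simp: assms)
qed

text \<open>For a threshold \<open>m\<close> other than \<open>i\<close>, deleting \<open>i\<close>
  from both sorted lists leaves identical data, at a cost of 2 on each side. The threshold
  \<open>i\<close> itself may move arbitrarily, but its variation never exceeds \<open>n\<close>.
  Together this is at most 4n + n.\<close>

lemma xi_num_bounded_difference: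
  assumes "i < n"
  shows "\<bar>xi_num n (key (z(i := w))) (resp (z(i := w))) (tag (z(i := w))) - xi_num n (key z) (resp z) (tag z)\<bar> \<le> 5 * real n"
proof -
  define v where "v z m = variation (\<lambda>j. of_bool (resp z m \<le> resp z j)) (srt z [0..<n])" for z m
  let ?z = "z(i := w)"
  have "\<bar>v ?z m - v z m\<bar> \<le> 4" if "m < n" "m \<noteq> i" for m
  proof -
    let ?L = "filter (\<lambda>j. j \<noteq> i) [0..<n]"
    let ?f = "\<lambda>z j. of_bool (resp z m \<le> resp z j) :: real"
    have "srt ?z ?L = srt z ?L" by (rule lex_sort_cong) auto
    then have "variation (?f ?z) (srt ?z ?L) = variation (?f z) (srt z ?L)"
      using that by (auto intro!: consec_sum_cong)
    moreover have "\<bar>v z m - variation (?f z) (srt z ?L)\<bar> \<le> 2" "\<bar>v ?z m - variation (?f ?z) (srt ?z ?L)\<bar> \<le> 2"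
      unfolding v_def using assms by (auto intro!: variation_lex_sort_delete)
    ultimately show ?thesis by linarith
  qed
  moreover have "\<bar>v ?z i - v z i\<bar> \<le> real n"
  proof -
    have "0 \<le> v z i" "v z i \<le> real n" for z
      using consec_sum_le_length[of "\<lambda>a b. \<bar>of_bool (resp z i \<le> resp z b) - of_bool (resp z i \<le> resp z a)\<bar>" "srt z [0..<n]"]
      unfolding v_def by (auto intro!: variation_nonneg)
    from this[of z] this[of ?z] show ?thesis by linarith
  qed
  ultimately have "(\<Sum>m<n. \<bar>v ?z m - v z m\<bar>) \<le> (\<Sum>m<n. 4 + (if m = i then real n else 0))"
    by (intro sum_mono) (auto intro: add_increasing)
  also have "\<dots> = 4 * real n + real n" using assms by (simp add: sum.distrib)
  finally have "\<bar>\<Sum>m<n. v ?z m - v z m\<bar> \<le> 5 * real n"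
    using sum_abs[of "\<lambda>m. v ?z m - v z m" "{..<n}"] by linarith
  then show ?thesis by (simp only: xi_num_def v_def sum_subtractf)
qed

section \<open>Mean variation at a fixed threshold\<close>

context regression_law
begin

text \<open>The integrand is the probability that two responses, independent given a common key,
  fall on different sides of \<open>t\<close>. Neighbours in the sorted sample behave like such a
  pair.\<close>

definition limit_var :: "real \<Rightarrow> real" where
  "limit_var t = (\<integral>p. 2 * (g t (fst p) - (g t (fst p))\<^sup>2) \<partial>P)"

definition mean_var :: "nat list \<Rightarrow> real \<Rightarrow> real" where
  "mean_var l t = (\<integral>z. variation (\<lambda>i. of_bool (t \<le> resp z i)) (srt z l) \<partial>PQ (set l))"

lemma bernoulli_var: "0 \<le> g t x - (g t x)\<^sup>2" "g t x - (g t x)\<^sup>2 \<le> 1 / 2"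
proof -
  have "0 \<le> g t x * (1 - g t x)" using g_nonneg g_le_1 by (intro mult_nonneg_nonneg) (auto simp: algebra_simps)
  moreover have "0 \<le> (g t x - 1/2)\<^sup>2" by simp
  ultimately show "0 \<le> g t x - (g t x)\<^sup>2" "g t x - (g t x)\<^sup>2 \<le> 1 / 2"
    by (simp_all add: power2_eq_square algebra_simps)
qed

lemma limit_var_bounds: "0 \<le> limit_var t" "limit_var t \<le> 1"
proof -
  show "0 \<le> limit_var t" unfolding limit_var_def using bernoulli_var by (intro integral_nonneg_AE) auto
  have *: "2 * (g t x - (g t x)\<^sup>2) \<le> 1" "0 \<le> 2 * (g t x - (g t x)\<^sup>2)" for x
    using bernoulli_var[of t x] by auto
  then show "limit_var t \<le> 1" unfolding limit_var_def
    by (intro integral_le_const integrable_const_bound[where B=1] AE_I2) (auto simp del: mult_le_cancel_left)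
qed

text \<open>After the responses are replaced by \<open>g t\<close>, the sum differs from the sum of
  Bernoulli variances by at most the variation of \<open>g t\<close>, which has small slope in mean.
  The constant \<open>C\<close> does not depend on \<open>l\<close>; this uniformity is what later
  allows a different index set for each left-out \<open>m\<close>.\<close>

lemma mean_var_approx:
  fixes e :: real
  assumes "e > 0"
  obtains C where "\<And>l. distinct l \<Longrightarrow> \<bar>mean_var l t - real (length l) * limit_var t\<bar> \<le> e * real (length l) + C"
proof -
  let ?g = "\<lambda>z i. g t (key z i)"
  have small: "small_variation (g t)"
    using g_nonneg g_le_1 by (intro small_variation_bounded) auto
  then obtain C where C: "\<And>l. distinct l \<Longrightarrow> (\<integral>z. variation (?g z) (srt z l) \<partial>PQ (set l)) \<le> e * real (length l) + C"
    using small_variationE[OF _ assms] by blast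
  have "\<bar>mean_var l t - real (length l) * limit_var t\<bar> \<le> e * real (length l) + (C + 1)" if l: "distinct l" for l
  proof -
    interpret Q: prob_space "PQ (set l)" by (rule prob_space_PQ)
    let ?A = "\<lambda>z. consec_sum (\<lambda>i j. ?g z i + ?g z j - 2 * (?g z i * ?g z j)) (srt z l)"
    let ?w = "\<lambda>x. 2 * (g t x - (g t x)\<^sup>2)"
    let ?S = "\<lambda>z. \<Sum>i\<leftarrow>l. ?w (key z i)"
    have wm: "?w \<in> borel_measurable borel" by measurable
    have wb: "\<bar>?w x\<bar> \<le> 1" for x using bernoulli_var[of t x] by auto
    note S = integral_sum_list_key[OF l wm wb]
    have close: "\<bar>?A z - ?S z\<bar> \<le> variation (?g z) (srt z l) + 1" for z
      using consec_sum_variance[of "?g z" "srt z l"] by (simp only: sum_list_lex_sort g_nonneg g_le_1 simp_thms)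
    have Aint: "integrable (PQ (set l)) ?A"
    proof (rule integrable_PQ)
      show "?A \<in> borel_measurable (PQ (set l))" by (rule measurable_consec_sum) measurable
      have "\<bar>?g z i + ?g z j - 2 * (?g z i * ?g z j)\<bar> \<le> 4" for z i j
      proof -
        have "0 \<le> ?g z i * ?g z j" "?g z i * ?g z j \<le> 1"
          using g_nonneg g_le_1 by (auto intro!: mult_le_one)
        with g_nonneg[of t "key z i"] g_nonneg[of t "key z j"] g_le_1[of t "key z i"] g_le_1[of t "key z j"]
        show ?thesis by linarith
      qed
      then show "\<bar>?A z\<bar> \<le> 4 * real (length l)" for z
        using consec_sum_abs_le[of "\<lambda>i j. ?g z i + ?g z j - 2 * (?g z i * ?g z j)" 4 "srt z l"] by simp
    qed
    have Vint: "integrable (PQ (set l)) (\<lambda>z. variation (?g z) (srt z l))"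
      by (rule small_variation_integrable[OF small])
    have "\<bar>(\<integral>z. ?A z \<partial>PQ (set l)) - (\<integral>z. ?S z \<partial>PQ (set l))\<bar> = \<bar>\<integral>z. ?A z - ?S z \<partial>PQ (set l)\<bar>"
      using Aint S(2) by (simp only: Bochner_Integration.integral_diff)
    also have "\<dots> \<le> (\<integral>z. \<bar>?A z - ?S z\<bar> \<partial>PQ (set l))" by (rule integral_abs_bound)
    also have "\<dots> \<le> (\<integral>z. variation (?g z) (srt z l) + 1 \<partial>PQ (set l))"
      using close by (intro integral_mono integrable_abs Bochner_Integration.integrable_diff Bochner_Integration.integrable_add Aint S Vint) auto
    also have "\<dots> = (\<integral>z. variation (?g z) (srt z l) \<partial>PQ (set l)) + 1"
      using Vint by (simp add: Q.prob_space)
    finally have "\<bar>(\<integral>z. ?A z \<partial>PQ (set l)) - (\<integral>z. ?S z \<partial>PQ (set l))\<bar> \<le> e * real (length l) + (C + 1)"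
      using C[OF l] by linarith
    moreover have "mean_var l t = (\<integral>z. ?A z \<partial>PQ (set l))"
      unfolding mean_var_def by (rule integral_consec_sum_replace[OF l])
    moreover have "(\<integral>z. ?S z \<partial>PQ (set l)) = real (length l) * limit_var t"
      unfolding limit_var_def by (rule S)
    ultimately show ?thesis by simp
  qed
  then show thesis by (rule that)
qed

lemma variation_resp_bounds:
  "0 \<le> variation (\<lambda>i. of_bool (t \<le> resp z i)) (srt z l)"
  "variation (\<lambda>i. of_bool (t \<le> resp z i)) (srt z l) \<le> real (length l)"
  using consec_sum_le_length[of "\<lambda>i j. \<bar>of_bool (t \<le> resp z j) - of_bool (t \<le> resp z i)\<bar>" "srt z l"]
  by (auto intro: variation_nonneg)

lemma variation_resp_measurable [measurable]:
  assumes [measurable]: "t \<in> borel_measurable N" "h \<in> N \<rightarrow>\<^sub>M PQ I"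
  shows "(\<lambda>p. variation (\<lambda>i. of_bool (t p \<le> resp (h p) i)) (srt (h p) l)) \<in> borel_measurable N"
proof (rule measurable_consec_sum)
  have [measurable]: "(\<lambda>p. resp (h p) i) \<in> borel_measurable N" for i
    by (rule measurable_compose[OF assms(2) measurable_coords(2)])
  show "(\<lambda>p. \<bar>of_bool (t p \<le> resp (h p) j) - of_bool (t p \<le> resp (h p) i)\<bar>) \<in> borel_measurable N" for i j
    by measurable
  show "(\<lambda>p. srt (h p) l) \<in> N \<rightarrow>\<^sub>M count_space UNIV"
    by (rule measurable_compose[OF assms(2) measurable_srt])
qed

lemma variation_resp_measurable_PQ [measurable]:
  assumes "t \<in> borel_measurable (PQ I)"
  shows "(\<lambda>z. variation (\<lambda>i. of_bool (t z \<le> resp z i)) (srt z l)) \<in> borel_measurable (PQ I)"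
  using variation_resp_measurable[OF assms, of "\<lambda>z. z"] by simp

lemma mean_var_bounds: "0 \<le> mean_var l t" "mean_var l t \<le> real (length l)"
proof -
  interpret Q: prob_space "PQ (set l)" by (rule prob_space_PQ)
  show "0 \<le> mean_var l t"
    unfolding mean_var_def by (intro integral_nonneg_AE AE_I2 variation_resp_bounds)
  show "mean_var l t \<le> real (length l)"
    unfolding mean_var_def using variation_resp_bounds
    by (intro Q.integral_le_const integrable_PQ[where B="length l"] AE_I2) auto
qed

lemma mean_var_measurable [measurable]: "mean_var l \<in> borel_measurable borel"
proof -
  interpret Q: prob_space "PQ (set l)" by (rule prob_space_PQ)
  have "(\<lambda>p. variation (\<lambda>i. of_bool (fst p \<le> resp (snd p) i)) (srt (snd p) l)) \<in> borel_measurable (borel \<Otimes>\<^sub>M PQ (set l))"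
    by (rule variation_resp_measurable) auto
  then show ?thesis unfolding mean_var_def
    by (intro Q.borel_measurable_lebesgue_integral) (simp add: case_prod_beta')
qed

text \<open>Since \<open>m\<close> is not in \<open>l\<close>, the threshold is independent of the
  sorted sample, and Fubini turns it into a fresh response drawn from \<open>P\<close>.\<close>

lemma integral_variation_own_threshold:
  assumes l: "distinct l" "m \<notin> set l"
  shows "(\<integral>z. variation (\<lambda>i. of_bool (resp z m \<le> resp z i)) (srt z l) \<partial>PQ (insert m (set l)))
    = (\<integral>p. mean_var l (fst (snd p)) \<partial>P)"
proof -
  interpret Q: prob_space "PQ (set l)" by (rule prob_space_PQ)
  interpret R: pair_prob_space "PQ (set l)" P ..
  let ?v = "\<lambda>t z. variation (\<lambda>i. of_bool (t \<le> resp z i)) (srt z l)"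
  have upd: "?v t (z(m := w)) = ?v t z" for t z w
  proof -
    have "srt (z(m := w)) l = srt z l" using l by (intro lex_sort_cong) auto
    then show ?thesis using l by (auto intro!: consec_sum_cong)
  qed
  have int: "integrable (PQ (insert m (set l))) (\<lambda>z. ?v (resp z m) z)"
    using variation_resp_bounds by (intro integrable_PQ[where B="length l"] variation_resp_measurable_PQ) auto
  have "(\<integral>z. ?v (resp z m) z \<partial>PQ (insert m (set l))) = (\<integral>z. \<integral>w. ?v (fst (snd w)) (z(m := w)) \<partial>P \<partial>PQ (set l))"
    using product_integral_insert[OF _ l(2) int] by simp
  also have "\<dots> = (\<integral>z. \<integral>w. ?v (fst (snd w)) z \<partial>P \<partial>PQ (set l))" by (simp only: upd)
  also have "\<dots> = (\<integral>w. \<integral>z. ?v (fst (snd w)) z \<partial>PQ (set l) \<partial>P)"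
  proof (rule R.Fubini_integral[symmetric])
    have "(\<lambda>q. ?v (fst (snd (snd q))) (fst q)) \<in> borel_measurable (PQ (set l) \<Otimes>\<^sub>M P)"
      by (rule variation_resp_measurable) auto
    then show "integrable (PQ (set l) \<Otimes>\<^sub>M P) (\<lambda>(z, w). ?v (fst (snd w)) z)"
      using variation_resp_bounds by (intro R.integrable_const_bound[where B="length l"] AE_I2) (auto simp: case_prod_beta')
  qed
  finally show ?thesis by (simp add: mean_var_def)
qed

section \<open>Mean of the normalized statistic with decoupled thresholds\<close>

definition mean_stat :: "nat \<Rightarrow> real" where
  "mean_stat n = (\<integral>z. xi_num n (key z) (resp z) (tag z) / (real n)\<^sup>2 \<partial>PQ {..<n})"

lemma xi_num_measurable [measurable]:
  "(\<lambda>z. xi_num n (key z) (resp z) (tag z)) \<in> borel_measurable (PQ I)"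
  unfolding xi_num_def by (intro borel_measurable_sum variation_resp_measurable_PQ) auto

text \<open>All left-out samples are confronted with one threshold, the response of
  \<open>p\<close>. Their index sets differ, and the sum over \<open>m\<close> is kept as it stands
  because the bounds on \<open>mean_var\<close> are uniform in the list.\<close>

definition threshold_mean :: "nat \<Rightarrow> real \<times> real \<times> real \<Rightarrow> real" where
  "threshold_mean n p = (\<Sum>m<n. mean_var (filter (\<lambda>i. i \<noteq> m) [0..<n]) (fst (snd p))) / (real n)\<^sup>2"

lemma length_filter_neq: "m < n \<Longrightarrow> length (filter (\<lambda>i. i \<noteq> m) [0..<n]) = n - 1"
proof -
  assume "m < n"
  have "length (filter (\<lambda>i. i \<noteq> m) [0..<n]) = card ({..<n} - {m})"
    by (subst distinct_card[symmetric]) (auto intro!: arg_cong[where f=card])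
  with \<open>m < n\<close> show ?thesis by simp
qed

text \<open>Deleting \<open>m\<close> from the list sorted for threshold \<open>m\<close> changes a
  variation by at most 2; there are \<open>n\<close> thresholds and the normalization is
  \<open>n\<close> squared.\<close>

lemma mean_stat_threshold_mean: "\<bar>mean_stat n - (\<integral>p. threshold_mean n p \<partial>P)\<bar> \<le> 2 / real n"
proof (cases "n = 0")
  case False
  let ?L = "\<lambda>m. filter (\<lambda>i. i \<noteq> m) [0..<n]"
  let ?v = "\<lambda>l m z. variation (\<lambda>i. of_bool (resp z m \<le> resp z i)) (srt z l)"
  interpret Q: prob_space "PQ {..<n}" by (rule prob_space_PQ)
  have int: "integrable (PQ I) (?v l m)" for l m I
    using variation_resp_bounds by (intro integrable_PQ[where B="length l"] variation_resp_measurable_PQ) auto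
  have close: "\<bar>(\<integral>z. ?v [0..<n] m z \<partial>PQ {..<n}) - (\<integral>p. mean_var (?L m) (fst (snd p)) \<partial>P)\<bar> \<le> 2" if "m < n" for m
  proof -
    have ins: "insert m (set (?L m)) = {..<n}" using that by auto
    have "(\<integral>z. ?v (?L m) m z \<partial>PQ {..<n}) = (\<integral>p. mean_var (?L m) (fst (snd p)) \<partial>P)"
      using integral_variation_own_threshold[of "?L m" m] unfolding ins by simp
    moreover have "\<bar>(\<integral>z. ?v [0..<n] m z \<partial>PQ {..<n}) - (\<integral>z. ?v (?L m) m z \<partial>PQ {..<n})\<bar> \<le> 2"
    proof (rule Q.integral_diff_le_of_bounded[where B="real n"])
      show "\<bar>?v [0..<n] m z\<bar> \<le> real n" for z
        using variation_resp_bounds[of "resp z m" z "[0..<n]"] by simp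
      show "\<bar>?v (?L m) m z\<bar> \<le> real n" for z
        using variation_resp_bounds[of "resp z m" z "?L m"] length_filter_neq[OF that] by simp
      show "\<bar>?v [0..<n] m z - ?v (?L m) m z\<bar> \<le> 2" for z
        using that by (intro variation_lex_sort_delete) auto
    qed (intro variation_resp_measurable_PQ; simp)+
    ultimately show ?thesis by simp
  qed
  have "mean_stat n = (\<Sum>m<n. \<integral>z. ?v [0..<n] m z \<partial>PQ {..<n}) / (real n)\<^sup>2"
    unfolding mean_stat_def xi_num_def using int by (simp add: Bochner_Integration.integral_sum)
  moreover have "(\<integral>p. threshold_mean n p \<partial>P) = (\<Sum>m<n. \<integral>p. mean_var (?L m) (fst (snd p)) \<partial>P) / (real n)\<^sup>2"
  proof -
    have "integrable P (\<lambda>p. mean_var l (fst (snd p)))" for l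
      using mean_var_bounds by (intro integrable_const_bound[where B="real (length l)"] AE_I2) auto
    then show ?thesis unfolding threshold_mean_def by (simp add: Bochner_Integration.integral_sum)
  qed
  ultimately have "\<bar>mean_stat n - (\<integral>p. threshold_mean n p \<partial>P)\<bar>
    = \<bar>\<Sum>m<n. (\<integral>z. ?v [0..<n] m z \<partial>PQ {..<n}) - (\<integral>p. mean_var (?L m) (fst (snd p)) \<partial>P)\<bar> / (real n)\<^sup>2"
    by (simp add: sum_subtractf diff_divide_distrib[symmetric])
  also have "\<dots> \<le> (\<Sum>m<n. 2) / (real n)\<^sup>2"
    using close by (intro divide_right_mono order_trans[OF sum_abs] sum_mono) auto
  also have "\<dots> = 2 / real n" using False by (simp add: power2_eq_square)
  finally show ?thesis .
qed (simp add: mean_stat_def threshold_mean_def)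

lemma threshold_mean_bounds: "0 \<le> threshold_mean n p" "threshold_mean n p \<le> 1"
proof -
  show "0 \<le> threshold_mean n p"
    unfolding threshold_mean_def by (intro divide_nonneg_nonneg sum_nonneg mean_var_bounds) auto
  show "threshold_mean n p \<le> 1"
  proof (cases "n = 0")
    case False
    have "(\<Sum>m<n. mean_var (filter (\<lambda>i. i \<noteq> m) [0..<n]) (fst (snd p))) \<le> (\<Sum>m<n. real n)"
      by (intro sum_mono order_trans[OF mean_var_bounds(2)]) (simp add: length_filter_neq)
    with False show ?thesis unfolding threshold_mean_def by (simp add: divide_simps power2_eq_square)
  qed (simp add: threshold_mean_def)
qed

lemma threshold_mean_tendsto: "(\<lambda>n. threshold_mean n p) \<longlonglongrightarrow> limit_var (fst (snd p))"
proof (rule LIMSEQ_I)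
  fix e :: real assume e: "e > 0"
  let ?t = "fst (snd p)" and ?L = "\<lambda>n m. filter (\<lambda>i. i \<noteq> m) [0..<n]"
  obtain C where C: "\<And>l. distinct l \<Longrightarrow> \<bar>mean_var l ?t - real (length l) * limit_var ?t\<bar> \<le> e / 2 * real (length l) + C"
    using mean_var_approx[of "e / 2" ?t] e by auto
  \<comment> \<open>Chosen so that the constant term, divided by \<open>n\<close>, stays below
    \<open>e / 2\<close>. The additional 1 absorbs the passage from \<open>n - 1\<close> to
    \<open>n\<close> observations, since \<open>limit_var\<close> is at most 1.\<close>
  obtain N where N: "2 * (\<bar>C\<bar> + 1) / e < real N" using reals_Archimedean2 by blast
  show "\<exists>N. \<forall>n\<ge>N. norm (threshold_mean n p - limit_var ?t) < e"
  proof (intro exI allI impI)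
    fix n assume n: "n \<ge> Suc N"
    then have n0: "real n > 0" by simp
    have each: "\<bar>mean_var (?L n m) ?t - real n * limit_var ?t\<bar> \<le> e / 2 * real n + (\<bar>C\<bar> + 1)" if "m < n" for m
    proof -
      have "\<bar>mean_var (?L n m) ?t - real (n - 1) * limit_var ?t\<bar> \<le> e / 2 * real (n - 1) + C"
        using C[of "?L n m"] length_filter_neq[OF that] by simp
      moreover have "real (n - 1) * limit_var ?t = real n * limit_var ?t - limit_var ?t"
        using n by (simp add: of_nat_diff algebra_simps)
      moreover have "e / 2 * real (n - 1) \<le> e / 2 * real n" using e by simp
      ultimately show ?thesis using limit_var_bounds[of ?t] by linarith
    qed
    have "threshold_mean n p - limit_var ?t = (\<Sum>m<n. mean_var (?L n m) ?t - real n * limit_var ?t) / (real n)\<^sup>2"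
      unfolding threshold_mean_def using n0 by (simp add: sum_subtractf diff_divide_distrib power2_eq_square)
    then have "\<bar>threshold_mean n p - limit_var ?t\<bar> = \<bar>\<Sum>m<n. mean_var (?L n m) ?t - real n * limit_var ?t\<bar> / (real n)\<^sup>2"
      by simp
    also have "\<dots> \<le> (\<Sum>m<n. e / 2 * real n + (\<bar>C\<bar> + 1)) / (real n)\<^sup>2"
      using each by (intro divide_right_mono order_trans[OF sum_abs] sum_mono) auto
    also have "\<dots> = e / 2 + (\<bar>C\<bar> + 1) / real n"
      using n0 by (simp add: field_simps power2_eq_square)
    also have "(\<bar>C\<bar> + 1) / real n < e / 2"
    proof -
      have "2 * (\<bar>C\<bar> + 1) / e < real n" using N n by simp
      then have "2 * (\<bar>C\<bar> + 1) < real n * e" using e by (simp add: pos_divide_less_eq)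
      then show ?thesis using n0 by (simp add: pos_divide_less_eq algebra_simps)
    qed
    finally show "norm (threshold_mean n p - limit_var ?t) < e" by simp
  qed
qed

lemma threshold_mean_measurable [measurable]: "threshold_mean n \<in> borel_measurable P"
  unfolding threshold_mean_def by measurable

text \<open>The functions \<open>g t\<close> are measurable for each fixed \<open>t\<close>, with no
  joint measurability in \<open>t\<close> and \<open>x\<close>, so the defining integral does not
  settle this. The finite-sample means are measurable in the threshold by Fubini, and the limit
  inherits it.\<close>

lemma limit_var_resp_measurable [measurable]: "(\<lambda>p. limit_var (fst (snd p))) \<in> borel_measurable P"
  by (rule borel_measurable_LIMSEQ_real[OF threshold_mean_tendsto]) measurable

lemma mean_stat_tendsto: "mean_stat \<longlonglongrightarrow> (\<integral>p. limit_var (fst (snd p)) \<partial>P)"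
proof -
  have "(\<lambda>n. \<integral>p. threshold_mean n p \<partial>P) \<longlonglongrightarrow> (\<integral>p. limit_var (fst (snd p)) \<partial>P)"
    using threshold_mean_bounds
    by (intro integral_dominated_convergence[where w="\<lambda>_. 1"] AE_I2 threshold_mean_tendsto) auto
  moreover have "(\<lambda>n. mean_stat n - (\<integral>p. threshold_mean n p \<partial>P)) \<longlonglongrightarrow> 0"
  proof (rule Lim_null_comparison)
    show "eventually (\<lambda>n. norm (mean_stat n - (\<integral>p. threshold_mean n p \<partial>P)) \<le> 2 / real n) sequentially"
      using mean_stat_threshold_mean by (intro always_eventually allI) (simp only: real_norm_def)
    show "(\<lambda>n. 2 / real n) \<longlonglongrightarrow> 0" by (rule lim_const_over_n)
  qed
  ultimately show ?thesis
    using tendsto_add[of "\<lambda>n. mean_stat n - (\<integral>p. threshold_mean n p \<partial>P)" 0 sequentially] by force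
qed

lemma AE_xi_num_tendsto:
  assumes N: "prob_space N" and rv: "\<And>i. \<zeta> i \<in> borel_measurable N"
    and ind: "prob_space.indep_vars N (\<lambda>_. borel) \<zeta> UNIV"
    and law: "\<And>i. distr N borel (\<zeta> i) = P"
  shows "AE \<omega> in N. (\<lambda>n. xi_num n (\<lambda>i. fst (\<zeta> i \<omega>)) (\<lambda>i. fst (snd (\<zeta> i \<omega>))) (\<lambda>i. snd (snd (\<zeta> i \<omega>))) / (real n)\<^sup>2)
    \<longlonglongrightarrow> (\<integral>p. limit_var (fst (snd p)) \<partial>P)"
proof -
  interpret N: prob_space N by fact
  define f where "f n z = xi_num n (key z) (resp z) (tag z) / (real n)\<^sup>2" for n z
  have "AE \<omega> in N. (\<lambda>n. f n (\<lambda>i\<in>{..<n}. \<zeta> i \<omega>) - (\<integral>z. f n z \<partial>PQ {..<n})) \<longlonglongrightarrow> 0"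
  proof (rule N.bounded_difference_LLN[OF rv ind law, where B="\<lambda>_. 1" and C=5])
    show "f n \<in> borel_measurable (PQ {..<n})" for n unfolding f_def by measurable
    show "\<bar>f n z\<bar> \<le> 1" for n z
      using xi_num_nonneg[of n "key z" "resp z" "tag z"] xi_num_le[of n "key z" "resp z" "tag z"]
      by (cases "n = 0") (auto simp: f_def power2_eq_square)
    show "\<bar>f n (z(i := w)) - f n z\<bar> \<le> 5 / real n" if "i < n" for n z i w
    proof -
      have "\<bar>f n (z(i := w)) - f n z\<bar> = \<bar>xi_num n (key (z(i := w))) (resp (z(i := w))) (tag (z(i := w))) - xi_num n (key z) (resp z) (tag z)\<bar> / (real n)\<^sup>2"
        by (simp add: f_def diff_divide_distrib[symmetric] del: fun_upd_apply)
      also have "\<dots> \<le> 5 * real n / (real n)\<^sup>2"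
        by (intro divide_right_mono xi_num_bounded_difference that) auto
      also have "\<dots> = 5 / real n" using that by (simp add: power2_eq_square)
      finally show ?thesis .
    qed
  qed auto
  then show ?thesis
  proof eventually_elim
    case (elim \<omega>)
    then have "(\<lambda>n. f n (\<lambda>i\<in>{..<n}. \<zeta> i \<omega>) - mean_stat n) \<longlonglongrightarrow> 0"
      by (simp add: mean_stat_def f_def)
    from tendsto_add[OF this mean_stat_tendsto]
    have "(\<lambda>n. f n (\<lambda>i\<in>{..<n}. \<zeta> i \<omega>)) \<longlonglongrightarrow> (\<integral>p. limit_var (fst (snd p)) \<partial>P)" by simp
    moreover have "f n (\<lambda>i\<in>{..<n}. \<zeta> i \<omega>) = xi_num n (\<lambda>i. fst (\<zeta> i \<omega>)) (\<lambda>i. fst (snd (\<zeta> i \<omega>))) (\<lambda>i. snd (snd (\<zeta> i \<omega>))) / (real n)\<^sup>2" for n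
      unfolding f_def by (intro arg_cong2[where f="(/)"] xi_num_cong refl) auto
    ultimately show ?case by simp
  qed
qed

end

section \<open>Conditional expectations as regression functions\<close>

lemma ereal_eq_SUP_rat:
  "ereal y = (SUP r::rat. if of_rat r < y then ereal (of_rat r) else - \<infinity>)"
proof (rule SUP_eqI[symmetric])
  fix u :: ereal
  assume u: "\<And>r::rat. r \<in> UNIV \<Longrightarrow> (if of_rat r < y then ereal (of_rat r) else - \<infinity>) \<le> u"
  show "ereal y \<le> u"
  proof (rule ccontr)
    assume "\<not> ereal y \<le> u"
    then obtain s where s: "u < ereal s" "ereal s < ereal y"
      by (metis ereal_dense2 not_le)
    then obtain r where "s < of_rat r" "of_rat r < y" using of_rat_dense by auto
    then have "ereal (of_rat r) \<le> u" using u[of r] by simp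
    then have "ereal (of_rat r) < ereal s" using s(1) by (rule le_less_trans)
    with \<open>s < of_rat r\<close> show False by simp
  qed
qed auto

text \<open>A real function is determined by its superlevel sets at rational levels, so it is enough
  that each of these is almost surely an event of \<open>X\<close>. The lemma serves twice: for
  conditional expectations given \<open>X\<close>, and for the response when the limit
  vanishes.\<close>

lemma AE_factor:
  fixes f :: "'a \<Rightarrow> real"
  assumes "\<And>r. \<exists>A\<in>sets MX. AE m in M. r < f m \<longleftrightarrow> X m \<in> A"
  shows "\<exists>g\<in>borel_measurable MX. AE m in M. f m = g (X m)"
proof -
  have "\<forall>r::rat. \<exists>A\<in>sets MX. AE m in M. of_rat r < f m \<longleftrightarrow> X m \<in> A" using assms by blast
  then obtain A where A [measurable]: "\<And>r::rat. A r \<in> sets MX" and AE: "\<And>r. AE m in M. of_rat r < f m \<longleftrightarrow> X m \<in> A r"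
    by metis
  \<comment> \<open>The supremum of the rationals \<open>r\<close> with \<open>x \<in> A r\<close>
    recovers \<open>f\<close> where the chosen sets are consistent. Elsewhere it may be infinite,
    and \<open>real_of_ereal\<close> then gives 0.\<close>
  define g where "g x = real_of_ereal (SUP r::rat. if x \<in> A r then ereal (of_rat r) else - \<infinity>)" for x
  have "AE m in M. \<forall>r. of_rat r < f m \<longleftrightarrow> X m \<in> A r"
    unfolding AE_all_countable using AE by blast
  then have "AE m in M. f m = g (X m)"
  proof eventually_elim
    case (elim m)
    then have "(SUP r::rat. if X m \<in> A r then ereal (of_rat r) else - \<infinity>) = (SUP r::rat. if of_rat r < f m then ereal (of_rat r) else - \<infinity>)"
      by simp
    also have "\<dots> = ereal (f m)" by (rule ereal_eq_SUP_rat[symmetric])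
    finally have "(SUP r::rat. if X m \<in> A r then ereal (of_rat r) else - \<infinity>) = ereal (f m)" .
    then show ?case by (simp add: g_def)
  qed
  moreover have "g \<in> borel_measurable MX" unfolding g_def by measurable
  ultimately show ?thesis by (rule rev_bexI[rotated])
qed

lemma (in prob_space) finite_measure_subalgebra_vimage:
  assumes "X \<in> M \<rightarrow>\<^sub>M MX"
  shows "finite_measure_subalgebra M (vimage_algebra (space M) X MX)"
proof
  show "subalgebra M (vimage_algebra (space M) X MX)"
    using sets_image_in_sets[OF refl assms] by (simp add: subalgebra_def)
qed

lemma (in finite_measure_subalgebra) real_cond_exp_01:
  assumes f: "f \<in> borel_measurable M" "\<And>m. 0 \<le> f m" "\<And>m. f m \<le> 1"
  shows "AE m in M. 0 \<le> real_cond_exp M F f m \<and> real_cond_exp M F f m \<le> 1"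
proof -
  have "integrable M f" using f by (intro integrable_const_bound[where B=1]) auto
  then have "AE m in M. real_cond_exp M F f m \<le> 1" using f by (intro real_cond_exp_le_c AE_I2) auto
  moreover have "AE m in M. 0 \<le> real_cond_exp M F f m" using f by (intro real_cond_exp_pos AE_I2) auto
  ultimately show ?thesis by eventually_elim simp
qed

lemma (in prob_space) regression_function:
  fixes f :: "'a \<Rightarrow> real"
  assumes K: "K \<in> M \<rightarrow>\<^sub>M MK" and f: "f \<in> borel_measurable M" "\<And>m. 0 \<le> f m" "\<And>m. f m \<le> 1"
  shows "\<exists>g\<in>borel_measurable MK. (\<forall>x. 0 \<le> g x \<and> g x \<le> (1::real)) \<and>
    (AE m in M. real_cond_exp M (vimage_algebra (space M) K MK) f m = g (K m))"
proof -
  let ?F = "vimage_algebra (space M) K MK"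
  interpret F: finite_measure_subalgebra M ?F by (rule finite_measure_subalgebra_vimage[OF K])
  have Ksp: "K \<in> space M \<rightarrow> space MK" using measurable_space[OF K] by auto
  have "\<exists>A\<in>sets MK. AE m in M. r < real_cond_exp M ?F f m \<longleftrightarrow> K m \<in> A" for r
  proof -
    have "{m \<in> space ?F. r < real_cond_exp M ?F f m} \<in> sets ?F" by measurable
    then obtain A where "A \<in> sets MK" "{m \<in> space M. r < real_cond_exp M ?F f m} = K -` A \<inter> space M"
      unfolding sets_vimage_algebra2[OF Ksp] by auto
    then show ?thesis by (intro bexI[of _ A] AE_I2) auto
  qed
  then obtain g where g [measurable]: "g \<in> borel_measurable MK" and AE: "AE m in M. real_cond_exp M ?F f m = g (K m)"
    using AE_factor by blast
  \<comment> \<open>Clipping changes \<open>g\<close> only where it matters on a null set and makes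
    the bounds hold at every point, as \<open>regression_law\<close> demands.\<close>
  have "AE m in M. real_cond_exp M ?F f m = max 0 (min 1 (g (K m)))"
    using AE F.real_cond_exp_01[OF f] by eventually_elim auto
  then show ?thesis by (intro bexI[of _ "\<lambda>x. max 0 (min 1 (g x))"]) auto
qed

section \<open>Conditional tail probabilities and the limit for general keys\<close>

definition cond_tail :: "'a measure \<Rightarrow> 'a measure \<Rightarrow> ('a \<Rightarrow> real) \<Rightarrow> real \<Rightarrow> 'a \<Rightarrow> real" where
  "cond_tail M F Y t = real_cond_exp M F (\<lambda>m. indicator {t..} (Y m))"

text \<open>Twice the expected conditional variance of the indicator of \<open>Y \<ge> t\<close>. It
  refers to a sub-sigma-algebra and not to a real key, so that the Borel isomorphism used to produce
  the key can be eliminated.\<close>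

definition cond_var :: "'a measure \<Rightarrow> 'a measure \<Rightarrow> ('a \<Rightarrow> real) \<Rightarrow> real \<Rightarrow> real" where
  "cond_var M F Y t = (\<integral>m. 2 * (cond_tail M F Y t m - (cond_tail M F Y t m)\<^sup>2) \<partial>M)"

text \<open>An instance of \<open>regression_law\<close> for the law of (key, response, tag) on the
  product space, where the tag lives on a factor of its own. Independence of the tag is used by
  integrating over it last.\<close>

lemma xi_num_limit:
  fixes K Y :: "'a \<Rightarrow> real" and \<tau> :: "'s \<Rightarrow> real" and \<zeta> :: "nat \<Rightarrow> 'b \<Rightarrow> real \<times> real \<times> real"
  assumes M: "prob_space M" and K [measurable]: "K \<in> borel_measurable M" and Y [measurable]: "Y \<in> borel_measurable M"
    and S: "prob_space S" and \<tau> [measurable]: "\<tau> \<in> borel_measurable S"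
    and N: "prob_space N" and rv: "\<And>i. \<zeta> i \<in> borel_measurable N"
    and ind: "prob_space.indep_vars N (\<lambda>_. borel) \<zeta> UNIV"
    and law: "\<And>i. distr N borel (\<zeta> i) = distr (M \<Otimes>\<^sub>M S) borel (\<lambda>(m, s). (K m, Y m, \<tau> s))"
  defines "F \<equiv> vimage_algebra (space M) K borel"
  shows "AE \<omega> in N. (\<lambda>n. xi_num n (\<lambda>i. fst (\<zeta> i \<omega>)) (\<lambda>i. fst (snd (\<zeta> i \<omega>))) (\<lambda>i. snd (snd (\<zeta> i \<omega>))) / (real n)\<^sup>2)
      \<longlonglongrightarrow> (\<integral>m. cond_var M F Y (Y m) \<partial>M)"
    and "(\<lambda>m. cond_var M F Y (Y m)) \<in> borel_measurable M"
    and "\<And>t. 0 \<le> cond_var M F Y t \<and> cond_var M F Y t \<le> 1"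
proof -
  interpret M: prob_space M by fact
  interpret S: prob_space S by fact
  interpret MS: pair_prob_space M S ..
  interpret F: finite_measure_subalgebra M F
    unfolding F_def by (rule M.finite_measure_subalgebra_vimage[OF K])
  define P where "P = distr (M \<Otimes>\<^sub>M S) borel (\<lambda>(m, s). (K m, Y m, \<tau> s))"
  have Tm [measurable]: "(\<lambda>(m, s). (K m, Y m, \<tau> s)) \<in> borel_measurable (M \<Otimes>\<^sub>M S)"
    by (simp add: borel_prod[symmetric])
  interpret P: prob_space P unfolding P_def by (rule MS.prob_space_distr) simp
  have intP: "(\<integral>p. H p \<partial>P) = (\<integral>s. (\<integral>m. H (K m, Y m, \<tau> s) \<partial>M) \<partial>S)"
    if H [measurable]: "H \<in> borel_measurable borel" and bdd: "\<And>p. \<bar>H p\<bar> \<le> (1::real)" for H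
  proof -
    have "(\<integral>p. H p \<partial>P) = (\<integral>q. H (case q of (m, s) \<Rightarrow> (K m, Y m, \<tau> s)) \<partial>(M \<Otimes>\<^sub>M S))"
      unfolding P_def by (rule integral_distr) measurable
    also have "\<dots> = (\<integral>(m, s). H (K m, Y m, \<tau> s) \<partial>(M \<Otimes>\<^sub>M S))"
      by (simp add: case_prod_beta')
    also have "\<dots> = (\<integral>s. (\<integral>m. H (K m, Y m, \<tau> s) \<partial>M) \<partial>S)"
    proof (rule MS.integral_snd[symmetric])
      have "(\<lambda>q. H ((\<lambda>(m, s). (K m, Y m, \<tau> s)) q)) \<in> borel_measurable (M \<Otimes>\<^sub>M S)"
        by (rule measurable_compose[OF Tm H])
      then show "integrable (M \<Otimes>\<^sub>M S) (\<lambda>(m, s). H (K m, Y m, \<tau> s))"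
        using bdd by (intro MS.integrable_const_bound[where B=1] AE_I2) (auto simp: case_prod_beta')
    qed
    finally show ?thesis .
  qed
  \<comment> \<open>A version is selected for each \<open>t\<close> separately, with an exceptional
    null set that depends on \<open>t\<close>.\<close>
  have "\<forall>t. \<exists>g\<in>borel_measurable borel. (\<forall>x. 0 \<le> g x \<and> g x \<le> (1::real)) \<and> (AE m in M. cond_tail M F Y t m = g (K m))"
    unfolding cond_tail_def F_def by (intro allI M.regression_function) auto
  then obtain g where gm [measurable]: "\<And>t. g t \<in> borel_measurable borel"
    and g01: "\<And>t x. 0 \<le> g t x \<and> g t x \<le> (1::real)" and gAE: "\<And>t. AE m in M. cond_tail M F Y t m = g t (K m)"
    by metis
  interpret R: regression_law P g
  proof
    show "sets P = sets borel" by (simp add: P_def)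
    show "g t \<in> borel_measurable borel" "0 \<le> g t x" "g t x \<le> 1" for t x using gm g01 by auto
    fix t and h :: "real \<times> real \<Rightarrow> real"
    assume h [measurable]: "h \<in> borel_measurable borel" and h1: "\<And>x u. \<bar>h (x, u)\<bar> \<le> 1"
    have proj [measurable]: "(fst :: real \<times> real \<times> real \<Rightarrow> real) \<in> borel_measurable borel"
      "(\<lambda>p :: real \<times> real \<times> real. fst (snd p)) \<in> borel_measurable borel"
      "(\<lambda>p :: real \<times> real \<times> real. (fst p, snd (snd p))) \<in> borel_measurable borel"
      by (simp_all add: borel_prod[symmetric])
    have [measurable]: "(\<lambda>p :: real \<times> real \<times> real. h (fst p, snd (snd p))) \<in> borel_measurable borel"
      by (rule measurable_compose[OF proj(3) h])
    have "(\<integral>p. h (fst p, snd (snd p)) * of_bool (t \<le> fst (snd p)) \<partial>P) = (\<integral>s. (\<integral>m. h (K m, \<tau> s) * indicator {t..} (Y m) \<partial>M) \<partial>S)"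
      using h1 by (subst intP) (auto simp: abs_mult indicator_def of_bool_def intro!: mult_le_one)
    also have "\<dots> = (\<integral>s. (\<integral>m. h (K m, \<tau> s) * g t (K m) \<partial>M) \<partial>S)"
    \<comment> \<open>For a frozen tag value the test function depends on the key alone and is
      measurable for \<open>F\<close>, so the defining property of conditional expectation
      applies.\<close>
    proof (rule Bochner_Integration.integral_cong[OF refl])
      fix s
      have "(\<lambda>x. (x, \<tau> s)) \<in> borel \<rightarrow>\<^sub>M (borel :: (real \<times> real) measure)" by (simp add: borel_prod[symmetric])
      then have hs: "(\<lambda>x. h (x, \<tau> s)) \<in> borel_measurable borel" by (rule measurable_compose[OF _ h])
      have KF: "K \<in> F \<rightarrow>\<^sub>M borel" unfolding F_def by (rule measurable_vimage_algebra1) auto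
      have hF: "(\<lambda>m. h (K m, \<tau> s)) \<in> borel_measurable F" by (rule measurable_compose[OF KF hs])
      have hM: "(\<lambda>m. h (K m, \<tau> s)) \<in> borel_measurable M" by (rule measurable_compose[OF K hs])
      have "(\<integral>m. h (K m, \<tau> s) * indicator {t..} (Y m) \<partial>M) = (\<integral>m. h (K m, \<tau> s) * cond_tail M F Y t m \<partial>M)"
        unfolding cond_tail_def
      proof (rule F.real_cond_exp_intg(2)[symmetric, OF _ hF])
        show "integrable M (\<lambda>m. h (K m, \<tau> s) * indicator {t..} (Y m))"
          using hM h1 by (intro M.integrable_const_bound[where B=1] AE_I2) (auto simp: indicator_def)
      qed measurable
      also have "\<dots> = (\<integral>m. h (K m, \<tau> s) * g t (K m) \<partial>M)"
        using gAE[of t] hM by (intro integral_cong_AE) (auto simp: cond_tail_def)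
      finally show "(\<integral>m. h (K m, \<tau> s) * indicator {t..} (Y m) \<partial>M) = (\<integral>m. h (K m, \<tau> s) * g t (K m) \<partial>M)" .
    qed
    also have "\<dots> = (\<integral>p. h (fst p, snd (snd p)) * g t (fst p) \<partial>P)"
      using h1 g01 by (subst intP) (auto simp: abs_mult intro!: mult_le_one)
    finally show "(\<integral>p. h (fst p, snd (snd p)) * of_bool (t \<le> fst (snd p)) \<partial>P) = (\<integral>p. h (fst p, snd (snd p)) * g t (fst p) \<partial>P)" .
  qed
  have lim: "R.limit_var t = cond_var M F Y t" for t
  proof -
    have "R.limit_var t = (\<integral>m. 2 * (g t (K m) - (g t (K m))\<^sup>2) \<partial>M)"
      unfolding R.limit_var_def
    proof (subst intP)
      show "(\<lambda>p. 2 * (g t (fst p) - (g t (fst p))\<^sup>2)) \<in> borel_measurable (borel :: (real \<times> real \<times> real) measure)"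
        by (simp add: borel_prod[symmetric])
      show "\<bar>2 * (g t (fst p) - (g t (fst p))\<^sup>2)\<bar> \<le> 1" for p :: "real \<times> real \<times> real"
        using R.bernoulli_var[of t "fst p"] by auto
    qed (simp add: S.prob_space)
    also have "\<dots> = cond_var M F Y t"
      unfolding cond_var_def using gAE[of t] by (intro integral_cong_AE) (auto simp: cond_tail_def)
    finally show ?thesis .
  qed
  show "0 \<le> cond_var M F Y t \<and> cond_var M F Y t \<le> 1" for t
    using R.limit_var_bounds[of t] by (simp add: lim)
  have [measurable]: "(\<lambda>p. cond_var M F Y (fst (snd p))) \<in> borel_measurable (borel :: (real \<times> real \<times> real) measure)"
    using R.limit_var_resp_measurable unfolding lim by (simp add: measurable_cong_sets[OF R.sets_P refl])
  \<comment> \<open>Measurability is known on triples; any constant tag, here 0, pulls it back to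
    \<open>M\<close>.\<close>
  have "(\<lambda>m. (K m, Y m, 0)) \<in> M \<rightarrow>\<^sub>M (borel :: (real \<times> real \<times> real) measure)" by (simp add: borel_prod[symmetric])
  then have "(\<lambda>m. cond_var M F Y (fst (snd (K m, Y m, 0 :: real)))) \<in> borel_measurable M"
    by (rule measurable_compose) measurable
  then show "(\<lambda>m. cond_var M F Y (Y m)) \<in> borel_measurable M" by simp
  have "(\<integral>p. R.limit_var (fst (snd p)) \<partial>P) = (\<integral>m. cond_var M F Y (Y m) \<partial>M)"
    unfolding lim using \<open>\<And>t. 0 \<le> cond_var M F Y t \<and> cond_var M F Y t \<le> 1\<close>
    by (subst intP) (auto simp: S.prob_space)
  then show "AE \<omega> in N. (\<lambda>n. xi_num n (\<lambda>i. fst (\<zeta> i \<omega>)) (\<lambda>i. fst (snd (\<zeta> i \<omega>))) (\<lambda>i. snd (snd (\<zeta> i \<omega>))) / (real n)\<^sup>2)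
      \<longlonglongrightarrow> (\<integral>m. cond_var M F Y (Y m) \<partial>M)"
    using R.AE_xi_num_tendsto[OF N rv ind] law by (simp add: P_def)
qed

section \<open>Vanishing of the limit\<close>

lemma borel_iso_inverse:
  assumes "borel_iso MY \<psi>" "space MY \<noteq> {}"
  obtains \<rho> where "\<rho> \<in> borel \<rightarrow>\<^sub>M MY" "\<And>y. y \<in> space MY \<Longrightarrow> \<rho> (\<psi> y) = y"
proof -
  obtain y0 where y0: "y0 \<in> space MY" using assms(2) by blast
  let ?inv = "the_inv_into (space MY) \<psi>"
  \<comment> \<open>The image of a Borel isomorphism is Borel, so extending the inverse by a
    constant outside it gives a measurable left inverse on the whole line.\<close>
  define \<rho> where "\<rho> x = (if x \<in> \<psi> ` space MY then ?inv x else y0)" for x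
  have "\<rho> \<in> borel \<rightarrow>\<^sub>M MY"
    unfolding \<rho>_def using assms(1) y0 unfolding borel_iso_def
    by (subst measurable_restrict_space_iff[symmetric]) auto
  moreover have "\<rho> (\<psi> y) = y" if "y \<in> space MY" for y
    using assms(1) that unfolding borel_iso_def \<rho>_def by (simp add: the_inv_into_f_f)
  ultimately show thesis by (rule that)
qed

text \<open>Both the isomorphism and its left inverse are measurable, so \<open>X\<close> and its
  real code generate the same events. Hence the limits do not depend on which isomorphism was
  chosen.\<close>

lemma vimage_algebra_borel_iso:
  assumes iso: "borel_iso MX \<phi>" and X: "X \<in> M \<rightarrow>\<^sub>M MX" and ne: "space M \<noteq> {}"
  shows "vimage_algebra (space M) (\<lambda>m. \<phi> (X m)) borel = vimage_algebra (space M) X MX"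
proof -
  have "space MX \<noteq> {}" using ne measurable_space[OF X] by blast
  then obtain \<rho> where \<rho>: "\<rho> \<in> borel \<rightarrow>\<^sub>M MX" "\<And>x. x \<in> space MX \<Longrightarrow> \<rho> (\<phi> x) = x"
    using borel_iso_inverse[OF iso] by blast
  have \<phi>: "\<phi> \<in> borel_measurable MX" using iso by (simp add: borel_iso_def)
  have "{(\<lambda>m. \<phi> (X m)) -` B \<inter> space M |B. B \<in> sets borel} = {X -` A \<inter> space M |A. A \<in> sets MX}"
  proof (intro equalityI subsetI; elim CollectE exE conjE)
    fix S B assume "S = (\<lambda>m. \<phi> (X m)) -` B \<inter> space M" "B \<in> sets borel"
    then show "S \<in> {X -` A \<inter> space M |A. A \<in> sets MX}"
      using measurable_sets[OF \<phi>, of B] measurable_space[OF X]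
      by (intro CollectI exI[of _ "\<phi> -` B \<inter> space MX"]) auto
  next
    fix S A assume "S = X -` A \<inter> space M" "A \<in> sets MX"
    then show "S \<in> {(\<lambda>m. \<phi> (X m)) -` B \<inter> space M |B. B \<in> sets borel}"
      using measurable_sets[OF \<rho>(1), of A] measurable_space[OF X] \<rho>(2)
      by (intro CollectI exI[of _ "\<rho> -` A"]) auto
  qed
  then show ?thesis by (simp add: vimage_algebra_def)
qed

section \<open>From vanishing integrals and good half-lines to all measurable sets\<close>

lemma integral_indicator_UN_zero:
  fixes h :: "'a \<Rightarrow> real"
  assumes h: "integrable M h" and T [measurable]: "T \<in> M \<rightarrow>\<^sub>M MT"
    and A: "\<And>i :: nat. A i \<in> sets MT" "disjoint_family A"
    and zero: "\<And>i. (\<integral>m. h m * indicator (A i) (T m) \<partial>M) = 0"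
  shows "(\<integral>m. h m * indicator (\<Union>i. A i) (T m) \<partial>M) = 0"
proof -
  note [measurable] = A(1)
  have eq: "(\<integral>m. h m * indicator B (T m) \<partial>M) = (LINT m:(T -` B \<inter> space M)|M. h m)" for B
    unfolding set_lebesgue_integral_def by (intro Bochner_Integration.integral_cong) (auto simp: indicator_def)
  have un: "T -` (\<Union>i. A i) \<inter> space M = (\<Union>i. T -` A i \<inter> space M)" by auto
  have "(LINT m:(\<Union>i. T -` A i \<inter> space M)|M. h m) = (\<Sum>i. LINT m:(T -` A i \<inter> space M)|M. h m)"
  proof (rule lebesgue_integral_countable_add)
    show "i \<noteq> j \<Longrightarrow> (T -` A i \<inter> space M) \<inter> (T -` A j \<inter> space M) = {}" for i j
      using A(2) by (auto simp: disjoint_family_on_def)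
    show "set_integrable M (\<Union>i. T -` A i \<inter> space M) h"
      unfolding set_integrable_def by (intro integrable_mult_indicator h) measurable
  qed measurable
  then show ?thesis using zero unfolding eq un by simp
qed

lemma integral_indicator_compl_zero:
  fixes h :: "'a \<Rightarrow> real"
  assumes h: "integrable M h" and T [measurable]: "T \<in> M \<rightarrow>\<^sub>M MT" and A [measurable]: "A \<in> sets MT"
    and zero: "(\<integral>m. h m \<partial>M) = 0" "(\<integral>m. h m * indicator A (T m) \<partial>M) = 0"
  shows "(\<integral>m. h m * indicator (space MT - A) (T m) \<partial>M) = 0"
proof -
  have "(\<integral>m. h m * indicator (space MT - A) (T m) \<partial>M) = (\<integral>m. h m - h m * indicator A (T m) \<partial>M)"
    using measurable_space[OF T] by (intro Bochner_Integration.integral_cong) (auto simp: indicator_def)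
  also have "\<dots> = 0"
  proof (subst Bochner_Integration.integral_diff[OF h])
    note [measurable] = borel_measurable_integrable[OF h]
    show "integrable M (\<lambda>m. h m * indicator A (T m))"
      by (rule Bochner_Integration.integrable_bound[OF h]) (auto simp: indicator_def)
  qed (simp add: zero)
  finally show ?thesis .
qed

text \<open>The sets \<open>D\<close> over which \<open>h\<close> integrates to zero form a Dynkin
  system: complements work because the total integral of \<open>h\<close> is zero, disjoint unions
  by countable additivity.\<close>

lemma integral_indicator_zero_generator:
  fixes h :: "'a \<Rightarrow> real"
  assumes h: "integrable M h" and T: "T \<in> M \<rightarrow>\<^sub>M MT"
    and gen: "sets MT = sigma_sets (space MT) G" "Int_stable G" "G \<subseteq> Pow (space MT)"
    and zero: "(\<integral>m. h m \<partial>M) = 0" "\<And>A. A \<in> G \<Longrightarrow> (\<integral>m. h m * indicator A (T m) \<partial>M) = 0"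
    and D: "D \<in> sets MT"
  shows "(\<integral>m. h m * indicator D (T m) \<partial>M) = 0"
proof -
  from gen(2,3) D[unfolded gen(1)] show ?thesis
  proof (induction rule: sigma_sets_induct_disjoint)
    case (basic A) then show ?case by (rule zero(2))
  next
    case empty show ?case by simp
  next
    case (compl A)
    then show ?case by (intro integral_indicator_compl_zero h T zero(1)) (auto simp: gen(1))
  next
    case (union A)
    then show ?case by (intro integral_indicator_UN_zero[OF h T]) (auto simp: gen(1))
  qed
qed

text \<open>If almost every value of Y is the endpoint of a good half-line, then the half-line from an
  arbitrary t agrees, up to a null set, with a countable union of half-lines from good points
  above t.\<close>

lemma half_lines_AE_induct:
  fixes Y :: "'a \<Rightarrow> real"
  assumes good: "AE m in M. P {Y m..}"
    and empty: "P {}"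
    and compl: "\<And>A. A \<in> sets borel \<Longrightarrow> P A \<Longrightarrow> P (- A)"
    and union: "\<And>A :: nat \<Rightarrow> real set. (\<And>i. A i \<in> sets borel) \<Longrightarrow> disjoint_family A \<Longrightarrow> (\<And>i. P (A i)) \<Longrightarrow> P (\<Union>i. A i)"
    and null: "\<And>A B. A \<in> sets borel \<Longrightarrow> B \<in> sets borel \<Longrightarrow> P A \<Longrightarrow> (AE m in M. Y m \<in> A \<longleftrightarrow> Y m \<in> B) \<Longrightarrow> P B"
    and A: "A \<in> sets borel"
  shows "P A"
proof -
  define T where "T = {t. P {t..}}"
  define S where "S = (\<lambda>t. {t..}) ` T"
  have S_borel: "B \<in> sets borel" if "B \<in> sigma_sets UNIV S" for B
    using that by (rule sets.sigma_sets_subset[of S borel, simplified, THEN subsetD, rotated]) (auto simp: S_def)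
  \<comment> \<open>\<open>P\<close> is closed only under disjoint unions, whereas the unions of
    half-lines needed below overlap. Good half-lines are stable under intersection, so
    \<open>P\<close> first extends to the whole sigma-algebra that they generate.\<close>
  have PS: "P B" if "B \<in> sigma_sets UNIV S" for B
  proof -
    have "Int_stable S"
    proof (rule Int_stableI)
      fix a b assume "a \<in> S" "b \<in> S"
      then obtain s t where "a = {s..}" "b = {t..}" "s \<in> T" "t \<in> T" by (auto simp: S_def)
      then have "a \<inter> b = {max s t..}" "max s t \<in> T" by (auto simp: max_def)
      then show "a \<inter> b \<in> S" by (auto simp: S_def)
    qed
    moreover have "S \<subseteq> Pow UNIV" by simp
    ultimately show ?thesis using that
    proof (induction rule: sigma_sets_induct_disjoint)
      case (basic A) then show ?case by (auto simp: S_def T_def)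
    next
      case empty show ?case by (rule assms(2))
    next
      case (compl A) then show ?case using assms(3)[OF S_borel] by (simp add: Compl_eq_Diff_UNIV)
    next
      case (union A) then show ?case by (intro assms(4) S_borel) auto
    qed
  qed
  have gen: "P {t..}" for t
  proof -
    \<comment> \<open>Agreement on \<open>T\<close> suffices, because \<open>Y\<close> takes its
      values in \<open>T\<close> almost surely. Everything of \<open>T\<close> above
      \<open>t\<close> lies above the infimum \<open>s\<close>, and it only matters whether
      \<open>s\<close> itself is good.\<close>
    have "\<exists>B\<in>sigma_sets UNIV S. \<forall>y\<in>T. y \<in> B \<longleftrightarrow> y \<in> {t..}"
    proof (cases "T \<inter> {t..} = {}")
      case True
      then show ?thesis by (intro bexI[of _ "{}"]) (auto intro: sigma_sets.Empty)
    next
      case False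
      define s where "s = Inf (T \<inter> {t..})"
      have bdd: "bdd_below (T \<inter> {t..})" by (rule bdd_belowI[of _ t]) auto
      have ts: "t \<le> s" unfolding s_def using False by (intro cInf_greatest) auto
      have s_le: "s \<le> y" if "y \<in> T" "t \<le> y" for y
        unfolding s_def using that bdd by (intro cInf_lower) auto
      show ?thesis
      proof (cases "s \<in> T")
        case True
        then have "{s..} \<in> sigma_sets UNIV S" by (intro sigma_sets.Basic) (auto simp: S_def)
        then show ?thesis using ts s_le by (intro bexI[of _ "{s..}"]) auto
      next
        case nT: False
        \<comment> \<open>The infimum is not good, so good points within
          \<open>inverse (real (Suc k))\<close> of it are taken. A point of \<open>T\<close> above
          \<open>t\<close> then exceeds \<open>s\<close> strictly and is caught by some
          \<open>{q k..}\<close>.\<close>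
        have "\<exists>q\<in>T \<inter> {t..}. q < s + inverse (real (Suc k))" for k
          using False cInf_lessD[of "T \<inter> {t..}" "s + inverse (real (Suc k))"] unfolding s_def by auto
        then obtain q where q: "\<And>k. q k \<in> T" "\<And>k. t \<le> q k" "\<And>k. q k < s + inverse (real (Suc k))"
          by (metis Int_iff atLeast_iff)
        have "{q k..} \<in> sigma_sets UNIV S" for k
          using q(1) by (intro sigma_sets.Basic) (auto simp: S_def)
        then have "(\<Union>k. {q k..}) \<in> sigma_sets UNIV S" by (rule sigma_sets.Union)
        moreover have "y \<in> (\<Union>k. {q k..}) \<longleftrightarrow> y \<in> {t..}" if "y \<in> T" for y
        proof
          assume "y \<in> (\<Union>k. {q k..})"
          then obtain k where "q k \<le> y" by auto
          with q(2)[of k] show "y \<in> {t..}" by auto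
        next
          assume y: "y \<in> {t..}"
          with that s_le nT have "s < y" by (metis atLeast_iff order_le_less)
          then obtain k where "inverse (real (Suc k)) < y - s" using reals_Archimedean[of "y - s"] by auto
          then have "q k \<le> y" using q(3)[of k] by linarith
          then show "y \<in> (\<Union>k. {q k..})" by auto
        qed
        ultimately show ?thesis by blast
      qed
    qed
    then obtain B where B: "B \<in> sigma_sets UNIV S" "\<And>y. y \<in> T \<Longrightarrow> y \<in> B \<longleftrightarrow> y \<in> {t..}" by blast
    have "AE m in M. Y m \<in> B \<longleftrightarrow> Y m \<in> {t..}"
      using good by eventually_elim (use B(2) in \<open>auto simp: T_def\<close>)
    then show ?thesis by (intro null[OF S_borel[OF B(1)] _ PS[OF B(1)]]) auto
  qed
  have Asig: "A \<in> sigma_sets UNIV (range (\<lambda>t::real. {t..}))"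
    using A unfolding borel_Ici by simp
  have stable: "Int_stable (range (\<lambda>t::real. {t..}))"
  proof (rule Int_stableI; elim rangeE)
    fix a b :: "real set" and x y :: real assume "a = {x..}" "b = {y..}"
    then have "a \<inter> b = {max x y..}" by auto
    then show "a \<inter> b \<in> range (\<lambda>t::real. {t..})" by simp
  qed
  have sub: "range (\<lambda>t::real. {t..}) \<subseteq> Pow UNIV" by simp
  have borel: "B \<in> sets borel" if "B \<in> sigma_sets UNIV (range (\<lambda>t::real. {t..}))" for B
    using that unfolding borel_Ici by simp
  from stable sub Asig show ?thesis
  proof (induction rule: sigma_sets_induct_disjoint)
    case (basic A) then show ?case using gen by auto
  next
    case empty show ?case by (rule assms(2))
  next
    case (compl A) then show ?case using assms(3)[OF borel] by (simp add: Compl_eq_Diff_UNIV)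
  next
    case (union A) then show ?case by (intro assms(4) borel) auto
  qed
qed

section \<open>Zero conditional variance and functional dependence\<close>

context prob_space
begin

lemma cond_tail_props:
  assumes F: "finite_measure_subalgebra M F" and Y [measurable]: "Y \<in> borel_measurable M"
  shows "cond_tail M F Y t \<in> borel_measurable F" "cond_tail M F Y t \<in> borel_measurable M"
    and "AE m in M. 0 \<le> cond_tail M F Y t m \<and> cond_tail M F Y t m \<le> 1"
    and "integrable M (cond_tail M F Y t)"
    and "(\<integral>m. cond_tail M F Y t m \<partial>M) = (\<integral>m. indicator {t..} (Y m) \<partial>M)"
    and "\<And>f. f \<in> borel_measurable F \<Longrightarrow> (AE m in M. \<bar>f m\<bar> \<le> 1) \<Longrightarrow>
      (\<integral>m. f m * cond_tail M F Y t m \<partial>M) = (\<integral>m. f m * indicator {t..} (Y m) \<partial>M)"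
proof -
  interpret F: finite_measure_subalgebra M F by fact
  show "cond_tail M F Y t \<in> borel_measurable F" "cond_tail M F Y t \<in> borel_measurable M"
    unfolding cond_tail_def by measurable
  show "AE m in M. 0 \<le> cond_tail M F Y t m \<and> cond_tail M F Y t m \<le> 1"
    unfolding cond_tail_def by (rule F.real_cond_exp_01) (auto simp: indicator_def)
  have i: "integrable M (\<lambda>m. indicator {t..} (Y m) :: real)"
    by (rule integrable_const_bound[where B=1]) (auto simp: indicator_def)
  show "integrable M (cond_tail M F Y t)" "(\<integral>m. cond_tail M F Y t m \<partial>M) = (\<integral>m. indicator {t..} (Y m) \<partial>M)"
    unfolding cond_tail_def by (rule F.real_cond_exp_int[OF i])+
  show "(\<integral>m. f m * cond_tail M F Y t m \<partial>M) = (\<integral>m. f m * indicator {t..} (Y m) \<partial>M)"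
    if f: "f \<in> borel_measurable F" and b: "AE m in M. \<bar>f m\<bar> \<le> 1" for f
    unfolding cond_tail_def
  proof (rule F.real_cond_exp_intg(2)[OF _ f])
    have [measurable]: "f \<in> borel_measurable M" using measurable_from_subalg[OF F.subalg f] .
    have "AE m in M. norm (f m * indicator {t..} (Y m)) \<le> 1"
      using b by eventually_elim (auto simp: indicator_def)
    then show "integrable M (\<lambda>m. f m * indicator {t..} (Y m))"
      by (rule integrable_const_bound) measurable
  qed measurable
qed

text \<open>Conditional expectation is an orthogonal projection, so the cross term equals the
  integral of the squared tail. The first form serves to compare two sigma-algebras; the second
  exhibits an L2 distance, which is zero only if the indicator is almost surely its own
  projection.\<close>

lemma cond_var_eq:
  assumes F: "finite_measure_subalgebra M F" and Y [measurable]: "Y \<in> borel_measurable M"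
  shows "cond_var M F Y t = 2 * ((\<integral>m. indicator {t..} (Y m) \<partial>M) - (\<integral>m. (cond_tail M F Y t m)\<^sup>2 \<partial>M))"
    and "cond_var M F Y t = 2 * (\<integral>m. (indicator {t..} (Y m) - cond_tail M F Y t m)\<^sup>2 \<partial>M)"
    and "integrable M (\<lambda>m. (indicator {t..} (Y m) - cond_tail M F Y t m)\<^sup>2)"
proof -
  note G = cond_tail_props[OF F Y, where t=t]
  note [measurable] = G(2)
  let ?G = "cond_tail M F Y t" and ?b = "\<lambda>m. indicator {t..} (Y m) :: real"
  have "AE m in M. norm ((?G m)\<^sup>2) \<le> 1"
    using G(3) by eventually_elim (auto simp: power_le_one)
  then have G2: "integrable M (\<lambda>m. (?G m)\<^sup>2)" by (rule integrable_const_bound) measurable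
  have "AE m in M. norm (?G m * ?b m) \<le> 1"
    using G(3) by eventually_elim (auto simp: indicator_def)
  then have Gb: "integrable M (\<lambda>m. ?G m * ?b m)" by (rule integrable_const_bound) measurable
  have b: "integrable M ?b" by (rule integrable_const_bound[where B=1]) (auto simp: indicator_def)
  show 1: "cond_var M F Y t = 2 * ((\<integral>m. ?b m \<partial>M) - (\<integral>m. (?G m)\<^sup>2 \<partial>M))"
    unfolding cond_var_def using G(4) G2 by (simp add: G(5))
  have "AE m in M. \<bar>?G m\<bar> \<le> 1" using G(3) by eventually_elim auto
  with G(1) have cross: "(\<integral>m. ?G m * ?b m \<partial>M) = (\<integral>m. (?G m)\<^sup>2 \<partial>M)"
    by (simp add: G(6)[symmetric] power2_eq_square)
  have sq: "(?b m - ?G m)\<^sup>2 = ?b m - 2 * (?G m * ?b m) + (?G m)\<^sup>2" for m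
    by (auto simp: indicator_def power2_eq_square algebra_simps)
  show "cond_var M F Y t = 2 * (\<integral>m. (?b m - ?G m)\<^sup>2 \<partial>M)"
    unfolding 1 sq using b Gb G2 by (simp add: cross)
  show "integrable M (\<lambda>m. (?b m - ?G m)\<^sup>2)"
    unfolding sq using b Gb G2 by simp
qed


text \<open>A vanishing integral makes the half-line from almost every value of the response an
  event of \<open>X\<close>, up to null sets. This spreads to all Borel sets,
  \<open>AE_factor\<close> rebuilds the response from its superlevel sets, and the left inverse of
  \<open>\<psi>\<close> returns to the original space.\<close>

lemma integral_cond_var_zero_iff:
  assumes X: "X \<in> M \<rightarrow>\<^sub>M MX" and Y: "Y \<in> M \<rightarrow>\<^sub>M MY" and iso: "borel_iso MY \<psi>"
  defines "F \<equiv> vimage_algebra (space M) X MX" and "Y' \<equiv> \<lambda>m. \<psi> (Y m)"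
  assumes meas: "(\<lambda>m. cond_var M F Y' (Y' m)) \<in> borel_measurable M"
    and bounds: "\<And>t. 0 \<le> cond_var M F Y' t \<and> cond_var M F Y' t \<le> 1"
  shows "(\<integral>m. cond_var M F Y' (Y' m) \<partial>M) = 0 \<longleftrightarrow> (\<exists>f\<in>MX \<rightarrow>\<^sub>M MY. AE m in M. Y m = f (X m))"
proof
  have Fs: "finite_measure_subalgebra M F" unfolding F_def by (rule finite_measure_subalgebra_vimage[OF X])
  interpret F: finite_measure_subalgebra M F by fact
  have \<psi> [measurable]: "\<psi> \<in> borel_measurable MY" using iso by (simp add: borel_iso_def)
  have Y' [measurable]: "Y' \<in> borel_measurable M" unfolding Y'_def using Y by measurable
  note [measurable] = meas
  have Xsp: "X \<in> space M \<rightarrow> space MX" using measurable_space[OF X] by auto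
  {
    assume L: "(\<integral>m. cond_var M F Y' (Y' m) \<partial>M) = 0"
    have "integrable M (\<lambda>m. cond_var M F Y' (Y' m))"
      using bounds by (intro integrable_const_bound[where B=1]) auto
    then have AE0: "AE m in M. cond_var M F Y' (Y' m) = 0"
      using L bounds by (subst (asm) integral_nonneg_eq_0_iff_AE) auto
    define P where "P A \<longleftrightarrow> (\<exists>C\<in>sets MX. AE m in M. Y' m \<in> A \<longleftrightarrow> X m \<in> C)" for A
    have half: "P {t..}" if "cond_var M F Y' t = 0" for t
    proof -
      have "(\<integral>m. (indicator {t..} (Y' m) - cond_tail M F Y' t m)\<^sup>2 \<partial>M) = 0"
        using cond_var_eq(2)[OF Fs Y', of t] that by simp
      then have AE: "AE m in M. (indicator {t..} (Y' m) - cond_tail M F Y' t m)\<^sup>2 = 0"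
        using cond_var_eq(3)[OF Fs Y', of t] by (subst (asm) integral_nonneg_eq_0_iff_AE) auto
      note [measurable] = cond_tail_props(1)[OF Fs Y', of t]
      \<comment> \<open>The conditional tail is almost surely 0 or 1 here, so any level strictly
        between them separates the two cases.\<close>
      have "{m \<in> space F. 1/2 < cond_tail M F Y' t m} \<in> sets F" by measurable
      then obtain C where C: "C \<in> sets MX" "{m \<in> space M. 1/2 < cond_tail M F Y' t m} = X -` C \<inter> space M"
        unfolding F_def sets_vimage_algebra2[OF Xsp] by auto
      have "AE m in M. Y' m \<in> {t..} \<longleftrightarrow> X m \<in> C"
        using AE AE_space
      proof eventually_elim
        case (elim m)
        then have "X m \<in> C \<longleftrightarrow> 1/2 < cond_tail M F Y' t m" using C(2) by blast
        moreover have "cond_tail M F Y' t m = indicator {t..} (Y' m)" using elim by simp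
        ultimately show ?case by (auto simp: indicator_def)
      qed
      with C(1) show ?thesis unfolding P_def by (intro bexI[of _ C])
    qed
    have P_compl: "P (- A)" if PA: "P A" for A
    proof -
      obtain C where C: "C \<in> sets MX" "AE m in M. Y' m \<in> A \<longleftrightarrow> X m \<in> C"
        using PA unfolding P_def by blast
      have "AE m in M. Y' m \<in> - A \<longleftrightarrow> X m \<in> space MX - C"
        using C(2) AE_space by eventually_elim (use Xsp in auto)
      with C(1) show ?thesis unfolding P_def by (intro bexI[of _ "space MX - C"]) auto
    qed
    have P_union: "P (\<Union>i. A i)" if "\<And>i. P (A i)" for A :: "nat \<Rightarrow> real set"
    proof -
      have "\<forall>i. \<exists>C. C \<in> sets MX \<and> (AE m in M. Y' m \<in> A i \<longleftrightarrow> X m \<in> C)"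
        using that unfolding P_def Bex_def by (rule allI)
      from choice[OF this] obtain C where
        C: "\<And>i. C i \<in> sets MX" "\<And>i. AE m in M. Y' m \<in> A i \<longleftrightarrow> X m \<in> C i"
        by auto
      have "AE m in M. \<forall>i. Y' m \<in> A i \<longleftrightarrow> X m \<in> C i" using C(2) by (simp add: AE_all_countable)
      then have "AE m in M. Y' m \<in> (\<Union>i. A i) \<longleftrightarrow> X m \<in> (\<Union>i. C i)" by eventually_elim auto
      moreover have "(\<Union>i. C i) \<in> sets MX" using C(1) by auto
      ultimately show ?thesis unfolding P_def by (intro bexI[of _ "\<Union>i. C i"])
    qed
    have P_null: "P B" if PA: "P A" and AB: "AE m in M. Y' m \<in> A \<longleftrightarrow> Y' m \<in> B" for A B
    proof -
      obtain C where C: "C \<in> sets MX" "AE m in M. Y' m \<in> A \<longleftrightarrow> X m \<in> C"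
        using PA unfolding P_def by blast
      have "AE m in M. Y' m \<in> B \<longleftrightarrow> X m \<in> C" using C(2) AB by eventually_elim auto
      with C(1) show ?thesis unfolding P_def by (intro bexI[of _ C])
    qed
    have P: "P A" if "A \<in> sets borel" for A
    proof (rule half_lines_AE_induct[where M=M and Y=Y' and P=P])
      show "AE m in M. P {Y' m..}" using AE0 by eventually_elim (rule half)
      show "P {}" unfolding P_def by (intro bexI[of _ "{}"]) auto
    qed (use P_compl P_union that in \<open>auto intro: P_null\<close>)
    have "\<exists>C\<in>sets MX. AE m in M. r < Y' m \<longleftrightarrow> X m \<in> C" for r
      using P[of "{r<..}"] unfolding P_def by simp
    then obtain g where g: "g \<in> borel_measurable MX" "AE m in M. Y' m = g (X m)"
      using AE_factor by blast
    have "space MY \<noteq> {}" using not_empty measurable_space[OF Y] by blast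
    then obtain \<rho> where \<rho>: "\<rho> \<in> borel \<rightarrow>\<^sub>M MY" "\<And>y. y \<in> space MY \<Longrightarrow> \<rho> (\<psi> y) = y"
      using borel_iso_inverse[OF iso] by blast
    have "AE m in M. Y m = \<rho> (g (X m))"
      using g(2) AE_space
    proof eventually_elim
      case (elim m)
      then show ?case using \<rho>(2)[OF measurable_space[OF Y elim(2)]] by (simp add: Y'_def)
    qed
    moreover have "(\<lambda>x. \<rho> (g x)) \<in> MX \<rightarrow>\<^sub>M MY" by (rule measurable_compose[OF g(1) \<rho>(1)])
    ultimately show "\<exists>f\<in>MX \<rightarrow>\<^sub>M MY. AE m in M. Y m = f (X m)" by (rule bexI)
  next
    assume "\<exists>f\<in>MX \<rightarrow>\<^sub>M MY. AE m in M. Y m = f (X m)"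
    then obtain f where f [measurable]: "f \<in> MX \<rightarrow>\<^sub>M MY" and Yf: "AE m in M. Y m = f (X m)" by blast
    have "cond_var M F Y' t = 0" for t
    proof -
      let ?k = "\<lambda>m. indicator {t..} (\<psi> (f (X m))) :: real"
      have XF [measurable]: "X \<in> F \<rightarrow>\<^sub>M MX" unfolding F_def by (rule measurable_vimage_algebra1[OF Xsp])
      note [measurable] = X
      have kM: "?k \<in> borel_measurable M" by measurable
      have kF: "?k \<in> borel_measurable F" by measurable
      have bk: "AE m in M. indicator {t..} (Y' m) = ?k m"
        using Yf by eventually_elim (simp add: Y'_def)
      have "AE m in M. cond_tail M F Y' t m = real_cond_exp M F ?k m"
        unfolding cond_tail_def using bk kM by (intro F.real_cond_exp_cong) auto
      moreover have "AE m in M. real_cond_exp M F ?k m = ?k m"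
        using kM kF by (intro F.real_cond_exp_F_meas integrable_const_bound[where B=1]) (auto simp: indicator_def)
      ultimately have "AE m in M. (indicator {t..} (Y' m) - cond_tail M F Y' t m)\<^sup>2 = 0"
        using bk by eventually_elim simp
      then have "(\<integral>m. (indicator {t..} (Y' m) - cond_tail M F Y' t m)\<^sup>2 \<partial>M) = 0"
        by (rule integral_eq_zero_AE)
      then show ?thesis by (simp add: cond_var_eq(2)[OF Fs Y'])
    qed
    then show "(\<integral>m. cond_var M F Y' (Y' m) \<partial>M) = 0" by simp
  }
qed

end

section \<open>Conditional independence and the gap between the two limits\<close>

lemma (in prob_space) integrable_AE_bounded:
  assumes "f \<in> borel_measurable M" "AE m in M. \<bar>f m\<bar> \<le> (B::real)"
  shows "integrable M f"
  using assms by (intro integrable_const_bound[where B=B]) auto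

lemma (in prob_space) cond_exp_bounded:
  assumes F: "finite_measure_subalgebra M F" and u [measurable]: "u \<in> borel_measurable M"
    and u01: "\<And>m. 0 \<le> u m" "\<And>m. u m \<le> 1"
  shows "AE m in M. \<bar>real_cond_exp M F u m\<bar> \<le> 1" "integrable M (real_cond_exp M F u)" "integrable M u"
    and "\<And>v. v \<in> borel_measurable M \<Longrightarrow> AE m in M. \<bar>v m\<bar> \<le> 1 \<Longrightarrow> integrable M (\<lambda>m. v m * real_cond_exp M F u m)"
    and "\<And>v. v \<in> borel_measurable M \<Longrightarrow> AE m in M. \<bar>v m\<bar> \<le> 1 \<Longrightarrow> integrable M (\<lambda>m. v m * u m)"
    and "\<And>v. v \<in> borel_measurable F \<Longrightarrow> AE m in M. \<bar>v m\<bar> \<le> 1 \<Longrightarrow>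
      (\<integral>m. v m * real_cond_exp M F u m \<partial>M) = (\<integral>m. v m * u m \<partial>M)"
proof -
  interpret F: finite_measure_subalgebra M F by fact
  show b: "AE m in M. \<bar>real_cond_exp M F u m\<bar> \<le> 1"
    using F.real_cond_exp_01[OF u u01] by eventually_elim auto
  then show "integrable M (real_cond_exp M F u)" by (intro integrable_AE_bounded) auto
  show "integrable M u" using u01 by (intro integrable_AE_bounded[where B=1]) auto
  show "integrable M (\<lambda>m. v m * real_cond_exp M F u m)"
    if [measurable]: "v \<in> borel_measurable M" and v: "AE m in M. \<bar>v m\<bar> \<le> 1" for v
  proof (rule integrable_AE_bounded)
    show "AE m in M. \<bar>v m * real_cond_exp M F u m\<bar> \<le> 1"
      using v b by eventually_elim (auto simp: abs_mult intro!: mult_le_one)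
  qed measurable
  show vu: "integrable M (\<lambda>m. v m * u m)"
    if [measurable]: "v \<in> borel_measurable M" and v: "AE m in M. \<bar>v m\<bar> \<le> 1" for v
  proof (rule integrable_AE_bounded)
    show "AE m in M. \<bar>v m * u m\<bar> \<le> 1"
      using v by eventually_elim (use u01 in \<open>auto simp: abs_mult intro!: mult_le_one\<close>)
  qed measurable
  show "(\<integral>m. v m * real_cond_exp M F u m \<partial>M) = (\<integral>m. v m * u m \<partial>M)"
    if v: "v \<in> borel_measurable F" "AE m in M. \<bar>v m\<bar> \<le> 1" for v
    by (rule F.real_cond_exp_intg(2)[OF vu[OF measurable_from_subalg[OF F.subalg v(1)] v(2)] v(1) u])
qed

text \<open>Conditional expectation is self-adjoint: both sides equal the integral of the product of
  the two conditional expectations.\<close>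

lemma (in prob_space) cond_exp_swap:
  assumes F: "finite_measure_subalgebra M F"
    and u: "u \<in> borel_measurable M" "\<And>m. 0 \<le> u m" "\<And>m. u m \<le> 1"
    and v: "v \<in> borel_measurable M" "\<And>m. 0 \<le> v m" "\<And>m. v m \<le> 1"
  shows "(\<integral>m. u m * real_cond_exp M F v m \<partial>M) = (\<integral>m. v m * real_cond_exp M F u m \<partial>M)"
proof -
  have "(\<integral>m. real_cond_exp M F v m * real_cond_exp M F u m \<partial>M) = (\<integral>m. real_cond_exp M F v m * u m \<partial>M)"
    by (rule cond_exp_bounded(6)[OF F u _ cond_exp_bounded(1)[OF F v]]) simp
  moreover have "(\<integral>m. real_cond_exp M F u m * real_cond_exp M F v m \<partial>M) = (\<integral>m. real_cond_exp M F u m * v m \<partial>M)"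
    by (rule cond_exp_bounded(6)[OF F v _ cond_exp_bounded(1)[OF F u]]) simp
  ultimately show ?thesis by (simp add: mult.commute)
qed

text \<open>The right side says that the conditional probability of \<open>Y \<in> A\<close> given
  \<open>X\<close> also serves as the one given \<open>(X, Z)\<close>. On rectangles this is the
  product formula integrated over events of \<open>X\<close>, and rectangles generate the product
  sigma-algebra.\<close>

lemma (in prob_space) cond_indep_iff_integral:
  assumes X [measurable]: "X \<in> M \<rightarrow>\<^sub>M MX" and Y [measurable]: "Y \<in> M \<rightarrow>\<^sub>M MY" and Z [measurable]: "Z \<in> M \<rightarrow>\<^sub>M MZ"
  defines "F \<equiv> vimage_algebra (space M) X MX"
  shows "cond_indep M MX MY MZ X Y Z \<longleftrightarrow> (\<forall>A\<in>sets MY. \<forall>D\<in>sets (MX \<Otimes>\<^sub>M MZ).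
    (\<integral>m. indicator D (X m, Z m) * indicator A (Y m) \<partial>M) =
    (\<integral>m. indicator D (X m, Z m) * real_cond_exp M F (\<lambda>m. indicator A (Y m)) m \<partial>M))"
proof -
  have F: "finite_measure_subalgebra M F" unfolding F_def by (rule finite_measure_subalgebra_vimage[OF X])
  interpret F: finite_measure_subalgebra M F by fact
  have Xsp: "X \<in> space M \<rightarrow> space MX" using measurable_space[OF X] by auto
  have XF: "X \<in> F \<rightarrow>\<^sub>M MX" unfolding F_def by (rule measurable_vimage_algebra1[OF Xsp])
  let ?E = "real_cond_exp M F"
  have rect: "(\<forall>D\<in>sets (MX \<Otimes>\<^sub>M MZ).
      (\<integral>m. indicator D (X m, Z m) * indicator A (Y m) \<partial>M) =
      (\<integral>m. indicator D (X m, Z m) * ?E (\<lambda>m. indicator A (Y m)) m \<partial>M)) \<longleftrightarrow>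
    (\<forall>B\<in>sets MZ. AE m in M. ?E (\<lambda>m. indicator A (Y m) * indicator B (Z m)) m =
      ?E (\<lambda>m. indicator A (Y m)) m * ?E (\<lambda>m. indicator B (Z m)) m)"
    if A [measurable]: "A \<in> sets MY" for A
  proof -
    define p where "p = ?E (\<lambda>m. indicator A (Y m))"
    have pF [measurable]: "p \<in> borel_measurable F" and pM [measurable]: "p \<in> borel_measurable M"
      unfolding p_def by measurable
    have Am: "(\<lambda>m. indicator A (Y m) :: real) \<in> borel_measurable M" by measurable
    note pb = cond_exp_bounded[OF F Am, folded p_def]
    have pb1: "AE m in M. \<bar>p m\<bar> \<le> 1" by (rule pb(1)) (auto simp: indicator_def)
    have pint: "integrable M p" by (rule pb(2)) (auto simp: indicator_def)
    \<comment> \<open>Both \<open>p\<close> and the indicator of \<open>C\<close> are measurable for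
      \<open>F\<close>, so the indicator of \<open>B\<close> may be replaced by its conditional
      expectation.\<close>
    have rectangle: "(\<integral>m. indicator (C \<times> B) (X m, Z m) * p m \<partial>M)
        = (\<integral>m. indicator C (X m) * (p m * ?E (\<lambda>m. indicator B (Z m)) m) \<partial>M)"
      if C [measurable]: "C \<in> sets MX" and B [measurable]: "B \<in> sets MZ" for C B
    proof -
      have v: "(\<lambda>m. indicator C (X m) * p m) \<in> borel_measurable F" using XF by measurable
      have vb: "AE m in M. \<bar>indicator C (X m) * p m\<bar> \<le> 1"
        using pb1 by eventually_elim (auto simp: indicator_def)
      have "(\<integral>m. indicator (C \<times> B) (X m, Z m) * p m \<partial>M) = (\<integral>m. (indicator C (X m) * p m) * indicator B (Z m) \<partial>M)"
        by (intro Bochner_Integration.integral_cong) (auto simp: indicator_def)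
      also have "\<dots> = (\<integral>m. (indicator C (X m) * p m) * ?E (\<lambda>m. indicator B (Z m)) m \<partial>M)"
        by (rule cond_exp_bounded(6)[OF F _ _ _ v vb, symmetric]) (auto simp: indicator_def)
      finally show ?thesis by (simp add: mult.assoc)
    qed
    show ?thesis
      unfolding p_def[symmetric]
    proof (intro iffI ballI)
      fix B assume all: "\<forall>D\<in>sets (MX \<Otimes>\<^sub>M MZ). (\<integral>m. indicator D (X m, Z m) * indicator A (Y m) \<partial>M) = (\<integral>m. indicator D (X m, Z m) * p m \<partial>M)"
        and B [measurable]: "B \<in> sets MZ"
      let ?q = "?E (\<lambda>m. indicator B (Z m))"
      show "AE m in M. ?E (\<lambda>m. indicator A (Y m) * indicator B (Z m)) m = p m * ?q m"
      proof (rule F.real_cond_exp_charact)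
        fix S assume "S \<in> sets F"
        then obtain C where C [measurable]: "C \<in> sets MX" and S: "S = X -` C \<inter> space M"
          unfolding F_def sets_vimage_algebra2[OF Xsp] by auto
        have "(LINT m:S|M. indicator A (Y m) * indicator B (Z m) :: real) = (\<integral>m. indicator (C \<times> B) (X m, Z m) * indicator A (Y m) \<partial>M)"
          unfolding set_lebesgue_integral_def S by (intro Bochner_Integration.integral_cong) (auto simp: indicator_def)
        also have "\<dots> = (\<integral>m. indicator (C \<times> B) (X m, Z m) * p m \<partial>M)"
          by (rule all[THEN bspec]) measurable
        also have "\<dots> = (\<integral>m. indicator C (X m) * (p m * ?q m) \<partial>M)" by (rule rectangle[OF C B])
        also have "\<dots> = (LINT m:S|M. p m * ?q m)"
          unfolding set_lebesgue_integral_def S by (intro Bochner_Integration.integral_cong) (auto simp: indicator_def)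
        finally show "(LINT m:S|M. indicator A (Y m) * indicator B (Z m) :: real) = (LINT m:S|M. p m * ?q m)" .
      next
        show "integrable M (\<lambda>m. indicator A (Y m) * indicator B (Z m) :: real)"
          by (rule integrable_AE_bounded[where B=1]) (auto simp: indicator_def)
        show "integrable M (\<lambda>m. p m * ?q m)"
          by (rule cond_exp_bounded(4)[OF F _ _ _ pM pb1]) (auto simp: indicator_def)
        show "(\<lambda>m. p m * ?q m) \<in> borel_measurable F" by measurable
      qed
    next
      fix D assume all: "\<forall>B\<in>sets MZ. AE m in M. ?E (\<lambda>m. indicator A (Y m) * indicator B (Z m)) m = p m * ?E (\<lambda>m. indicator B (Z m)) m"
        and D [measurable]: "D \<in> sets (MX \<Otimes>\<^sub>M MZ)"
      let ?h = "\<lambda>m. indicator A (Y m) - p m"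
      have iA: "integrable M (\<lambda>m. indicator A (Y m) :: real)"
        by (rule integrable_AE_bounded[where B=1]) (auto simp: indicator_def)
      have hint: "integrable M ?h" using iA pint by simp
      have split: "(\<integral>m. ?h m * indicator D (X m, Z m) \<partial>M) = (\<integral>m. indicator D (X m, Z m) * indicator A (Y m) \<partial>M) - (\<integral>m. indicator D (X m, Z m) * p m \<partial>M)"
        if [measurable]: "D \<in> sets (MX \<Otimes>\<^sub>M MZ)" for D
      proof -
        have "integrable M (\<lambda>m. indicator D (X m, Z m) * indicator A (Y m) :: real)"
          by (rule integrable_AE_bounded[where B=1]) (auto simp: indicator_def)
        moreover have "integrable M (\<lambda>m. indicator D (X m, Z m) * p m)"
          by (rule pb(4)) (auto simp: indicator_def)
        ultimately show ?thesis by (simp add: algebra_simps flip: Bochner_Integration.integral_diff)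
      qed
      have "(\<integral>m. ?h m * indicator D (X m, Z m) \<partial>M) = 0"
      proof (rule integral_indicator_zero_generator[where MT="MX \<Otimes>\<^sub>M MZ" and T="\<lambda>m. (X m, Z m)" and G="{a \<times> b | a b. a \<in> sets MX \<and> b \<in> sets MZ}"])
        show "sets (MX \<Otimes>\<^sub>M MZ) = sigma_sets (space (MX \<Otimes>\<^sub>M MZ)) {a \<times> b | a b. a \<in> sets MX \<and> b \<in> sets MZ}"
          by (simp add: sets_pair_measure space_pair_measure)
        show "Int_stable {a \<times> b | a b. a \<in> sets MX \<and> b \<in> sets MZ}" by (rule Int_stable_pair_measure_generator)
        show "{a \<times> b | a b. a \<in> sets MX \<and> b \<in> sets MZ} \<subseteq> Pow (space (MX \<Otimes>\<^sub>M MZ))"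
          by (simp add: space_pair_measure pair_measure_closed)
        have "(\<integral>m. p m \<partial>M) = (\<integral>m. indicator A (Y m) \<partial>M)"
          unfolding p_def by (rule F.real_cond_exp_int(2)[OF iA])
        then show "(\<integral>m. ?h m \<partial>M) = 0" using iA pint by simp
        fix R assume "R \<in> {a \<times> b | a b. a \<in> sets MX \<and> b \<in> sets MZ}"
        then obtain C B where R: "R = C \<times> B" and C [measurable]: "C \<in> sets MX" and B [measurable]: "B \<in> sets MZ" by blast
        let ?AB = "\<lambda>m. indicator A (Y m) * indicator B (Z m) :: real"
        have CF: "(\<lambda>m. indicator C (X m) :: real) \<in> borel_measurable F" using XF by measurable
        have "(\<integral>m. indicator R (X m, Z m) * indicator A (Y m) \<partial>M) = (\<integral>m. indicator C (X m) * ?AB m \<partial>M)"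
          unfolding R by (intro Bochner_Integration.integral_cong) (auto simp: indicator_def)
        also have "\<dots> = (\<integral>m. indicator C (X m) * ?E ?AB m \<partial>M)"
          by (rule cond_exp_bounded(6)[OF F _ _ _ CF, symmetric]) (auto simp: indicator_def)
        also have "\<dots> = (\<integral>m. indicator C (X m) * (p m * ?E (\<lambda>m. indicator B (Z m)) m) \<partial>M)"
        proof (rule integral_cong_AE)
          show "AE m in M. indicator C (X m) * ?E ?AB m = indicator C (X m) * (p m * ?E (\<lambda>m. indicator B (Z m)) m)"
            using all[THEN bspec, OF B] by eventually_elim simp
        qed measurable
        also have "\<dots> = (\<integral>m. indicator R (X m, Z m) * p m \<partial>M)" unfolding R by (rule rectangle[OF C B, symmetric])
        finally show "(\<integral>m. ?h m * indicator R (X m, Z m) \<partial>M) = 0"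
          by (subst split) (auto simp: R)
      qed (use hint in auto)
      then show "(\<integral>m. indicator D (X m, Z m) * indicator A (Y m) \<partial>M) = (\<integral>m. indicator D (X m, Z m) * p m \<partial>M)"
        by (simp add: split[OF D])
    qed
  qed
  show ?thesis
    unfolding cond_indep_def F_def[symmetric] using rect by blast
qed

text \<open>Pythagoras for nested projections: the coarser tail is measurable for the finer
  sigma-algebra, so its product with the finer tail integrates like its own square.\<close>

lemma (in prob_space) cond_var_diff:
  assumes F: "finite_measure_subalgebra M F" and G: "finite_measure_subalgebra M G" and sub: "subalgebra G F"
    and Y [measurable]: "Y \<in> borel_measurable M"
  shows "cond_var M F Y t - cond_var M G Y t = 2 * (\<integral>m. (cond_tail M G Y t m - cond_tail M F Y t m)\<^sup>2 \<partial>M)"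
    and "integrable M (\<lambda>m. (cond_tail M G Y t m - cond_tail M F Y t m)\<^sup>2)"
proof -
  let ?f = "cond_tail M F Y t" and ?g = "cond_tail M G Y t"
  note f = cond_tail_props[OF F Y, where t=t] and g = cond_tail_props[OF G Y, where t=t]
  note [measurable] = f(2) g(2)
  have f1: "AE m in M. \<bar>?f m\<bar> \<le> 1" using f(3) by eventually_elim auto
  have g1: "AE m in M. \<bar>?g m\<bar> \<le> 1" using g(3) by eventually_elim auto
  have int: "integrable M (\<lambda>m. u m * v m)"
    if [measurable]: "u \<in> borel_measurable M" "v \<in> borel_measurable M"
      and uv: "AE m in M. \<bar>u m\<bar> \<le> 1" "AE m in M. \<bar>v m\<bar> \<le> 1" for u v :: "'a \<Rightarrow> real"
  proof (rule integrable_AE_bounded)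
    show "AE m in M. \<bar>u m * v m\<bar> \<le> 1"
      using uv by eventually_elim (auto simp: abs_mult intro!: mult_le_one)
  qed measurable
  have fG: "?f \<in> borel_measurable G" by (rule measurable_from_subalg[OF sub f(1)])
  have cross: "(\<integral>m. ?f m * ?g m \<partial>M) = (\<integral>m. ?f m * ?f m \<partial>M)"
    using g(6)[OF fG f1] f(6)[OF f(1) f1] by simp
  have sq: "(?g m - ?f m)\<^sup>2 = ?g m * ?g m - 2 * (?f m * ?g m) + ?f m * ?f m" for m
    by (simp add: power2_eq_square algebra_simps)
  note ints = int[OF f(2) f(2) f1 f1] int[OF f(2) g(2) f1 g1] int[OF g(2) g(2) g1 g1]
  show "integrable M (\<lambda>m. (?g m - ?f m)\<^sup>2)" unfolding sq using ints by simp
  have "(\<integral>m. (?g m - ?f m)\<^sup>2 \<partial>M) = (\<integral>m. ?g m * ?g m \<partial>M) - (\<integral>m. ?f m * ?f m \<partial>M)"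
    unfolding sq using ints by (simp add: cross)
  then show "cond_var M F Y t - cond_var M G Y t = 2 * (\<integral>m. (?g m - ?f m)\<^sup>2 \<partial>M)"
    unfolding cond_var_eq(1)[OF F Y] cond_var_eq(1)[OF G Y] by (simp add: power2_eq_square)
qed

lemma (in prob_space) integral_cond_var_comparison:
  assumes X [measurable]: "X \<in> M \<rightarrow>\<^sub>M MX" and Y [measurable]: "Y \<in> M \<rightarrow>\<^sub>M MY" and Z [measurable]: "Z \<in> M \<rightarrow>\<^sub>M MZ"
    and iso: "borel_iso MY \<psi>"
  defines "F \<equiv> vimage_algebra (space M) X MX"
    and "G \<equiv> vimage_algebra (space M) (\<lambda>m. (X m, Z m)) (MX \<Otimes>\<^sub>M MZ)"
    and "Y' \<equiv> \<lambda>m. \<psi> (Y m)"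
  assumes measF [measurable]: "(\<lambda>m. cond_var M F Y' (Y' m)) \<in> borel_measurable M"
    and boundsF: "\<And>t. 0 \<le> cond_var M F Y' t \<and> cond_var M F Y' t \<le> 1"
    and measG [measurable]: "(\<lambda>m. cond_var M G Y' (Y' m)) \<in> borel_measurable M"
    and boundsG: "\<And>t. 0 \<le> cond_var M G Y' t \<and> cond_var M G Y' t \<le> 1"
  shows "(\<integral>m. cond_var M G Y' (Y' m) \<partial>M) \<le> (\<integral>m. cond_var M F Y' (Y' m) \<partial>M)"
    and "(\<integral>m. cond_var M G Y' (Y' m) \<partial>M) = (\<integral>m. cond_var M F Y' (Y' m) \<partial>M) \<longleftrightarrow> cond_indep M MX MY MZ X Y Z"
proof -
  have W: "(\<lambda>m. (X m, Z m)) \<in> M \<rightarrow>\<^sub>M MX \<Otimes>\<^sub>M MZ" by measurable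
  have F: "finite_measure_subalgebra M F" unfolding F_def by (rule finite_measure_subalgebra_vimage[OF X])
  have G: "finite_measure_subalgebra M G" unfolding G_def by (rule finite_measure_subalgebra_vimage[OF W])
  interpret F: finite_measure_subalgebra M F by fact
  interpret G: finite_measure_subalgebra M G by fact
  have Wsp: "(\<lambda>m. (X m, Z m)) \<in> space M \<rightarrow> space (MX \<Otimes>\<^sub>M MZ)" using measurable_space[OF W] by auto
  have WG: "(\<lambda>m. (X m, Z m)) \<in> G \<rightarrow>\<^sub>M MX \<Otimes>\<^sub>M MZ"
    unfolding G_def by (rule measurable_vimage_algebra1[OF Wsp])
  have XG: "X \<in> G \<rightarrow>\<^sub>M MX" using measurable_compose[OF WG measurable_fst] by simp
  have spG: "space G = space M" by (simp add: G_def)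
  have sub: "subalgebra G F"
    unfolding subalgebra_def using sets_image_in_sets[OF spG XG] by (simp add: F_def spG)
  have \<psi> [measurable]: "\<psi> \<in> borel_measurable MY" using iso by (simp add: borel_iso_def)
  have Y' [measurable]: "Y' \<in> borel_measurable M" unfolding Y'_def by measurable
  let ?f = "cond_tail M F Y'" and ?g = "cond_tail M G Y'"
  let ?VF = "\<lambda>m. cond_var M F Y' (Y' m)" and ?VG = "\<lambda>m. cond_var M G Y' (Y' m)"
  have intF: "integrable M ?VF" and intG: "integrable M ?VG"
    using boundsF boundsG by (auto intro!: integrable_AE_bounded[where B=1])
  have diff_nonneg: "0 \<le> cond_var M F Y' t - cond_var M G Y' t" for t
    unfolding cond_var_diff(1)[OF F G sub Y'] by simp
  then show "integral\<^sup>L M ?VG \<le> integral\<^sup>L M ?VF"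
    by (intro integral_mono intF intG) (simp add: algebra_simps)

  \<comment> \<open>Projecting the indicator of \<open>D\<close> instead of that of \<open>A\<close>
    leaves an integral that is linear in the indicator of \<open>A\<close>. With \<open>D\<close>
    fixed, the condition on \<open>A\<close> is therefore stable under complements and disjoint
    unions, and \<open>cond_exp_swap\<close> translates it back.\<close>
  define K where "K D = real_cond_exp M F (\<lambda>m. indicator D (X m, Z m))" for D
  define h where "h D m = indicator D (X m, Z m) - K D m" for D m
  have K [measurable]: "K D \<in> borel_measurable M" for D unfolding K_def by measurable
  have Kb: "AE m in M. \<bar>K D m\<bar> \<le> 1" "integrable M (K D)" if [measurable]: "D \<in> sets (MX \<Otimes>\<^sub>M MZ)" for D
    unfolding K_def by (rule cond_exp_bounded[OF F]; auto simp: indicator_def)+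
  have hint: "integrable M (h D)" and h0: "(\<integral>m. h D m \<partial>M) = 0" if D [measurable]: "D \<in> sets (MX \<Otimes>\<^sub>M MZ)" for D
  proof -
    have i: "integrable M (\<lambda>m. indicator D (X m, Z m) :: real)"
      by (rule integrable_AE_bounded[where B=1]) (auto simp: indicator_def)
    then show "integrable M (h D)" unfolding h_def using Kb(2)[OF D] by simp
    have "(\<integral>m. K D m \<partial>M) = (\<integral>m. indicator D (X m, Z m) \<partial>M)"
      unfolding K_def by (rule F.real_cond_exp_int(2)[OF i])
    then show "(\<integral>m. h D m \<partial>M) = 0" unfolding h_def using i Kb(2)[OF D] by simp
  qed
  have h_zero_iff: "(\<integral>m. h D m * u m \<partial>M) = 0 \<longleftrightarrow>
      (\<integral>m. indicator D (X m, Z m) * u m \<partial>M) = (\<integral>m. indicator D (X m, Z m) * real_cond_exp M F u m \<partial>M)"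
    if D [measurable]: "D \<in> sets (MX \<Otimes>\<^sub>M MZ)" and u [measurable]: "u \<in> borel_measurable M"
      and u01: "\<And>m. 0 \<le> u m" "\<And>m. u m \<le> 1" for D u
  proof -
    have "integrable M (\<lambda>m. indicator D (X m, Z m) * u m)"
      using u01 by (intro integrable_AE_bounded[where B=1]) (auto simp: indicator_def)
    moreover have "integrable M (\<lambda>m. u m * K D m)"
      unfolding K_def by (rule cond_exp_bounded(4)[OF F]) (use u01 in \<open>auto simp: indicator_def\<close>)
    moreover have "(\<integral>m. h D m * u m \<partial>M) = (\<integral>m. indicator D (X m, Z m) * u m - u m * K D m \<partial>M)"
      by (intro Bochner_Integration.integral_cong refl) (simp add: h_def algebra_simps)
    moreover have "(\<integral>m. u m * K D m \<partial>M) = (\<integral>m. indicator D (X m, Z m) * real_cond_exp M F u m \<partial>M)"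
      unfolding K_def by (rule cond_exp_swap[OF F u u01]) (auto simp: indicator_def)
    ultimately show ?thesis by simp
  qed
  define P where "P A \<longleftrightarrow> (\<forall>D\<in>sets (MX \<Otimes>\<^sub>M MZ). (\<integral>m. h D m * indicator A (Y' m) \<partial>M) = 0)" for A
  have tails: "(AE m in M. ?g t m = ?f t m) \<longleftrightarrow> P {t..}" for t
  proof
    let ?b = "\<lambda>m. indicator {t..} (Y' m) :: real"
    have b: "?b \<in> borel_measurable M" "\<And>m. 0 \<le> ?b m" "\<And>m. ?b m \<le> 1" by (auto simp: indicator_def)
    have P: "P {t..} \<longleftrightarrow> (\<forall>D\<in>sets (MX \<Otimes>\<^sub>M MZ). (\<integral>m. indicator D (X m, Z m) * ?b m \<partial>M) = (\<integral>m. indicator D (X m, Z m) * ?f t m \<partial>M))"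
      unfolding P_def cond_tail_def by (intro ball_cong refl h_zero_iff b)
    note f = cond_tail_props[OF F Y', where t=t] and g = cond_tail_props[OF G Y', where t=t]
    note [measurable] = f(2) g(2)
    {
      assume eq: "AE m in M. ?g t m = ?f t m"
      show "P {t..}"
        unfolding P
      proof
        fix D assume D [measurable]: "D \<in> sets (MX \<Otimes>\<^sub>M MZ)"
        have "(\<integral>m. indicator D (X m, Z m) * ?g t m \<partial>M) = (\<integral>m. indicator D (X m, Z m) * ?b m \<partial>M)"
          by (rule g(6)[OF measurable_compose[OF WG borel_measurable_indicator[OF D]]]) (auto simp: indicator_def)
        moreover have "(\<integral>m. indicator D (X m, Z m) * ?g t m \<partial>M) = (\<integral>m. indicator D (X m, Z m) * ?f t m \<partial>M)"
          using eq by (intro integral_cong_AE) auto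
        ultimately show "(\<integral>m. indicator D (X m, Z m) * ?b m \<partial>M) = (\<integral>m. indicator D (X m, Z m) * ?f t m \<partial>M)" by simp
      qed
    next
      assume all: "P {t..}"
      show "AE m in M. ?g t m = ?f t m"
        unfolding cond_tail_def[of M G]
      proof (rule G.real_cond_exp_charact)
        fix S assume "S \<in> sets G"
        then obtain D where D: "D \<in> sets (MX \<Otimes>\<^sub>M MZ)" and S: "S = (\<lambda>m. (X m, Z m)) -` D \<inter> space M"
          unfolding G_def sets_vimage_algebra2[OF Wsp] by auto
        have conv: "(LINT m:S|M. u m) = (\<integral>m. indicator D (X m, Z m) * u m \<partial>M)" for u :: "'a \<Rightarrow> real"
          unfolding set_lebesgue_integral_def S by (intro Bochner_Integration.integral_cong) (auto simp: indicator_def)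
        show "(LINT m:S|M. ?b m) = (LINT m:S|M. ?f t m)"
          unfolding conv using all D unfolding P by blast
      next
        show "integrable M ?b" using b by (intro integrable_AE_bounded[where B=1]) auto
        show "integrable M (?f t)" by (rule f(4))
        show "?f t \<in> borel_measurable G" by (rule measurable_from_subalg[OF sub f(1)])
      qed
    }
  qed
  \<comment> \<open>The gap at \<open>t\<close> is twice a squared L2 distance of the two tails; it
    vanishes exactly when conditioning on \<open>Z\<close> in addition to \<open>X\<close> does not
    change the tail at \<open>t\<close>.\<close>
  have var_eq_iff: "cond_var M F Y' t - cond_var M G Y' t = 0 \<longleftrightarrow> P {t..}" for t
  proof -
    have "cond_var M F Y' t - cond_var M G Y' t = 0 \<longleftrightarrow> (AE m in M. (?g t m - ?f t m)\<^sup>2 = 0)"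
      unfolding cond_var_diff(1)[OF F G sub Y'] using cond_var_diff(2)[OF F G sub Y', of t]
      by (simp add: integral_nonneg_eq_0_iff_AE)
    then show ?thesis using tails by simp
  qed
  have "integral\<^sup>L M ?VG = integral\<^sup>L M ?VF \<longleftrightarrow> (\<integral>m. ?VF m - ?VG m \<partial>M) = 0"
    using intF intG by auto
  also have "\<dots> \<longleftrightarrow> (AE m in M. ?VF m - ?VG m = 0)"
    using diff_nonneg intF intG by (intro integral_nonneg_eq_0_iff_AE) auto
  also have "\<dots> \<longleftrightarrow> (AE m in M. P {Y' m..})" by (simp only: var_eq_iff)
  also have "\<dots> \<longleftrightarrow> (\<forall>A\<in>sets borel. P A)"
  proof (intro iffI ballI)
    fix A :: "real set" assume AE: "AE m in M. P {Y' m..}" and A: "A \<in> sets borel"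
    show "P A"
    proof (rule half_lines_AE_induct[where M=M and Y=Y' and P=P, OF AE _ _ _ _ A])
      show "P {}" by (simp add: P_def)
    next
      fix A :: "real set" assume "A \<in> sets borel" "P A"
      then show "P (- A)"
        unfolding P_def using integral_indicator_compl_zero[OF hint Y' _ h0, of _ A]
        by (simp add: Compl_eq_Diff_UNIV)
    next
      fix A :: "nat \<Rightarrow> real set" assume "\<And>i. A i \<in> sets borel" "disjoint_family A" "\<And>i. P (A i)"
      then show "P (\<Union>i. A i)"
        unfolding P_def using integral_indicator_UN_zero[OF hint Y', of _ A] by blast
    next
      fix A B :: "real set" assume [measurable]: "A \<in> sets borel" "B \<in> sets borel"
        and PA: "P A" and AB: "AE m in M. Y' m \<in> A \<longleftrightarrow> Y' m \<in> B"
      show "P B"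
        unfolding P_def
      proof
        fix D assume D: "D \<in> sets (MX \<Otimes>\<^sub>M MZ)"
        note [measurable] = borel_measurable_integrable[OF hint[OF D]]
        have "(\<integral>m. h D m * indicator B (Y' m) \<partial>M) = (\<integral>m. h D m * indicator A (Y' m) \<partial>M)"
        proof (rule integral_cong_AE)
          show "AE m in M. h D m * indicator B (Y' m) = h D m * indicator A (Y' m)"
            using AB by eventually_elim (auto simp: indicator_def)
        qed measurable
        then show "(\<integral>m. h D m * indicator B (Y' m) \<partial>M) = 0" using PA D unfolding P_def by simp
      qed
    qed
  qed auto
  also have "\<dots> \<longleftrightarrow> (\<forall>A\<in>sets MY. \<forall>D\<in>sets (MX \<Otimes>\<^sub>M MZ). (\<integral>m. h D m * indicator A (Y m) \<partial>M) = 0)"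
  proof (intro iffI ballI)
    fix A D assume all: "\<forall>A\<in>sets borel. P A" and A: "A \<in> sets MY" and D: "D \<in> sets (MX \<Otimes>\<^sub>M MZ)"
    \<comment> \<open>The left inverse \<open>\<rho>\<close> turns an event of \<open>Y\<close> into
      a Borel event of its real code; the converse direction pulls back along
      \<open>\<psi>\<close>.\<close>
    have "space MY \<noteq> {}" using not_empty measurable_space[OF Y] by blast
    then obtain \<rho> where \<rho>: "\<rho> \<in> borel \<rightarrow>\<^sub>M MY" "\<And>y. y \<in> space MY \<Longrightarrow> \<rho> (\<psi> y) = y"
      using borel_iso_inverse[OF iso] by blast
    have "\<rho> -` A \<in> sets borel" using measurable_sets[OF \<rho>(1) A] by simp
    then have "(\<integral>m. h D m * indicator (\<rho> -` A) (Y' m) \<partial>M) = 0" using all D unfolding P_def by blast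
    also have "(\<integral>m. h D m * indicator (\<rho> -` A) (Y' m) \<partial>M) = (\<integral>m. h D m * indicator A (Y m) \<partial>M)"
      using \<rho>(2) measurable_space[OF Y]
      by (intro Bochner_Integration.integral_cong) (auto simp: Y'_def indicator_def)
    finally show "(\<integral>m. h D m * indicator A (Y m) \<partial>M) = 0" .
  next
    fix B :: "real set" assume all: "\<forall>A\<in>sets MY. \<forall>D\<in>sets (MX \<Otimes>\<^sub>M MZ). (\<integral>m. h D m * indicator A (Y m) \<partial>M) = 0"
      and B: "B \<in> sets borel"
    show "P B"
      unfolding P_def
    proof
      fix D assume D: "D \<in> sets (MX \<Otimes>\<^sub>M MZ)"
      have "(\<integral>m. h D m * indicator B (Y' m) \<partial>M) = (\<integral>m. h D m * indicator (\<psi> -` B \<inter> space MY) (Y m) \<partial>M)"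
        using measurable_space[OF Y]
        by (intro Bochner_Integration.integral_cong) (auto simp: Y'_def indicator_def)
      then show "(\<integral>m. h D m * indicator B (Y' m) \<partial>M) = 0"
        using all D measurable_sets[OF \<psi> B] by simp
    qed
  qed
  also have "\<dots> \<longleftrightarrow> cond_indep M MX MY MZ X Y Z"
    unfolding cond_indep_iff_integral[OF X Y Z] F_def[symmetric]
    by (intro ball_cong refl h_zero_iff) (auto simp: indicator_def)
  finally show "integral\<^sup>L M ?VG = integral\<^sup>L M ?VF \<longleftrightarrow> cond_indep M MX MY MZ X Y Z" .
qed

section \<open>Both coefficients on one sample\<close>

lemma distr_scores:
  assumes M: "prob_space M" and S: "prob_space S" and N: "prob_space N"
    and T: "T \<in> M \<rightarrow>\<^sub>M MT" and R: "R \<in> N \<rightarrow>\<^sub>M MT \<Otimes>\<^sub>M S'" and sets_S: "sets S = sets S'"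
    and law: "distr N (MT \<Otimes>\<^sub>M S') R = distr M MT T \<Otimes>\<^sub>M S"
    and f: "f \<in> borel_measurable (MT \<Otimes>\<^sub>M S')"
  shows "distr N borel (\<lambda>\<omega>. f (R \<omega>)) = distr (M \<Otimes>\<^sub>M S) borel (\<lambda>(m, s). f (T m, s))"
proof -
  interpret S: prob_space S by fact
  \<comment> \<open>\<open>S\<close> carries the tag law, while \<open>S'\<close> is only the
    measurable space on which it lives. The identity between them lets the law of a pair be
    rewritten as an image of the product measure.\<close>
  have ident: "(\<lambda>s. s) \<in> S \<rightarrow>\<^sub>M S'" using sets_S by (simp add: measurable_cong_sets[OF refl sets_S[symmetric]])
  have S_eq: "distr S S' (\<lambda>s. s) = S" using sets_S by (intro measure_eqI) (auto simp: emeasure_distr ident)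
  have pm: "(\<lambda>(m, s). (T m, s)) \<in> M \<Otimes>\<^sub>M S \<rightarrow>\<^sub>M MT \<Otimes>\<^sub>M S'"
    using T ident by measurable
  have "distr N borel (\<lambda>\<omega>. f (R \<omega>)) = distr (distr N (MT \<Otimes>\<^sub>M S') R) borel f"
    by (subst distr_distr[OF f R]) (simp add: comp_def)
  also have "distr N (MT \<Otimes>\<^sub>M S') R = distr M MT T \<Otimes>\<^sub>M distr S S' (\<lambda>s. s)"
    unfolding S_eq by (rule law)
  also have "\<dots> = distr (M \<Otimes>\<^sub>M S) (MT \<Otimes>\<^sub>M S') (\<lambda>(m, s). (T m, s))"
    by (rule pair_measure_distr[OF T ident]) (simp only: S_eq S.sigma_finite_measure_axioms)
  also have "distr \<dots> borel f = distr (M \<Otimes>\<^sub>M S) borel (\<lambda>(m, s). f (T m, s))"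
    by (subst distr_distr[OF f pm]) (simp add: comp_def case_prod_beta')
  finally show ?thesis .
qed

theorem mainTheorem2:
  fixes M :: "'a measure" and N :: "'b measure"
    and MX :: "'x measure" and MY :: "'y measure" and MZ :: "'z measure"
    and X :: "'a \<Rightarrow> 'x" and Y :: "'a \<Rightarrow> 'y" and Z :: "'a \<Rightarrow> 'z"
    and Xs :: "nat \<Rightarrow> 'b \<Rightarrow> 'x" and Ys :: "nat \<Rightarrow> 'b \<Rightarrow> 'y" and Zs :: "nat \<Rightarrow> 'b \<Rightarrow> 'z"
    and U V :: "nat \<Rightarrow> 'b \<Rightarrow> real"
    and \<phi> :: "'x \<Rightarrow> real" and \<psi> :: "'y \<Rightarrow> real" and \<delta> :: "'x \<times> 'z \<Rightarrow> real"
  assumes sbX: "standard_borel TYPE('px::polish_space) MX"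
    and sbY: "standard_borel TYPE('py::polish_space) MY"
    and sbZ: "standard_borel TYPE('pz::polish_space) MZ"
    and M: "prob_space M"
    and X: "X \<in> M \<rightarrow>\<^sub>M MX" and Y: "Y \<in> M \<rightarrow>\<^sub>M MY" and Z: "Z \<in> M \<rightarrow>\<^sub>M MZ"
    and iso_phi: "borel_iso MX \<phi>" and iso_psi: "borel_iso MY \<psi>"
    and iso_delta: "borel_iso (MX \<Otimes>\<^sub>M MZ) \<delta>"
    and N: "prob_space N"
    and meas: "\<And>i. Xs i \<in> N \<rightarrow>\<^sub>M MX" "\<And>i. Ys i \<in> N \<rightarrow>\<^sub>M MY" "\<And>i. Zs i \<in> N \<rightarrow>\<^sub>M MZ"
              "\<And>i. U i \<in> borel_measurable N" "\<And>i. V i \<in> borel_measurable N"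
    and indep: "prob_space.indep_vars N (\<lambda>i. (MX \<Otimes>\<^sub>M MY \<Otimes>\<^sub>M MZ) \<Otimes>\<^sub>M (borel \<Otimes>\<^sub>M borel))
                  (\<lambda>i \<omega>. ((Xs i \<omega>, Ys i \<omega>, Zs i \<omega>), (U i \<omega>, V i \<omega>))) UNIV"
    and distr: "\<And>i. distr N ((MX \<Otimes>\<^sub>M MY \<Otimes>\<^sub>M MZ) \<Otimes>\<^sub>M (borel \<Otimes>\<^sub>M borel))
                  (\<lambda>\<omega>. ((Xs i \<omega>, Ys i \<omega>, Zs i \<omega>), (U i \<omega>, V i \<omega>)))
                = distr M (MX \<Otimes>\<^sub>M MY \<Otimes>\<^sub>M MZ) (\<lambda>\<omega>. (X \<omega>, Y \<omega>, Z \<omega>)) \<Otimes>\<^sub>M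
                  (uniform_measure lborel {0..1::real} \<Otimes>\<^sub>M uniform_measure lborel {0..1::real})"
    and nonfun: "\<not> (\<exists>f \<in> MX \<rightarrow>\<^sub>M MY. AE \<omega> in M. Y \<omega> = f (X \<omega>))"
  shows "\<exists>c \<in> {0..1::real}.
           (AE \<omega> in N.
              (\<lambda>n. xi_cond
                    (chatterjee_xi n (\<lambda>i. \<phi> (Xs i \<omega>)) (\<lambda>i. \<psi> (Ys i \<omega>)) (\<lambda>i. U i \<omega>))
                    (chatterjee_xi n (\<lambda>i. \<delta> (Xs i \<omega>, Zs i \<omega>)) (\<lambda>i. \<psi> (Ys i \<omega>)) (\<lambda>i. V i \<omega>)))
              \<longlonglongrightarrow> c)
         \<and> (c = 0 \<longleftrightarrow> cond_indep M MX MY MZ X Y Z)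
         \<and> (c = 1 \<longleftrightarrow> (\<exists>g \<in> MX \<Otimes>\<^sub>M MZ \<rightarrow>\<^sub>M MY. AE \<omega> in M. Y \<omega> = g (X \<omega>, Z \<omega>)))"
proof -
  interpret M: prob_space M by fact
  interpret N: prob_space N by fact
  define unif where "unif = uniform_measure lborel {0..1::real}"
  have unif: "prob_space unif" unfolding unif_def by (rule prob_space_uniform_measure) auto
  define S where "S = unif \<Otimes>\<^sub>M unif"
  interpret unif2: pair_prob_space unif unif using unif by (intro pair_prob_space.intro pair_sigma_finite.intro prob_space_imp_sigma_finite)
  have S: "prob_space S" unfolding S_def by (rule unif2.prob_space_axioms)
  have sets_S: "sets S = sets (borel \<Otimes>\<^sub>M borel)"
    unfolding S_def unif_def by (intro sets_pair_measure_cong) auto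
  let ?MT = "MX \<Otimes>\<^sub>M MY \<Otimes>\<^sub>M MZ"
  let ?R = "\<lambda>i \<omega>. ((Xs i \<omega>, Ys i \<omega>, Zs i \<omega>), (U i \<omega>, V i \<omega>))"
  note [measurable] = X Y Z meas
  have \<phi> [measurable]: "\<phi> \<in> borel_measurable MX" and \<psi> [measurable]: "\<psi> \<in> borel_measurable MY"
    and \<delta> [measurable]: "\<delta> \<in> borel_measurable (MX \<Otimes>\<^sub>M MZ)"
    using iso_phi iso_psi iso_delta by (simp_all add: borel_iso_def)
  define Y' where "Y' = (\<lambda>m. \<psi> (Y m))"
  have Y': "Y' \<in> borel_measurable M" unfolding Y'_def by measurable
  have W: "(\<lambda>m. (X m, Z m)) \<in> M \<rightarrow>\<^sub>M MX \<Otimes>\<^sub>M MZ" by measurable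
  have R: "?R i \<in> N \<rightarrow>\<^sub>M ?MT \<Otimes>\<^sub>M (borel \<Otimes>\<^sub>M borel)" for i by measurable
  \<comment> \<open>One statement for both coefficients: \<open>\<kappa>\<close> reads the key from
    the pair \<open>(x, z)\<close> and \<open>\<tau>\<close> picks one of the two tags. It is used
    with \<open>\<phi>\<close> of the first component and the first tag, and with
    \<open>\<delta>\<close> and the second tag.\<close>
  have limits: "AE \<omega> in N. (\<lambda>n. xi_num n (\<lambda>i. \<kappa> (Xs i \<omega>, Zs i \<omega>)) (\<lambda>i. \<psi> (Ys i \<omega>)) (\<lambda>i. \<tau> (U i \<omega>, V i \<omega>)) / (real n)\<^sup>2)
        \<longlonglongrightarrow> (\<integral>m. cond_var M F Y' (Y' m) \<partial>M)"
      "(\<lambda>m. cond_var M F Y' (Y' m)) \<in> borel_measurable M"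
      "\<And>t. 0 \<le> cond_var M F Y' t \<and> cond_var M F Y' t \<le> 1"
    if \<kappa> [measurable]: "\<kappa> \<in> borel_measurable (MX \<Otimes>\<^sub>M MZ)" and \<tau> [measurable]: "\<tau> \<in> borel_measurable (borel \<Otimes>\<^sub>M borel)"
      and F: "F = vimage_algebra (space M) (\<lambda>m. \<kappa> (X m, Z m)) borel" for \<kappa> \<tau> F
  proof -
    let ?f = "\<lambda>q. (\<kappa> (fst (fst q), snd (snd (fst q))), \<psi> (fst (snd (fst q))), \<tau> (snd q))"
    have f: "?f \<in> borel_measurable (?MT \<Otimes>\<^sub>M (borel \<Otimes>\<^sub>M borel))"
      unfolding borel_prod[symmetric] by measurable
    have Km: "(\<lambda>m. \<kappa> (X m, Z m)) \<in> borel_measurable M" by measurable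
    have \<tau>S: "\<tau> \<in> borel_measurable S" using \<tau> by (simp add: measurable_cong_sets[OF sets_S refl])
    have rv: "(\<lambda>\<omega>. ?f (?R i \<omega>)) \<in> borel_measurable N" for i by (rule measurable_compose[OF R f])
    have ind: "N.indep_vars (\<lambda>_. borel) (\<lambda>i \<omega>. ?f (?R i \<omega>)) UNIV"
      by (rule N.indep_vars_compose2[OF indep]) (rule f)
    have XYZ: "(\<lambda>m. (X m, Y m, Z m)) \<in> M \<rightarrow>\<^sub>M ?MT" by measurable
    have law: "distr N borel (\<lambda>\<omega>. ?f (?R i \<omega>)) = distr (M \<Otimes>\<^sub>M S) borel (\<lambda>(m, s). (\<kappa> (X m, Z m), Y' m, \<tau> s))" for i
      using distr_scores[OF M S N XYZ R sets_S _ f] distr[of i]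
      by (simp add: S_def unif_def Y'_def)
    note lim = xi_num_limit[OF M Km Y' S \<tau>S N rv ind law, folded F]
    show "AE \<omega> in N. (\<lambda>n. xi_num n (\<lambda>i. \<kappa> (Xs i \<omega>, Zs i \<omega>)) (\<lambda>i. \<psi> (Ys i \<omega>)) (\<lambda>i. \<tau> (U i \<omega>, V i \<omega>)) / (real n)\<^sup>2)
        \<longlonglongrightarrow> (\<integral>m. cond_var M F Y' (Y' m) \<partial>M)"
      using lim(1) by simp
    show "(\<lambda>m. cond_var M F Y' (Y' m)) \<in> borel_measurable M" by (rule lim(2))
    show "\<And>t. 0 \<le> cond_var M F Y' t \<and> cond_var M F Y' t \<le> 1" by (rule lim(3))
  qed
  define F where "F = vimage_algebra (space M) X MX"
  define G where "G = vimage_algebra (space M) (\<lambda>m. (X m, Z m)) (MX \<Otimes>\<^sub>M MZ)"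
  have F_eq: "F = vimage_algebra (space M) (\<lambda>m. (\<lambda>(x, z). \<phi> x) (X m, Z m)) borel"
    unfolding F_def using vimage_algebra_borel_iso[OF iso_phi X M.not_empty] by simp
  have G_eq: "G = vimage_algebra (space M) (\<lambda>m. \<delta> (X m, Z m)) borel"
    unfolding G_def by (rule vimage_algebra_borel_iso[OF iso_delta W M.not_empty, symmetric])
  have pre: "(\<lambda>(x, z). \<phi> x) \<in> borel_measurable (MX \<Otimes>\<^sub>M MZ)" by measurable
  define LX where "LX = (\<integral>m. cond_var M F Y' (Y' m) \<partial>M)"
  define LW where "LW = (\<integral>m. cond_var M G Y' (Y' m) \<partial>M)"
  have mF: "(\<lambda>m. cond_var M F Y' (Y' m)) \<in> borel_measurable M" and bF: "\<And>t. 0 \<le> cond_var M F Y' t \<and> cond_var M F Y' t \<le> 1"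
    using limits(2,3)[OF pre measurable_fst F_eq] by auto
  have mG: "(\<lambda>m. cond_var M G Y' (Y' m)) \<in> borel_measurable M" and bG: "\<And>t. 0 \<le> cond_var M G Y' t \<and> cond_var M G Y' t \<le> 1"
    using limits(2,3)[OF \<delta> measurable_snd G_eq] by auto
  have LX0: "LX = 0 \<longleftrightarrow> (\<exists>f\<in>MX \<rightarrow>\<^sub>M MY. AE m in M. Y m = f (X m))"
    unfolding LX_def F_def Y'_def
    by (rule M.integral_cond_var_zero_iff[OF X Y iso_psi mF[unfolded F_def Y'_def] bF[unfolded F_def Y'_def]])
  have LW0: "LW = 0 \<longleftrightarrow> (\<exists>g\<in>MX \<Otimes>\<^sub>M MZ \<rightarrow>\<^sub>M MY. AE m in M. Y m = g (X m, Z m))"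
    unfolding LW_def G_def Y'_def
    by (rule M.integral_cond_var_zero_iff[OF W Y iso_psi mG[unfolded G_def Y'_def] bG[unfolded G_def Y'_def]])
  have comparison: "LW \<le> LX" "LW = LX \<longleftrightarrow> cond_indep M MX MY MZ X Y Z"
    unfolding LX_def LW_def F_def G_def Y'_def
    by (rule M.integral_cond_var_comparison[OF X Y Z iso_psi mF[unfolded F_def Y'_def] bF[unfolded F_def Y'_def]
      mG[unfolded G_def Y'_def] bG[unfolded G_def Y'_def]])+
  have LW_nonneg: "0 \<le> LW" unfolding LW_def using bG by (intro integral_nonneg_AE) auto
  \<comment> \<open>Here the assumption that Y is not a function of X enters: it keeps the limiting
    denominator away from zero.\<close>
  have "\<not> LX = 0" unfolding LX0 by (rule nonfun)
  with LW_nonneg comparison(1) have LX_pos: "0 < LX" by linarith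
  define c where "c = 1 - LW / LX"
  have c01: "c \<in> {0..1}" using LX_pos LW_nonneg comparison(1) by (auto simp: c_def)
  have c0: "c = 0 \<longleftrightarrow> cond_indep M MX MY MZ X Y Z"
    unfolding comparison(2)[symmetric] c_def using LX_pos by auto
  have c1: "c = 1 \<longleftrightarrow> (\<exists>g\<in>MX \<Otimes>\<^sub>M MZ \<rightarrow>\<^sub>M MY. AE \<omega> in M. Y \<omega> = g (X \<omega>, Z \<omega>))"
    unfolding LW0[symmetric] c_def using LX_pos by auto
  have conv: "AE \<omega> in N. (\<lambda>n. xi_cond
      (chatterjee_xi n (\<lambda>i. \<phi> (Xs i \<omega>)) (\<lambda>i. \<psi> (Ys i \<omega>)) (\<lambda>i. U i \<omega>))
      (chatterjee_xi n (\<lambda>i. \<delta> (Xs i \<omega>, Zs i \<omega>)) (\<lambda>i. \<psi> (Ys i \<omega>)) (\<lambda>i. V i \<omega>))) \<longlonglongrightarrow> c"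
    using limits(1)[OF pre measurable_fst F_eq] limits(1)[OF \<delta> measurable_snd G_eq]
  proof eventually_elim
    case (elim \<omega>)
    let ?a = "\<lambda>n. xi_num n (\<lambda>i. \<phi> (Xs i \<omega>)) (\<lambda>i. \<psi> (Ys i \<omega>)) (\<lambda>i. U i \<omega>)"
    let ?b = "\<lambda>n. xi_num n (\<lambda>i. \<delta> (Xs i \<omega>, Zs i \<omega>)) (\<lambda>i. \<psi> (Ys i \<omega>)) (\<lambda>i. V i \<omega>)"
    have a: "(\<lambda>n. ?a n / (real n)\<^sup>2) \<longlonglongrightarrow> LX" and b: "(\<lambda>n. ?b n / (real n)\<^sup>2) \<longlonglongrightarrow> LW"
      using elim by (simp_all add: LX_def LW_def)
    have "(\<lambda>n. 1 - (?b n / (real n)\<^sup>2) / (?a n / (real n)\<^sup>2)) \<longlonglongrightarrow> c"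
      unfolding c_def using LX_pos by (intro tendsto_intros a b) auto
    moreover have "eventually (\<lambda>n. 1 - (?b n / (real n)\<^sup>2) / (?a n / (real n)\<^sup>2) =
        xi_cond (chatterjee_xi n (\<lambda>i. \<phi> (Xs i \<omega>)) (\<lambda>i. \<psi> (Ys i \<omega>)) (\<lambda>i. U i \<omega>))
          (chatterjee_xi n (\<lambda>i. \<delta> (Xs i \<omega>, Zs i \<omega>)) (\<lambda>i. \<psi> (Ys i \<omega>)) (\<lambda>i. V i \<omega>))) sequentially"
      \<comment> \<open>Eventually the numerator for X is positive, which forces \<open>n\<close> to
        be nonzero as well. From then on no division by zero occurs and the factors \<open>n\<close>
        squared cancel.\<close>
      using order_tendstoD(1)[OF a LX_pos]
    proof eventually_elim
      case (elim n)
      then have "?a n \<noteq> 0" "n \<noteq> 0" by (auto intro: Nat.gr0I)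
      then show ?case by (simp add: xi_cond_eq)
    qed
    ultimately show ?case by (rule Lim_transform_eventually)
  qed
  show ?thesis using c01 conv c0 c1 by (intro bexI[of _ c] conjI)
qed

end
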